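(* Let $\omega\in\mathbb C$. For any integers $m,n\geq 0$, the $\mathfrak K_\omega$-module $L_m\otimes L_n$ (with $\mathfrak K_\omega$ acting via the comultiplication $\Delta$) is isomorphic to $\bigoplus_{p=0}^{\min\{m,n\}}L_{m+n-2p}$.
   Context: All algebras are unital associative over $\mathbb C$ and $[x,y]=xy-yx$. $\mathrm U(\mathfrak{sl}_2)$ is the algebra generated by $E,F,H$ with $[H,E]=2E$, $[H,F]=-2F$, $[E,F]=H$. For $\omega\in\mathbb C$, $\mathfrak K_\omega$ is the algebra generated by $A,B$ subject to $A^2B-2ABA+BA^2=B+\omega A$ and $B^2A-2BAB+AB^2=A+\omega B$, and $C=[A,B]$. The comultiplication $\Delta\colon\mathfrak K_\omega\to\mathfrak K_\omega\otimes\mathfrak K_\omega$ is the algebra homomorphism with $\Delta(X)=X\otimes1+1\otimes X$ for $X\in\{A,B,C\}$; a tensor product of $\mathfrak K_\omega$-modules is a $\mathfrak K_\omega$-module via $\Delta$. There is an algebra homomorphism $\zeta\colon\mathfrak K_\omega\to\mathrm U(\mathfrak{sl}_2)$ with $A\mapsto \frac{1+\omega}{2}E+\frac{1-\omega}{2}F-\frac{\omega}{2}H$, $B\mapsto \frac12H$. For $n\ge0$, $L_n$ is the $(n+1)$-dimensional $\mathrm U(\mathfrak{sl}_2)$-module with basis $v_0,\dots,v_n$ where $Ev_i=(n-i+1)v_{i-1}$ ($1\le i\le n$), $Ev_0=0$, $Fv_i=(i+1)v_{i+1}$ ($0\le i\le n-1$), $Fv_n=0$, $Hv_i=(n-2i)v_i$;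 it is regarded as a $\mathfrak K_\omega$-module by pulling back via $\zeta$. *)

theory Defs
  imports Complex_Main "HOL-Library.Poly_Mapping" "HOL-Algebra.Module" "HOL-Algebra.QuotRing"
begin

section \<open>Algebras and modules over the complex numbers\<close>

definition complex_field :: "complex ring"
  where "complex_field = \<lparr>carrier = UNIV, mult = (*), one = 1, zero = 0, add = (+)\<rparr>"

text \<open>
  A complex vector space is a \<^typ>\<open>(complex, 'v) module\<close> record \<open>V\<close> with \<open>module complex_field V\<close>;
  its ring fields \<open>mult\<close> and \<open>one\<close> carry no meaning. For an algebra they are the ring structure.
  The library's locale \<^locale>\<open>algebra\<close> covers commutative algebras only.
\<close>

locale complex_algebra =
  fixes A :: "(complex, 'a, 'm) module_scheme" (structure)
  assumes ring: "ring A"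
    and vector_space: "module complex_field A"
    and smult_mult_left: "\<lbrakk>x \<in> carrier A; y \<in> carrier A\<rbrakk> \<Longrightarrow> (c \<odot> x) \<otimes> y = c \<odot> (x \<otimes> y)"
    and smult_mult_right: "\<lbrakk>x \<in> carrier A; y \<in> carrier A\<rbrakk> \<Longrightarrow> x \<otimes> (c \<odot> y) = c \<odot> (x \<otimes> y)"

definition algebra_hom ::
    "(complex, 'a, 'm) module_scheme \<Rightarrow> (complex, 'b, 'n) module_scheme \<Rightarrow> ('a \<Rightarrow> 'b) set"
  where "algebra_hom A B =
    {f \<in> ring_hom A B. \<forall>c. \<forall>x \<in> carrier A. f (c \<odot>\<^bsub>A\<^esub> x) = c \<odot>\<^bsub>B\<^esub> f x}"

record ('a, 'v) alg_module = "(complex, 'v) module" +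
  act :: "'a \<Rightarrow> 'v \<Rightarrow> 'v"

locale left_module =
  fixes A :: "(complex, 'a, 'm) module_scheme" and M :: "('a, 'v, 'n) alg_module_scheme"
  assumes algebra: "complex_algebra A"
    and vector_space: "module complex_field M"
    and act_closed: "\<lbrakk>a \<in> carrier A; x \<in> carrier M\<rbrakk> \<Longrightarrow> act M a x \<in> carrier M"
    and act_add_left: "\<lbrakk>a \<in> carrier A; b \<in> carrier A; x \<in> carrier M\<rbrakk> \<Longrightarrow>
      act M (a \<oplus>\<^bsub>A\<^esub> b) x = act M a x \<oplus>\<^bsub>M\<^esub> act M b x"
    and act_add_right: "\<lbrakk>a \<in> carrier A; x \<in> carrier M; y \<in> carrier M\<rbrakk> \<Longrightarrow>
      act M a (x \<oplus>\<^bsub>M\<^esub> y) = act M a x \<oplus>\<^bsub>M\<^esub> act M a y"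
    and act_smult_left: "\<lbrakk>a \<in> carrier A; x \<in> carrier M\<rbrakk> \<Longrightarrow>
      act M (c \<odot>\<^bsub>A\<^esub> a) x = c \<odot>\<^bsub>M\<^esub> act M a x"
    and act_smult_right: "\<lbrakk>a \<in> carrier A; x \<in> carrier M\<rbrakk> \<Longrightarrow>
      act M a (c \<odot>\<^bsub>M\<^esub> x) = c \<odot>\<^bsub>M\<^esub> act M a x"
    and act_mult: "\<lbrakk>a \<in> carrier A; b \<in> carrier A; x \<in> carrier M\<rbrakk> \<Longrightarrow>
      act M (a \<otimes>\<^bsub>A\<^esub> b) x = act M a (act M b x)"
    and act_one: "x \<in> carrier M \<Longrightarrow> act M \<one>\<^bsub>A\<^esub> x = x"

definition alg_module_hom ::
    "(complex, 'a, 'm) module_scheme \<Rightarrow> ('a, 'v, 'n) alg_module_scheme \<Rightarrow>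
     ('a, 'w, 'o) alg_module_scheme \<Rightarrow> ('v \<Rightarrow> 'w) set"
  where "alg_module_hom A M N = {f \<in> carrier M \<rightarrow> carrier N.
    (\<forall>x \<in> carrier M. \<forall>y \<in> carrier M. f (x \<oplus>\<^bsub>M\<^esub> y) = f x \<oplus>\<^bsub>N\<^esub> f y) \<and>
    (\<forall>c. \<forall>x \<in> carrier M. f (c \<odot>\<^bsub>M\<^esub> x) = c \<odot>\<^bsub>N\<^esub> f x) \<and>
    (\<forall>a \<in> carrier A. \<forall>x \<in> carrier M. f (act M a x) = act N a (f x))}"

definition alg_module_isomorphic ::
    "(complex, 'a, 'm) module_scheme \<Rightarrow> ('a, 'v, 'n) alg_module_scheme \<Rightarrow>
     ('a, 'w, 'o) alg_module_scheme \<Rightarrow> bool"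
  where "alg_module_isomorphic A M N \<longleftrightarrow> left_module A M \<and> left_module A N \<and>
    (\<exists>f \<in> alg_module_hom A M N. bij_betw f (carrier M) (carrier N))"

definition with_action :: "(complex, 'v, 'm) module_scheme \<Rightarrow> ('a \<Rightarrow> 'v \<Rightarrow> 'v) \<Rightarrow> ('a, 'v) alg_module"
  where "with_action V \<rho> =
    \<lparr>carrier = carrier V, mult = mult V, one = one V, zero = zero V, add = add V,
     smult = smult V, act = \<rho>\<rparr>"

definition pullback :: "('a \<Rightarrow> 'b) \<Rightarrow> ('b, 'v, 'm) alg_module_scheme \<Rightarrow> ('a, 'v) alg_module"
  where "pullback f M = with_action M (\<lambda>a. act M (f a))"

definition direct_sum :: "'i set \<Rightarrow> ('i \<Rightarrow> ('a, 'v, 'm) alg_module_scheme) \<Rightarrow> ('a, 'i \<Rightarrow> 'v) alg_module"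
  where "direct_sum I M =
    \<lparr>carrier = {x \<in> \<Pi>\<^sub>E i\<in>I. carrier (M i). finite {i \<in> I. x i \<noteq> \<zero>\<^bsub>M i\<^esub>}},
     mult = undefined, one = undefined,
     zero = (\<lambda>i\<in>I. \<zero>\<^bsub>M i\<^esub>),
     add = (\<lambda>x y. \<lambda>i\<in>I. x i \<oplus>\<^bsub>M i\<^esub> y i),
     smult = (\<lambda>c x. \<lambda>i\<in>I. c \<odot>\<^bsub>M i\<^esub> x i),
     act = (\<lambda>a x. \<lambda>i\<in>I. act (M i) a (x i))\<rparr>"


section \<open>Free objects and quotients\<close>

definition free_space :: "'x set \<Rightarrow> (complex, 'x \<Rightarrow>\<^sub>0 complex) module"
  where "free_space X =
    \<lparr>carrier = {p. Poly_Mapping.keys p \<subseteq> X}, mult = undefined, one = undefined, zero = 0, add = (+),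
     smult = (\<lambda>c. Poly_Mapping.map ((*) c))\<rparr>"

text \<open>The linear map from a free vector space to \<open>V\<close> that extends a map \<open>f\<close> of the basis.\<close>

definition linear_extension ::
    "(complex, 'v, 'm) module_scheme \<Rightarrow> ('x \<Rightarrow> 'v) \<Rightarrow> ('x \<Rightarrow>\<^sub>0 complex) \<Rightarrow> 'v"
  where "linear_extension V f p =
    (\<Oplus>\<^bsub>V\<^esub>x\<in>Poly_Mapping.keys p. Poly_Mapping.lookup p x \<odot>\<^bsub>V\<^esub> f x)"

definition monoid_algebra :: "('x, 'm) monoid_scheme \<Rightarrow> (complex, 'x \<Rightarrow>\<^sub>0 complex) module"
  where "monoid_algebra G =
    \<lparr>carrier = {p. Poly_Mapping.keys p \<subseteq> carrier G},
     mult = (\<lambda>p q. \<Sum>x\<in>Poly_Mapping.keys p. \<Sum>y\<in>Poly_Mapping.keys q.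
       Poly_Mapping.single (x \<otimes>\<^bsub>G\<^esub> y) (Poly_Mapping.lookup p x * Poly_Mapping.lookup q y)),
     one = Poly_Mapping.single \<one>\<^bsub>G\<^esub> 1, zero = 0, add = (+),
     smult = (\<lambda>c. Poly_Mapping.map ((*) c))\<rparr>"

definition word_monoid :: "'g list monoid"
  where "word_monoid = \<lparr>carrier = UNIV, mult = (@), one = []\<rparr>"

abbreviation free_algebra :: "(complex, 'g list \<Rightarrow>\<^sub>0 complex) module"
  where "free_algebra \<equiv> monoid_algebra word_monoid"

text \<open>
  The quotient by a subspace \<open>I\<close>. The ring fields are those of \<^const>\<open>FactRing\<close>; they are meaningful
  if \<open>V\<close> is an algebra and \<open>I\<close> a two-sided ideal.
\<close>

definition quotient :: "(complex, 'v, 'm) module_scheme \<Rightarrow> 'v set \<Rightarrow> (complex, 'v set) module"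
  where "quotient V I =
    \<lparr>carrier = a_rcosets\<^bsub>V\<^esub> I, mult = rcoset_mult V I, one = I +>\<^bsub>V\<^esub> \<one>\<^bsub>V\<^esub>, zero = I, add = set_add V,
     smult = (\<lambda>c X. \<Union>x\<in>X. I +>\<^bsub>V\<^esub> (c \<odot>\<^bsub>V\<^esub> x))\<rparr>"

definition rep :: "'v set \<Rightarrow> 'v"
  where "rep X = (SOME x. x \<in> X)"

text \<open>
  The algebra with generators the elements of \<^typ>\<open>'g\<close> and relations \<open>r = 0\<close> for \<open>r \<in> R\<close>.
  \<^const>\<open>genideal\<close> generates a two-sided ideal.
\<close>

definition presented_algebra :: "('g list \<Rightarrow>\<^sub>0 complex) set \<Rightarrow> (complex, ('g list \<Rightarrow>\<^sub>0 complex) set) module"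
  where "presented_algebra R = quotient free_algebra (Idl\<^bsub>free_algebra\<^esub> R)"

definition generator :: "('g list \<Rightarrow>\<^sub>0 complex) set \<Rightarrow> 'g \<Rightarrow> ('g list \<Rightarrow>\<^sub>0 complex) set"
  where "generator R g = Idl\<^bsub>free_algebra\<^esub> R +>\<^bsub>free_algebra\<^esub> Poly_Mapping.single [g] 1"

text \<open>
  The algebra homomorphism from a presented algebra to \<open>B\<close> sending each generator \<open>g\<close> to \<open>\<phi> g\<close>,
  and the action of a presented algebra on a vector space \<open>V\<close> in which \<open>g\<close> acts by \<open>\<rho> g\<close>.
  Both require the images of the generators to satisfy the relations; the choice of
  representative is then irrelevant.
\<close>

definition presented_hom ::
    "(complex, 'b, 'm) module_scheme \<Rightarrow> ('g \<Rightarrow> 'b) \<Rightarrow> ('g list \<Rightarrow>\<^sub>0 complex) set \<Rightarrow> 'b"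
  where "presented_hom B \<phi> X =
    linear_extension B (\<lambda>w. foldr (\<lambda>g b. \<phi> g \<otimes>\<^bsub>B\<^esub> b) w \<one>\<^bsub>B\<^esub>) (rep X)"

definition presented_action ::
    "(complex, 'v, 'm) module_scheme \<Rightarrow> ('g \<Rightarrow> 'v \<Rightarrow> 'v) \<Rightarrow> ('g list \<Rightarrow>\<^sub>0 complex) set \<Rightarrow> 'v \<Rightarrow> 'v"
  where "presented_action V \<rho> X v = linear_extension V (\<lambda>w. foldr \<rho> w v) (rep X)"


section \<open>Tensor products\<close>

definition tensor_relators ::
    "(complex, 'v, 'm) module_scheme \<Rightarrow> (complex, 'w, 'n) module_scheme \<Rightarrow> ('v \<times> 'w \<Rightarrow>\<^sub>0 complex) set"
  where "tensor_relators V W =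
    {Poly_Mapping.single (v \<oplus>\<^bsub>V\<^esub> v', w) 1 - Poly_Mapping.single (v, w) 1 - Poly_Mapping.single (v', w) 1
      | v v' w. v \<in> carrier V \<and> v' \<in> carrier V \<and> w \<in> carrier W} \<union>
    {Poly_Mapping.single (v, w \<oplus>\<^bsub>W\<^esub> w') 1 - Poly_Mapping.single (v, w) 1 - Poly_Mapping.single (v, w') 1
      | v w w'. v \<in> carrier V \<and> w \<in> carrier W \<and> w' \<in> carrier W} \<union>
    {Poly_Mapping.single (c \<odot>\<^bsub>V\<^esub> v, w) 1 - Poly_Mapping.single (v, w) c
      | c v w. v \<in> carrier V \<and> w \<in> carrier W} \<union>
    {Poly_Mapping.single (v, c \<odot>\<^bsub>W\<^esub> w) 1 - Poly_Mapping.single (v, w) c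
      | c v w. v \<in> carrier V \<and> w \<in> carrier W}"

definition tensor_kernel ::
    "(complex, 'v, 'm) module_scheme \<Rightarrow> (complex, 'w, 'n) module_scheme \<Rightarrow> ('v \<times> 'w \<Rightarrow>\<^sub>0 complex) set"
  where "tensor_kernel V W =
    \<Inter>{N. submodule N complex_field (free_space (carrier V \<times> carrier W)) \<and> tensor_relators V W \<subseteq> N}"

definition tensor_space ::
    "(complex, 'v, 'm) module_scheme \<Rightarrow> (complex, 'w, 'n) module_scheme \<Rightarrow>
     (complex, ('v \<times> 'w \<Rightarrow>\<^sub>0 complex) set) module"
  where "tensor_space V W = quotient (free_space (carrier V \<times> carrier W)) (tensor_kernel V W)"

definition pure_tensor ::
    "(complex, 'v, 'm) module_scheme \<Rightarrow> (complex, 'w, 'n) module_scheme \<Rightarrow> 'v \<Rightarrow> 'w \<Rightarrow>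
     ('v \<times> 'w \<Rightarrow>\<^sub>0 complex) set"
  where "pure_tensor V W v w =
    tensor_kernel V W +>\<^bsub>free_space (carrier V \<times> carrier W)\<^esub> Poly_Mapping.single (v, w) 1"

text \<open>
  The same vector space with the product \<open>(a \<otimes> b)(a' \<otimes> b') = aa' \<otimes> bb'\<close>: the monoid algebra of
  the product of the multiplicative monoids has the free vector space above as underlying space.
\<close>

definition tensor_algebra ::
    "(complex, 'a, 'm) module_scheme \<Rightarrow> (complex, 'b, 'n) module_scheme \<Rightarrow>
     (complex, ('a \<times> 'b \<Rightarrow>\<^sub>0 complex) set) module"
  where "tensor_algebra A B = quotient (monoid_algebra (A \<times>\<times> B)) (tensor_kernel A B)"

text \<open>
  For an \<open>A\<close>-module \<open>M\<close> and a \<open>B\<close>-module \<open>N\<close>, the module over the tensor product of \<open>A\<close> and \<open>B\<close>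
  with \<open>(a \<otimes> b)(x \<otimes> y) = ax \<otimes> by\<close>, extended bilinearly.
\<close>

definition tensor_module ::
    "('a, 'v, 'm) alg_module_scheme \<Rightarrow> ('b, 'w, 'n) alg_module_scheme \<Rightarrow>
     (('a \<times> 'b \<Rightarrow>\<^sub>0 complex) set, ('v \<times> 'w \<Rightarrow>\<^sub>0 complex) set) alg_module"
  where "tensor_module M N = with_action (tensor_space M N)
    (\<lambda>S T. linear_extension (tensor_space M N)
      (\<lambda>(a, b). linear_extension (tensor_space M N)
        (\<lambda>(x, y). pure_tensor M N (act M a x) (act N b y)) (rep T)) (rep S))"


section \<open>The enveloping algebra of \<open>sl\<^sub>2\<close> and its modules \<open>L\<^sub>n\<close>\<close>

datatype sl2_gen = E | F | H

definition sl2_relators :: "(sl2_gen list \<Rightarrow>\<^sub>0 complex) set"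
  where "sl2_relators =
    {Poly_Mapping.single [H, E] 1 - Poly_Mapping.single [E, H] 1 - Poly_Mapping.single [E] 2,
     Poly_Mapping.single [H, F] 1 - Poly_Mapping.single [F, H] 1 + Poly_Mapping.single [F] 2,
     Poly_Mapping.single [E, F] 1 - Poly_Mapping.single [F, E] 1 - Poly_Mapping.single [H] 1}"

definition U_sl2 :: "(complex, (sl2_gen list \<Rightarrow>\<^sub>0 complex) set) module"
  where "U_sl2 = presented_algebra sl2_relators"

text \<open>The basis vector \<open>v\<^sub>i\<close> is \<open>Poly_Mapping.single i 1\<close>.\<close>

fun L_basis_action :: "nat \<Rightarrow> sl2_gen \<Rightarrow> nat \<Rightarrow> (nat \<Rightarrow>\<^sub>0 complex)"
  where
    "L_basis_action n E i =
      (if i = 0 then 0 else Poly_Mapping.single (i - 1) (of_nat n - of_nat i + 1))"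
  | "L_basis_action n F i =
      (if i < n then Poly_Mapping.single (i + 1) (of_nat i + 1) else 0)"
  | "L_basis_action n H i = Poly_Mapping.single i (of_nat n - 2 * of_nat i)"

definition L_sl2 :: "nat \<Rightarrow> ((sl2_gen list \<Rightarrow>\<^sub>0 complex) set, nat \<Rightarrow>\<^sub>0 complex) alg_module"
  where "L_sl2 n = with_action (free_space {..n})
    (presented_action (free_space {..n})
      (\<lambda>g. linear_extension (free_space {..n}) (L_basis_action n g)))"


section \<open>The algebra \<open>K\<^sub>\<omega>\<close>\<close>

datatype K_gen = A | B

definition K_relators :: "complex \<Rightarrow> (K_gen list \<Rightarrow>\<^sub>0 complex) set"
  where "K_relators \<omega> =
    {Poly_Mapping.single [A, A, B] 1 - Poly_Mapping.single [A, B, A] 2 + Poly_Mapping.single [B, A, A] 1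
       - (Poly_Mapping.single [B] 1 + Poly_Mapping.single [A] \<omega>),
     Poly_Mapping.single [B, B, A] 1 - Poly_Mapping.single [B, A, B] 2 + Poly_Mapping.single [A, B, B] 1
       - (Poly_Mapping.single [A] 1 + Poly_Mapping.single [B] \<omega>)}"

definition K_alg :: "complex \<Rightarrow> (complex, (K_gen list \<Rightarrow>\<^sub>0 complex) set) module"
  where "K_alg \<omega> = presented_algebra (K_relators \<omega>)"

text \<open>
  The comultiplication is given by its values on the generators; that it also maps
  \<open>C = [A, B]\<close> to \<open>C \<otimes> 1 + 1 \<otimes> C\<close> is a consequence.
\<close>

definition comult :: "complex \<Rightarrow> (K_gen list \<Rightarrow>\<^sub>0 complex) set \<Rightarrow>
    ((K_gen list \<Rightarrow>\<^sub>0 complex) set \<times> (K_gen list \<Rightarrow>\<^sub>0 complex) set \<Rightarrow>\<^sub>0 complex) set"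
  where "comult \<omega> =
    (let K = K_alg \<omega>; KK = tensor_algebra K K in
     presented_hom KK
      (\<lambda>g. let X = generator (K_relators \<omega>) g in
        pure_tensor K K X \<one>\<^bsub>K\<^esub> \<oplus>\<^bsub>KK\<^esub> pure_tensor K K \<one>\<^bsub>K\<^esub> X))"

definition zeta :: "complex \<Rightarrow> (K_gen list \<Rightarrow>\<^sub>0 complex) set \<Rightarrow> (sl2_gen list \<Rightarrow>\<^sub>0 complex) set"
  where "zeta \<omega> =
    (let U = U_sl2; gen = generator sl2_relators in
     presented_hom U
      (\<lambda>g. case g of
         A \<Rightarrow> (((1 + \<omega>) / 2) \<odot>\<^bsub>U\<^esub> gen E \<oplus>\<^bsub>U\<^esub> ((1 - \<omega>) / 2) \<odot>\<^bsub>U\<^esub> gen F) \<ominus>\<^bsub>U\<^esub> (\<omega> / 2) \<odot>\<^bsub>U\<^esub> gen H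
       | B \<Rightarrow> (1 / 2) \<odot>\<^bsub>U\<^esub> gen H))"

definition L_mod :: "complex \<Rightarrow> nat \<Rightarrow> ((K_gen list \<Rightarrow>\<^sub>0 complex) set, nat \<Rightarrow>\<^sub>0 complex) alg_module"
  where "L_mod \<omega> n = pullback (zeta \<omega>) (L_sl2 n)"

text \<open>The tensor product of two \<open>K\<^sub>\<omega>\<close>-modules, again a \<open>K\<^sub>\<omega>\<close>-module.\<close>

definition K_tensor ::
    "complex \<Rightarrow> ((K_gen list \<Rightarrow>\<^sub>0 complex) set, 'v, 'm) alg_module_scheme \<Rightarrow>
     ((K_gen list \<Rightarrow>\<^sub>0 complex) set, 'w, 'n) alg_module_scheme \<Rightarrow>
     ((K_gen list \<Rightarrow>\<^sub>0 complex) set, ('v \<times> 'w \<Rightarrow>\<^sub>0 complex) set) alg_module"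
  where "K_tensor \<omega> M N = pullback (comult \<omega>) (tensor_module M N)"

end

theory Submission
  imports Defs
begin

text \<open>
  Since \<open>\<zeta>\<close> sends the generators of \<open>K\<^sub>\<omega>\<close> into \<open>sl\<^sub>2\<close> and both the generators of \<open>K\<^sub>\<omega>\<close> and \<open>sl\<^sub>2\<close>
  act on a tensor product by the Leibniz rule, the claim follows from the Clebsch--Gordan decomposition
  for \<open>sl\<^sub>2\<close>. For \<open>p \<le> min m n\<close> there is a vector \<open>w\<^sub>p \<in> L\<^sub>m \<otimes> L\<^sub>n\<close> of weight \<open>m + n - 2p\<close> killed by \<open>E\<close>.
  On vectors whose coordinates on all \<open>v\<^sub>i \<otimes> v\<^sub>0\<close> vanish \<open>E\<close> is injective, so \<open>F\<^sup>k w\<^sub>p = 0\<close> for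
  \<open>k = m + n - 2p + 1\<close>, and \<open>v\<^sub>i \<mapsto> F\<^sup>i w\<^sub>p / i!\<close> is an \<open>sl\<^sub>2\<close>-map from \<open>L\<close> with index \<open>m + n - 2p\<close>. The kernel of the
  resulting map from the direct sum is stable under \<open>E\<close>; if nonzero, it would contain a vector killed by
  \<open>E\<close>, that is, a linear relation between the \<open>w\<^sub>p\<close>, which have different weights. Equality of
  dimensions gives surjectivity.
\<close>


text \<open>Presented algebras and tensor products are quotients here, and maps out of them are
  defined through a chosen representative \<open>rep\<close>. Much of the work is therefore
  well-definedness: a linear or multiplicative map on the free object that kills the relators kills
  the subspace or ideal they generate, since its kernel is again a subspace or an ideal. Module
  axioms on quotients are inherited from free objects through the projections. The relations of
  \<open>K_alg\<close> are the Lie identities [A,[A,B]] = B + \<omega> A and [B,[B,A]] = A +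
  \<omega> B. This is why they can be checked for \<zeta> inside the three-dimensional span of E, F,
  H, and why they pass to the elements x \<otimes> 1 + 1 \<otimes> x. After that \<omega> enters
  only through the coefficients of an element of sl2, and the intertwining map is the same for all
  \<omega>. No case distinction arises, not even for \<omega> = 1 or \<omega> = -1, where F or E is
  missing from \<zeta>(A). The comparison itself takes place in coordinates: \<open>K_tensor\<close>
  is identified with functions on {0..m} \<times> {0..n}, and the isomorphism is this identification
  followed by the inverse of \<open>CG_map\<close>.\<close>

abbreviation (input) sgl where "sgl \<equiv> Poly_Mapping.single"
abbreviation (input) coef where "coef \<equiv> Poly_Mapping.lookup"
abbreviation (input) supp where "supp \<equiv> Poly_Mapping.keys"

section \<open>Linear maps and free spaces\<close>

lemma complex_field_simps [simp]:
  "carrier complex_field = UNIV" "mult complex_field = (*)" "one complex_field = 1"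
  "zero complex_field = 0" "add complex_field = (+)"
  by (simp_all add: complex_field_def)

lemma cring_complex_field: "cring complex_field"
proof (rule cringI)
  show "abelian_group complex_field"
  proof (rule abelian_groupI)
    show "\<exists>y\<in>carrier complex_field. y \<oplus>\<^bsub>complex_field\<^esub> x = \<zero>\<^bsub>complex_field\<^esub>" for x
      by (rule bexI[of _ "- x"]) auto
  qed (auto simp: algebra_simps)
  show "Group.comm_monoid complex_field"
    by (rule comm_monoidI) auto
qed (auto simp: algebra_simps)

lemma a_inv_complex_field [simp]: "\<ominus>\<^bsub>complex_field\<^esub> c = - c"
proof -
  interpret cring complex_field by (rule cring_complex_field)
  show ?thesis by (rule minus_equality) auto
qed

text \<open>The record operations of \<open>complex_field\<close> are replaced by ordinary complex
  arithmetic once and for all, so that later module proofs never meet them.\<close>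

lemma complex_moduleI:
  assumes "abelian_group V"
    and "\<And>c x. x \<in> carrier V \<Longrightarrow> c \<odot>\<^bsub>V\<^esub> x \<in> carrier V"
    and "\<And>c d x. x \<in> carrier V \<Longrightarrow> (c + d) \<odot>\<^bsub>V\<^esub> x = c \<odot>\<^bsub>V\<^esub> x \<oplus>\<^bsub>V\<^esub> d \<odot>\<^bsub>V\<^esub> x"
    and "\<And>c x y. \<lbrakk>x \<in> carrier V; y \<in> carrier V\<rbrakk> \<Longrightarrow> c \<odot>\<^bsub>V\<^esub> (x \<oplus>\<^bsub>V\<^esub> y) = c \<odot>\<^bsub>V\<^esub> x \<oplus>\<^bsub>V\<^esub> c \<odot>\<^bsub>V\<^esub> y"
    and "\<And>c d x. x \<in> carrier V \<Longrightarrow> (c * d) \<odot>\<^bsub>V\<^esub> x = c \<odot>\<^bsub>V\<^esub> (d \<odot>\<^bsub>V\<^esub> x)"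
    and "\<And>x. x \<in> carrier V \<Longrightarrow> 1 \<odot>\<^bsub>V\<^esub> x = x"
  shows "module complex_field V"
  using assms by (intro moduleI cring_complex_field) simp_all

text \<open>Scalar multiplication of \<open>free_space\<close> as a total operation. It makes the
  type of finitely supported functions an instance of the locale \<open>vector_space\<close>, whose
  span and independence results serve the dimension argument, while \<open>free_space_simps\<close>
  links it to the carrier-based records.\<close>

definition scl :: "complex \<Rightarrow> ('x \<Rightarrow>\<^sub>0 complex) \<Rightarrow> ('x \<Rightarrow>\<^sub>0 complex)"
  where "scl c = Poly_Mapping.map ((*) c)"

lemma lookup_scl [simp]: "coef (scl c p) x = c * coef p x"
  unfolding scl_def by (simp add: Poly_Mapping.map.rep_eq when_def)

interpretation pm: vector_space scl
  by unfold_locales (auto intro!: poly_mapping_eqI simp: lookup_add algebra_simps)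

lemma keys_scl: "supp (scl c p) \<subseteq> supp p"
  by (auto simp: in_keys_iff)

lemma scl_single [simp]: "scl c (sgl x d) = sgl x (c * d)"
  by (simp add: scl_def)

lemma free_space_simps [simp]:
  "carrier (free_space X) = {p. supp p \<subseteq> X}" "zero (free_space X) = 0"
  "add (free_space X) = (+)" "smult (free_space X) = scl"
  by (simp_all add: free_space_def scl_def fun_eq_iff)

lemma module_free_space: "module complex_field (free_space X)"
proof (rule complex_moduleI)
  show "abelian_group (free_space X)"
  proof (rule abelian_groupI)
    fix p assume "p \<in> carrier (free_space X)"
    then show "\<exists>q\<in>carrier (free_space X). q \<oplus>\<^bsub>free_space X\<^esub> p = \<zero>\<^bsub>free_space X\<^esub>"
      by (intro bexI[of _ "- p"]) simp_all
  next
    fix p q assume "p \<in> carrier (free_space X)" "q \<in> carrier (free_space X)"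
    then show "p \<oplus>\<^bsub>free_space X\<^esub> q \<in> carrier (free_space X)"
      using keys_add[of p q] by auto
  qed (auto simp: algebra_simps)
next
  fix p q assume "p \<in> carrier (free_space X)"
  then show "c \<odot>\<^bsub>free_space X\<^esub> p \<in> carrier (free_space X)" for c
    using keys_scl[of c p] by auto
qed (auto simp: pm.scale_left_distrib pm.scale_right_distrib)

lemma a_inv_free_space [simp]: "supp p \<subseteq> X \<Longrightarrow> \<ominus>\<^bsub>free_space X\<^esub> p = - p"
proof -
  interpret module complex_field "free_space X" by (rule module_free_space)
  show "supp p \<subseteq> X \<Longrightarrow> ?thesis" by (rule minus_equality) auto
qed

lemma a_minus_free_space [simp]: "supp q \<subseteq> X \<Longrightarrow> p \<ominus>\<^bsub>free_space X\<^esub> q = p - q"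
  by (simp add: a_minus_def)

section \<open>Linear maps between carrier-based vector spaces\<close>

definition lin_maps ::
    "(complex, 'v, 'm) module_scheme \<Rightarrow> (complex, 'w, 'n) module_scheme \<Rightarrow> ('v \<Rightarrow> 'w) set"
  where "lin_maps V W = {f \<in> carrier V \<rightarrow> carrier W.
    (\<forall>x \<in> carrier V. \<forall>y \<in> carrier V. f (x \<oplus>\<^bsub>V\<^esub> y) = f x \<oplus>\<^bsub>W\<^esub> f y) \<and>
    (\<forall>c. \<forall>x \<in> carrier V. f (c \<odot>\<^bsub>V\<^esub> x) = c \<odot>\<^bsub>W\<^esub> f x)}"

lemma lin_mapsI:
  assumes "\<And>x. x \<in> carrier V \<Longrightarrow> f x \<in> carrier W"
    and "\<And>x y. \<lbrakk>x \<in> carrier V; y \<in> carrier V\<rbrakk> \<Longrightarrow> f (x \<oplus>\<^bsub>V\<^esub> y) = f x \<oplus>\<^bsub>W\<^esub> f y"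
    and "\<And>c x. x \<in> carrier V \<Longrightarrow> f (c \<odot>\<^bsub>V\<^esub> x) = c \<odot>\<^bsub>W\<^esub> f x"
  shows "f \<in> lin_maps V W"
  using assms by (auto simp: lin_maps_def)

lemma lin_mapsD:
  assumes "f \<in> lin_maps V W"
  shows "x \<in> carrier V \<Longrightarrow> f x \<in> carrier W"
    and "\<lbrakk>x \<in> carrier V; y \<in> carrier V\<rbrakk> \<Longrightarrow> f (x \<oplus>\<^bsub>V\<^esub> y) = f x \<oplus>\<^bsub>W\<^esub> f y"
    and "x \<in> carrier V \<Longrightarrow> f (c \<odot>\<^bsub>V\<^esub> x) = c \<odot>\<^bsub>W\<^esub> f x"
  using assms by (auto simp: lin_maps_def)

text \<open>Membership in \<open>lin_maps\<close> constrains values on the carrier only, so a map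
  may be exchanged for a more convenient one that agrees with it there.\<close>

lemma lin_maps_cong:
  assumes "f \<in> lin_maps V W" "module complex_field V" "\<And>x. x \<in> carrier V \<Longrightarrow> g x = f x"
  shows "g \<in> lin_maps V W"
proof -
  interpret module complex_field V by fact
  show ?thesis using assms(1,3) by (auto simp: lin_maps_def Pi_iff)
qed

lemma lin_maps_comp:
  "\<lbrakk>f \<in> lin_maps U V; g \<in> lin_maps V W\<rbrakk> \<Longrightarrow> (\<lambda>x. g (f x)) \<in> lin_maps U W"
  by (auto simp: lin_maps_def Pi_iff)

context
  fixes V :: "(complex, 'v, 'm) module_scheme" and W :: "(complex, 'w, 'n) module_scheme" and f
  assumes V: "module complex_field V" and W: "module complex_field W" and f: "f \<in> lin_maps V W"
begin

interpretation V: module complex_field V by (rule V)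
interpretation W: module complex_field W by (rule W)

lemma lin_maps_zero: "f \<zero>\<^bsub>V\<^esub> = \<zero>\<^bsub>W\<^esub>"
proof -
  have "f (0 \<odot>\<^bsub>V\<^esub> \<zero>\<^bsub>V\<^esub>) = 0 \<odot>\<^bsub>W\<^esub> f \<zero>\<^bsub>V\<^esub>"
    by (rule lin_mapsD(3)[OF f]) simp
  then show ?thesis
    using V.smult_l_null[of "\<zero>\<^bsub>V\<^esub>"] W.smult_l_null[of "f \<zero>\<^bsub>V\<^esub>"] lin_mapsD(1)[OF f, of "\<zero>\<^bsub>V\<^esub>"] by simp
qed

lemma lin_maps_a_inv: "x \<in> carrier V \<Longrightarrow> f (\<ominus>\<^bsub>V\<^esub> x) = \<ominus>\<^bsub>W\<^esub> f x"
  using lin_mapsD(2)[OF f, of "\<ominus>\<^bsub>V\<^esub> x" x] lin_maps_zero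
  by (metis V.M.a_inv_closed V.M.l_neg W.M.minus_equality lin_mapsD(1)[OF f])

lemma lin_maps_minus: "\<lbrakk>x \<in> carrier V; y \<in> carrier V\<rbrakk> \<Longrightarrow> f (x \<ominus>\<^bsub>V\<^esub> y) = f x \<ominus>\<^bsub>W\<^esub> f y"
  by (simp add: a_minus_def lin_mapsD(2)[OF f] lin_maps_a_inv)

lemma lin_maps_finsum:
  "\<lbrakk>finite S; g \<in> S \<rightarrow> carrier V\<rbrakk> \<Longrightarrow> f (\<Oplus>\<^bsub>V\<^esub>x\<in>S. g x) = (\<Oplus>\<^bsub>W\<^esub>x\<in>S. f (g x))"
proof (induction S rule: finite_induct)
  case (insert s S)
  then have "(\<lambda>x. f (g x)) \<in> S \<rightarrow> carrier W" "f (g s) \<in> carrier W"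
    using lin_mapsD(1)[OF f] by auto
  with insert show ?case
    by (simp add: lin_mapsD(2)[OF f] Pi_iff)
qed (simp add: lin_maps_zero)

lemma lin_maps_linear_extension:
  assumes "g \<in> supp p \<rightarrow> carrier V"
  shows "f (linear_extension V g p) = linear_extension W (\<lambda>x. f (g x)) p"
proof -
  have "f (linear_extension V g p) = (\<Oplus>\<^bsub>W\<^esub>x\<in>supp p. f (coef p x \<odot>\<^bsub>V\<^esub> g x))"
    unfolding linear_extension_def using assms by (intro lin_maps_finsum) (auto simp: Pi_iff)
  also have "\<dots> = linear_extension W (\<lambda>x. f (g x)) p"
    unfolding linear_extension_def using assms lin_mapsD(1)[OF f]
    by (intro W.M.finsum_cong') (auto simp: lin_mapsD(3)[OF f] Pi_iff)
  finally show ?thesis .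
qed

lemma submodule_kernel: "submodule {x \<in> carrier V. f x = \<zero>\<^bsub>W\<^esub>} complex_field V"
  by (rule V.submoduleI)
    (auto simp: lin_maps_zero lin_maps_a_inv lin_mapsD(2,3)[OF f] W.smult_r_null[simplified])

end

context
  fixes W :: "(complex, 'w, 'n) module_scheme" and f :: "'x \<Rightarrow> 'w" and X :: "'x set"
  assumes W: "module complex_field W" and f: "f \<in> X \<rightarrow> carrier W"
begin

interpretation W: module complex_field W by (rule W)

text \<open>The range of summation of \<open>linear_extension\<close> depends on its argument.
  Padding with zero terms to a common finite set is what makes additivity provable termwise.\<close>

lemma linear_extension_superset:
  assumes "finite S" "supp p \<subseteq> S" "S \<subseteq> X"
  shows "linear_extension W f p = (\<Oplus>\<^bsub>W\<^esub>x\<in>S. coef p x \<odot>\<^bsub>W\<^esub> f x)"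
  unfolding linear_extension_def finsum_def
proof (rule comm_monoid.finprod_mono_neutral_cong_left[OF W.M.a_comm_monoid assms(1,2)])
  show "coef p x \<odot>\<^bsub>W\<^esub> f x = \<one>\<^bsub>add_monoid W\<^esub>" if "x \<in> S - supp p" for x
    using that assms(3) f W.smult_l_null[simplified] by (auto simp: in_keys_iff Pi_iff subset_iff)
  show "(\<lambda>x. coef p x \<odot>\<^bsub>W\<^esub> f x) \<in> S \<rightarrow> carrier (add_monoid W)"
    using assms(3) f by (auto simp: Pi_iff)
qed auto

lemma linear_extension_lin_maps: "linear_extension W f \<in> lin_maps (free_space X) W"
proof (rule lin_mapsI)
  fix p assume "p \<in> carrier (free_space X)"
  then have p: "supp p \<subseteq> X" by simp
  then show "linear_extension W f p \<in> carrier W"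
    unfolding linear_extension_def using f by (intro W.M.finsum_closed) (auto simp: Pi_iff subset_iff)
  show "linear_extension W f (c \<odot>\<^bsub>free_space X\<^esub> p) = c \<odot>\<^bsub>W\<^esub> linear_extension W f p" for c
  proof -
    have "linear_extension W f (scl c p) = (\<Oplus>\<^bsub>W\<^esub>x\<in>supp p. coef (scl c p) x \<odot>\<^bsub>W\<^esub> f x)"
      using p keys_scl[of c p] by (intro linear_extension_superset) auto
    also have "\<dots> = (\<Oplus>\<^bsub>W\<^esub>x\<in>supp p. c \<odot>\<^bsub>W\<^esub> (coef p x \<odot>\<^bsub>W\<^esub> f x))"
      using p f by (intro W.M.finsum_cong') (auto simp: Pi_iff subset_iff W.smult_assoc1[simplified])
    also have "\<dots> = c \<odot>\<^bsub>W\<^esub> linear_extension W f p"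
      unfolding linear_extension_def using p f by (subst W.finsum_smult_ldistr) (auto simp: Pi_iff subset_iff)
    finally show ?thesis by simp
  qed
  fix q assume "q \<in> carrier (free_space X)"
  then have q: "supp q \<subseteq> X" by simp
  let ?S = "supp p \<union> supp q"
  have "linear_extension W f (p + q) = (\<Oplus>\<^bsub>W\<^esub>x\<in>?S. coef (p + q) x \<odot>\<^bsub>W\<^esub> f x)"
    using p q keys_add[of p q] by (intro linear_extension_superset) auto
  also have "\<dots> = (\<Oplus>\<^bsub>W\<^esub>x\<in>?S. coef p x \<odot>\<^bsub>W\<^esub> f x \<oplus>\<^bsub>W\<^esub> coef q x \<odot>\<^bsub>W\<^esub> f x)"
    using p q f by (intro W.M.finsum_cong') (auto simp: Pi_iff subset_iff lookup_add W.smult_l_distr[simplified])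
  also have "\<dots> = (\<Oplus>\<^bsub>W\<^esub>x\<in>?S. coef p x \<odot>\<^bsub>W\<^esub> f x) \<oplus>\<^bsub>W\<^esub> (\<Oplus>\<^bsub>W\<^esub>x\<in>?S. coef q x \<odot>\<^bsub>W\<^esub> f x)"
    using p q f by (intro W.M.finsum_addf) (auto simp: Pi_iff subset_iff)
  also have "\<dots> = linear_extension W f p \<oplus>\<^bsub>W\<^esub> linear_extension W f q"
    using p q by (subst (1 2) linear_extension_superset[of ?S]) auto
  finally show "linear_extension W f (p \<oplus>\<^bsub>free_space X\<^esub> q) =
    linear_extension W f p \<oplus>\<^bsub>W\<^esub> linear_extension W f q" by simp
qed

lemma linear_extension_single:
  "x \<in> X \<Longrightarrow> linear_extension W f (sgl x c) = c \<odot>\<^bsub>W\<^esub> f x"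
  using f W.smult_l_null[simplified]
  by (cases "c = 0") (auto simp: linear_extension_def Pi_iff)

lemma linear_extension_single_one: "x \<in> X \<Longrightarrow> linear_extension W f (sgl x 1) = f x"
  using f by (simp add: linear_extension_single Pi_iff W.smult_one[simplified])

end

lemma linear_extension_cong:
  assumes "module complex_field W" "\<And>x. x \<in> supp p \<Longrightarrow> f x = g x" "g \<in> supp p \<rightarrow> carrier W"
  shows "linear_extension W f p = linear_extension W g p"
proof -
  interpret W: module complex_field W by fact
  show ?thesis
    unfolding linear_extension_def using assms(2,3) by (intro W.M.finsum_cong') auto
qed

lemma poly_mapping_sum_singles:
  fixes p :: "'x \<Rightarrow>\<^sub>0 complex"
  shows "(\<Sum>x\<in>supp p. sgl x (coef p x)) = p"
proof (rule poly_mapping_eqI)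
  fix y
  show "coef (\<Sum>x\<in>supp p. sgl x (coef p x)) y = coef p y"
    by (cases "y \<in> supp p") (auto simp: lookup_sum lookup_single when_def in_keys_iff sum.delta)
qed

lemma free_space_induct [consumes 1, case_names zero single add]:
  fixes p :: "'x \<Rightarrow>\<^sub>0 complex"
  assumes "supp p \<subseteq> X" and "P 0"
    and "\<And>x c. x \<in> X \<Longrightarrow> P (sgl x c)"
    and "\<And>p q. \<lbrakk>supp p \<subseteq> X; supp q \<subseteq> X; P p; P q\<rbrakk> \<Longrightarrow> P (p + q)"
  shows "P p"
proof -
  have "P (\<Sum>x\<in>S. sgl x (coef p x)) \<and> supp (\<Sum>x\<in>S. sgl x (coef p x)) \<subseteq> X" if "finite S" "S \<subseteq> X" for S
    using that
  proof (induction S rule: finite_induct)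
    case (insert x S)
    have "supp (sgl x (coef p x)) \<subseteq> X" using insert by simp
    with insert assms(3)[of x "coef p x"] assms(4) show ?case
      using keys_add[of "sgl x (coef p x)" "\<Sum>x\<in>S. sgl x (coef p x)"] by (auto simp del: keys_single)
  qed (use assms in simp)
  from this[of "supp p"] show ?thesis
    using assms(1) by (simp add: poly_mapping_sum_singles)
qed

lemma free_space_lin_maps_eq:
  assumes W: "module complex_field W"
    and f: "f \<in> lin_maps (free_space X) W" and g: "g \<in> lin_maps (free_space X) W"
    and eq: "\<And>x. x \<in> X \<Longrightarrow> f (sgl x 1) = g (sgl x 1)"
    and p: "supp p \<subseteq> X"
  shows "f p = g p"
  using p
proof (induction rule: free_space_induct)
  case zero
  show ?case
    using lin_maps_zero[OF module_free_space W f] lin_maps_zero[OF module_free_space W g] by simp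
next
  case (single x c)
  then show ?case
    using lin_mapsD(3)[OF f, of "sgl x 1" c] lin_mapsD(3)[OF g, of "sgl x 1" c] eq by simp
next
  case (add p q)
  then show ?case
    using lin_mapsD(2)[OF f, of p q] lin_mapsD(2)[OF g, of p q] by simp
qed

text \<open>\<open>linear_extension\<close> with values in a free space, written with the ordinary
  sum of the type instead of \<open>finsum\<close>. Being total, it obeys its algebraic laws without
  carrier conditions; all coordinate computations use it.\<close>

definition lin_ext :: "('x \<Rightarrow> ('y \<Rightarrow>\<^sub>0 complex)) \<Rightarrow> ('x \<Rightarrow>\<^sub>0 complex) \<Rightarrow> ('y \<Rightarrow>\<^sub>0 complex)"
  where "lin_ext f p = (\<Sum>x\<in>supp p. scl (coef p x) (f x))"

lemma linear_extension_free_space: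
  fixes f :: "'x \<Rightarrow> ('y \<Rightarrow>\<^sub>0 complex)"
  assumes "f \<in> supp p \<rightarrow> carrier (free_space Y)"
  shows "linear_extension (free_space Y) f p = lin_ext f p"
proof -
  interpret module complex_field "free_space Y" by (rule module_free_space)
  have "(\<Oplus>\<^bsub>free_space Y\<^esub>x\<in>S. g x) = (\<Sum>x\<in>S. g x)"
    if "finite S" "g \<in> S \<rightarrow> carrier (free_space Y)" for S :: "'x set" and g
    using that by (induction S rule: finite_induct) (simp_all add: Pi_iff)
  then show ?thesis
    unfolding linear_extension_def lin_ext_def using assms
    by (simp add: Pi_iff order.trans[OF keys_scl])
qed

lemma lin_ext_lin_maps: "f \<in> X \<rightarrow> carrier (free_space Y) \<Longrightarrow> lin_ext f \<in> lin_maps (free_space X) (free_space Y)"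
  by (rule lin_maps_cong[OF linear_extension_lin_maps module_free_space])
    (auto simp: module_free_space Pi_iff subset_iff intro!: linear_extension_free_space[symmetric])

lemma lin_ext_UNIV: "lin_ext f \<in> lin_maps (free_space UNIV) (free_space UNIV)"
  by (rule lin_ext_lin_maps) simp

lemma lin_ext_zero [simp]: "lin_ext f 0 = 0"
  by (simp add: lin_ext_def)

lemma lin_ext_add: "lin_ext f (p + q) = lin_ext f p + lin_ext f q"
  using lin_mapsD(2)[OF lin_ext_UNIV] by simp

lemma lin_ext_scl: "lin_ext f (scl c p) = scl c (lin_ext f p)"
  using lin_mapsD(3)[OF lin_ext_UNIV] by simp

lemma lin_ext_minus: "lin_ext f (p - q) = lin_ext f p - lin_ext f q"
  using lin_maps_minus[OF module_free_space module_free_space lin_ext_UNIV] by simp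

lemma lin_ext_single [simp]: "lin_ext f (sgl x c) = scl c (f x)"
  by (cases "c = 0") (simp_all add: lin_ext_def)

lemma lin_ext_keys: "(\<And>x. x \<in> supp p \<Longrightarrow> supp (f x) \<subseteq> Y) \<Longrightarrow> supp (lin_ext f p) \<subseteq> Y"
  unfolding lin_ext_def by (intro order.trans[OF keys_sum] UN_least) (meson keys_scl order.trans)

lemma lin_ext_cong: "(\<And>x. x \<in> supp p \<Longrightarrow> f x = g x) \<Longrightarrow> lin_ext f p = lin_ext g p"
  by (simp add: lin_ext_def)

lemma lin_ext_sum: "lin_ext f (sum g S) = (\<Sum>s\<in>S. lin_ext f (g s))"
  by (induction S rule: infinite_finite_induct) (simp_all add: lin_ext_add)

lemma lin_ext_lin_ext: "lin_ext f (lin_ext g p) = lin_ext (\<lambda>x. lin_ext f (g x)) p"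
  by (simp add: lin_ext_def[of g] lin_ext_sum lin_ext_scl lin_ext_def[of "\<lambda>x. lin_ext f (g x)"])

lemma lin_ext_single_id: "lin_ext (\<lambda>x. sgl x 1) p = p"
  by (simp add: lin_ext_def poly_mapping_sum_singles)

lemma lin_ext_fun_add: "lin_ext (\<lambda>x. f x + g x) p = lin_ext f p + lin_ext g p"
  by (simp add: lin_ext_def pm.scale_right_distrib sum.distrib)

lemma lin_ext_fun_scl: "lin_ext (\<lambda>x. scl c (f x)) p = scl c (lin_ext f p)"
  by (simp add: lin_ext_def pm.scale_sum_right mult.commute)

lemma lin_ext_swap: "lin_ext (\<lambda>x. lin_ext (\<lambda>y. f x y) q) p = lin_ext (\<lambda>y. lin_ext (\<lambda>x. f x y) p) q"
proof -
  have "lin_ext (\<lambda>x. lin_ext (\<lambda>y. f x y) q) p =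
    (\<Sum>x\<in>supp p. \<Sum>y\<in>supp q. scl (coef p x) (scl (coef q y) (f x y)))"
    by (simp add: lin_ext_def pm.scale_sum_right)
  also have "\<dots> = (\<Sum>y\<in>supp q. \<Sum>x\<in>supp p. scl (coef p x) (scl (coef q y) (f x y)))"
    by (rule sum.swap)
  also have "\<dots> = lin_ext (\<lambda>y. lin_ext (\<lambda>x. f x y) p) q"
    by (simp add: lin_ext_def pm.scale_sum_right mult.commute)
  finally show ?thesis .
qed


section \<open>Homomorphic images, quotients and presented algebras\<close>

text \<open>The axioms are equations, so a surjection that preserves the operations transports them.
  Preservation of zero is a separate assumption because the target is not yet known to be a group,
  from which it could be derived.\<close>

lemma module_image:
  assumes V: "module complex_field V" and f: "f \<in> lin_maps V W"
    and surj: "f ` carrier V = carrier W" and zero: "f \<zero>\<^bsub>V\<^esub> = \<zero>\<^bsub>W\<^esub>"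
  shows "module complex_field W"
proof -
  interpret V: module complex_field V by fact
  note fD = lin_mapsD[OF f]
  have ex: "\<exists>v\<in>carrier V. x = f v" if "x \<in> carrier W" for x
    using that surj by blast
  \<comment> \<open>Used right to left: each operation of the target applied to images is pulled
    back to the source, where the module laws are available.\<close>
  note [simp] = fD(2,3)[symmetric] zero[symmetric]
  show ?thesis
  proof (rule complex_moduleI)
    show "abelian_group W"
    proof (rule abelian_groupI)
      fix x assume "x \<in> carrier W"
      then obtain v where "v \<in> carrier V" "x = f v" using ex by blast
      then show "\<exists>y\<in>carrier W. y \<oplus>\<^bsub>W\<^esub> x = \<zero>\<^bsub>W\<^esub>"
        using fD(1) by (intro bexI[of _ "f (\<ominus>\<^bsub>V\<^esub> v)"]) (simp_all add: V.M.l_neg)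
    next
      fix x y z assume "x \<in> carrier W" "y \<in> carrier W" "z \<in> carrier W"
      then obtain u v w where "u \<in> carrier V" "x = f u" "v \<in> carrier V" "y = f v" "w \<in> carrier V" "z = f w"
        using ex by metis
      then show "x \<oplus>\<^bsub>W\<^esub> y \<oplus>\<^bsub>W\<^esub> z = x \<oplus>\<^bsub>W\<^esub> (y \<oplus>\<^bsub>W\<^esub> z)"
        by (simp add: V.M.a_assoc)
    next
      fix x y assume "x \<in> carrier W" "y \<in> carrier W"
      then obtain u v where uv: "u \<in> carrier V" "x = f u" "v \<in> carrier V" "y = f v"
        using ex by metis
      then show "x \<oplus>\<^bsub>W\<^esub> y = y \<oplus>\<^bsub>W\<^esub> x" by (simp add: V.M.a_comm)
      show "x \<oplus>\<^bsub>W\<^esub> y \<in> carrier W" using uv fD(1) by simp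
    next
      fix x assume "x \<in> carrier W"
      then obtain v where "v \<in> carrier V" "x = f v" using ex by blast
      then show "\<zero>\<^bsub>W\<^esub> \<oplus>\<^bsub>W\<^esub> x = x" by simp
    qed (use fD(1) in simp)
  next
    fix c d x y assume "x \<in> carrier W" "y \<in> carrier W"
    then obtain u v where uv: "u \<in> carrier V" "x = f u" "v \<in> carrier V" "y = f v"
      using ex by metis
    then show "c \<odot>\<^bsub>W\<^esub> (x \<oplus>\<^bsub>W\<^esub> y) = c \<odot>\<^bsub>W\<^esub> x \<oplus>\<^bsub>W\<^esub> c \<odot>\<^bsub>W\<^esub> y"
      by (simp add: V.smult_r_distr[simplified])
  next
    fix c d x assume "x \<in> carrier W"
    then obtain u where uv: "u \<in> carrier V" "x = f u"
      using ex by metis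
    show "c \<odot>\<^bsub>W\<^esub> x \<in> carrier W" using uv fD(1) by simp
    show "(c + d) \<odot>\<^bsub>W\<^esub> x = c \<odot>\<^bsub>W\<^esub> x \<oplus>\<^bsub>W\<^esub> d \<odot>\<^bsub>W\<^esub> x"
      using uv by (simp add: V.smult_l_distr[simplified])
    show "(c * d) \<odot>\<^bsub>W\<^esub> x = c \<odot>\<^bsub>W\<^esub> (d \<odot>\<^bsub>W\<^esub> x)"
      using uv by (simp add: V.smult_assoc1[simplified])
    show "1 \<odot>\<^bsub>W\<^esub> x = x"
      using uv by (simp add: V.smult_one[simplified])
  qed
qed

lemma module_cong:
  assumes "module complex_field V" "carrier W = carrier V" "zero W = zero V" "add W = add V" "smult W = smult V"
  shows "module complex_field W"
  by (rule module_image[OF assms(1), where f = "\<lambda>x. x"]) (auto simp: lin_maps_def assms(2-))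

lemma with_action_simps [simp]:
  "carrier (with_action V \<rho>) = carrier V" "zero (with_action V \<rho>) = zero V"
  "add (with_action V \<rho>) = add V" "smult (with_action V \<rho>) = smult V" "act (with_action V \<rho>) = \<rho>"
  by (simp_all add: with_action_def)

lemma module_with_action: "module complex_field V \<Longrightarrow> module complex_field (with_action V \<rho>)"
  by (rule module_cong) simp_all

lemma algebra_hom_lin_maps: "f \<in> algebra_hom R S \<Longrightarrow> f \<in> lin_maps R S"
  by (auto simp: algebra_hom_def lin_maps_def ring_hom_closed ring_hom_add)

lemma algebra_homD:
  assumes "f \<in> algebra_hom R S"
  shows "x \<in> carrier R \<Longrightarrow> f x \<in> carrier S"
    and "\<lbrakk>x \<in> carrier R; y \<in> carrier R\<rbrakk> \<Longrightarrow> f (x \<oplus>\<^bsub>R\<^esub> y) = f x \<oplus>\<^bsub>S\<^esub> f y"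
    and "x \<in> carrier R \<Longrightarrow> f (c \<odot>\<^bsub>R\<^esub> x) = c \<odot>\<^bsub>S\<^esub> f x"
    and "\<lbrakk>x \<in> carrier R; y \<in> carrier R\<rbrakk> \<Longrightarrow> f (x \<otimes>\<^bsub>R\<^esub> y) = f x \<otimes>\<^bsub>S\<^esub> f y"
    and "f \<one>\<^bsub>R\<^esub> = \<one>\<^bsub>S\<^esub>"
  using assms by (auto simp: algebra_hom_def ring_hom_closed ring_hom_add ring_hom_mult ring_hom_one)

lemma algebra_homI:
  assumes "f \<in> lin_maps R S"
    and "\<And>x y. \<lbrakk>x \<in> carrier R; y \<in> carrier R\<rbrakk> \<Longrightarrow> f (x \<otimes>\<^bsub>R\<^esub> y) = f x \<otimes>\<^bsub>S\<^esub> f y"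
    and "f \<one>\<^bsub>R\<^esub> = \<one>\<^bsub>S\<^esub>"
  shows "f \<in> algebra_hom R S"
  using assms by (auto simp: algebra_hom_def lin_maps_def intro!: ring_hom_memI)

lemma complex_algebra_image:
  assumes R: "complex_algebra R" and f: "f \<in> algebra_hom R S"
    and surj: "f ` carrier R = carrier S" and zero: "f \<zero>\<^bsub>R\<^esub> = \<zero>\<^bsub>S\<^esub>"
  shows "complex_algebra S"
proof -
  interpret R: complex_algebra R by fact
  interpret R: ring R by (rule R.ring)
  interpret RV: module complex_field R by (rule R.vector_space)
  note fD = algebra_homD[OF f]
  have S: "module complex_field S"
    by (rule module_image[OF R.vector_space algebra_hom_lin_maps[OF f] surj zero])
  have ex: "\<exists>v\<in>carrier R. x = f v" if "x \<in> carrier S" for x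
    using that surj by blast
  note [simp] = fD(2-5)[symmetric] and [simp] = fD(1)
  show ?thesis
  proof (intro complex_algebra.intro S ringI)
    show "abelian_group S" using S by (simp add: module_def)
    show "Group.monoid S"
    proof (rule monoidI)
      fix x y z assume "x \<in> carrier S" "y \<in> carrier S" "z \<in> carrier S"
      then obtain u v w where "u \<in> carrier R" "x = f u" "v \<in> carrier R" "y = f v" "w \<in> carrier R" "z = f w"
        using ex by metis
      then show "x \<otimes>\<^bsub>S\<^esub> y \<otimes>\<^bsub>S\<^esub> z = x \<otimes>\<^bsub>S\<^esub> (y \<otimes>\<^bsub>S\<^esub> z)"
        by (simp add: R.m_assoc)
    next
      fix x y assume "x \<in> carrier S" "y \<in> carrier S"
      then obtain u v where "u \<in> carrier R" "x = f u" "v \<in> carrier R" "y = f v"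
        using ex by metis
      then show "x \<otimes>\<^bsub>S\<^esub> y \<in> carrier S" by simp
    next
      fix x assume "x \<in> carrier S"
      then obtain u where "u \<in> carrier R" "x = f u" using ex by metis
      then show "\<one>\<^bsub>S\<^esub> \<otimes>\<^bsub>S\<^esub> x = x" "x \<otimes>\<^bsub>S\<^esub> \<one>\<^bsub>S\<^esub> = x" by simp_all
    qed simp
  next
    fix x y z assume "x \<in> carrier S" "y \<in> carrier S" "z \<in> carrier S"
    then obtain u v w where "u \<in> carrier R" "x = f u" "v \<in> carrier R" "y = f v" "w \<in> carrier R" "z = f w"
      using ex by metis
    then show "(x \<oplus>\<^bsub>S\<^esub> y) \<otimes>\<^bsub>S\<^esub> z = x \<otimes>\<^bsub>S\<^esub> z \<oplus>\<^bsub>S\<^esub> y \<otimes>\<^bsub>S\<^esub> z"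
      "z \<otimes>\<^bsub>S\<^esub> (x \<oplus>\<^bsub>S\<^esub> y) = z \<otimes>\<^bsub>S\<^esub> x \<oplus>\<^bsub>S\<^esub> z \<otimes>\<^bsub>S\<^esub> y"
      by (simp_all add: R.l_distr R.r_distr)
  next
    fix c x y assume "x \<in> carrier S" "y \<in> carrier S"
    then obtain u v where "u \<in> carrier R" "x = f u" "v \<in> carrier R" "y = f v"
      using ex by metis
    then show "c \<odot>\<^bsub>S\<^esub> x \<otimes>\<^bsub>S\<^esub> y = c \<odot>\<^bsub>S\<^esub> (x \<otimes>\<^bsub>S\<^esub> y)"
      "x \<otimes>\<^bsub>S\<^esub> (c \<odot>\<^bsub>S\<^esub> y) = c \<odot>\<^bsub>S\<^esub> (x \<otimes>\<^bsub>S\<^esub> y)"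
      by (simp_all add: R.smult_mult_left R.smult_mult_right)
  qed
qed

text \<open>The same transport along a pair of surjections, one of algebras and one of vector
  spaces, compatible with the actions. It yields modules over quotient algebras as well as the
  tensor module.\<close>

lemma left_module_image:
  assumes M: "left_module R M" and S: "complex_algebra S"
    and f: "f \<in> algebra_hom R S" "f ` carrier R = carrier S"
    and g: "g \<in> lin_maps M N" "g ` carrier M = carrier N" "g \<zero>\<^bsub>M\<^esub> = \<zero>\<^bsub>N\<^esub>"
    and act: "\<And>a x. \<lbrakk>a \<in> carrier R; x \<in> carrier M\<rbrakk> \<Longrightarrow> act N (f a) (g x) = g (act M a x)"
  shows "left_module S N"
proof -
  interpret M: left_module R M by fact
  interpret R: complex_algebra R by (rule M.algebra)
  interpret R: ring R by (rule R.ring)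
  interpret RV: module complex_field R by (rule R.vector_space)
  interpret V: module complex_field M by (rule M.vector_space)
  note [simp] = algebra_homD(2-5)[OF f(1), symmetric] algebra_homD(1)[OF f(1)]
    lin_mapsD(2-3)[OF g(1), symmetric] lin_mapsD(1)[OF g(1)]
  note [simp] = act M.act_closed M.act_add_left M.act_add_right M.act_smult_left M.act_smult_right M.act_mult M.act_one
  have ex: "\<exists>v\<in>carrier R. x = f v" if "x \<in> carrier S" for x
    using that f(2) by blast
  have ex': "\<exists>v\<in>carrier M. x = g v" if "x \<in> carrier N" for x
    using that g(2) by blast
  show ?thesis
  proof (rule left_module.intro[OF S module_image[OF M.vector_space g]])
    fix a b x assume "a \<in> carrier S" "b \<in> carrier S" "x \<in> carrier N"
    then obtain p q v where "p \<in> carrier R" "a = f p" "q \<in> carrier R" "b = f q" "v \<in> carrier M" "x = g v"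
      using ex ex' by metis
    then show "act N (a \<oplus>\<^bsub>S\<^esub> b) x = act N a x \<oplus>\<^bsub>N\<^esub> act N b x"
      "act N (a \<otimes>\<^bsub>S\<^esub> b) x = act N a (act N b x)"
      by simp_all
  next
    fix a x y assume "a \<in> carrier S" "x \<in> carrier N" "y \<in> carrier N"
    then obtain p u v where "p \<in> carrier R" "a = f p" "u \<in> carrier M" "x = g u" "v \<in> carrier M" "y = g v"
      using ex ex' by metis
    then show "act N a (x \<oplus>\<^bsub>N\<^esub> y) = act N a x \<oplus>\<^bsub>N\<^esub> act N a y" by simp
  next
    fix c a x assume "a \<in> carrier S" "x \<in> carrier N"
    then obtain p u where "p \<in> carrier R" "a = f p" "u \<in> carrier M" "x = g u"
      using ex ex' by metis
    then show "act N a x \<in> carrier N" "act N (c \<odot>\<^bsub>S\<^esub> a) x = c \<odot>\<^bsub>N\<^esub> act N a x"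
      "act N a (c \<odot>\<^bsub>N\<^esub> x) = c \<odot>\<^bsub>N\<^esub> act N a x" by simp_all
  next
    fix x assume "x \<in> carrier N"
    then obtain u where "u \<in> carrier M" "x = g u" using ex' by metis
    then show "act N \<one>\<^bsub>S\<^esub> x = x" by simp
  qed
qed

lemma left_module_pullback:
  assumes "left_module S M" "complex_algebra R" "f \<in> algebra_hom R S"
  shows "left_module R (pullback f M)"
proof -
  interpret M: left_module S M by fact
  note [simp] = algebra_homD[OF assms(3)]
  show ?thesis
    unfolding pullback_def
    by (rule left_module.intro[OF assms(2) module_with_action[OF M.vector_space]])
      (simp_all add: M.act_closed M.act_add_left M.act_add_right M.act_smult_left M.act_smult_right
        M.act_mult M.act_one)
qed

lemma left_module_direct_sum:
  assumes fin: "finite I" and R: "complex_algebra R" and M: "\<And>i. i \<in> I \<Longrightarrow> left_module R (M i)"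
  shows "left_module R (direct_sum I M)"
proof -
  let ?D = "direct_sum I M"
  note VM = left_module.vector_space[OF M]
  note ag = abelian_groupE[OF module.axioms(2)[OF VM]]
  have simps [simp]: "carrier ?D = (\<Pi>\<^sub>E i\<in>I. carrier (M i))" "\<zero>\<^bsub>?D\<^esub> = (\<lambda>i\<in>I. \<zero>\<^bsub>M i\<^esub>)"
    "add ?D = (\<lambda>x y. \<lambda>i\<in>I. x i \<oplus>\<^bsub>M i\<^esub> y i)" "smult ?D = (\<lambda>c x. \<lambda>i\<in>I. c \<odot>\<^bsub>M i\<^esub> x i)"
    "act ?D = (\<lambda>a x. \<lambda>i\<in>I. act (M i) a (x i))"
    using fin by (auto simp: direct_sum_def)
  have memD: "x i \<in> carrier (M i)" if "x \<in> carrier ?D" "i \<in> I" for x i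
    using that by (auto simp: PiE_iff)
  have V: "module complex_field ?D"
  proof (rule complex_moduleI)
    show "abelian_group ?D"
    proof (rule abelian_groupI)
      fix x assume x: "x \<in> carrier ?D"
      show "\<exists>y\<in>carrier ?D. y \<oplus>\<^bsub>?D\<^esub> x = \<zero>\<^bsub>?D\<^esub>"
      proof (rule bexI[of _ "\<lambda>i\<in>I. \<ominus>\<^bsub>M i\<^esub> x i"])
        show "(\<lambda>i\<in>I. \<ominus>\<^bsub>M i\<^esub> x i) \<in> carrier ?D"
          using memD[OF x] abelian_group.a_inv_closed[OF module.axioms(2)[OF VM]] by auto
        show "(\<lambda>i\<in>I. \<ominus>\<^bsub>M i\<^esub> x i) \<oplus>\<^bsub>?D\<^esub> x = \<zero>\<^bsub>?D\<^esub>"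
          using memD[OF x] abelian_group.l_neg[OF module.axioms(2)[OF VM]] by (auto simp: fun_eq_iff)
      qed
    next
      fix x y z assume "x \<in> carrier ?D" "y \<in> carrier ?D" "z \<in> carrier ?D"
      note m = this[THEN memD]
      show "x \<oplus>\<^bsub>?D\<^esub> y \<oplus>\<^bsub>?D\<^esub> z = x \<oplus>\<^bsub>?D\<^esub> (y \<oplus>\<^bsub>?D\<^esub> z)"
        using m ag(3) by (auto simp: fun_eq_iff)
    next
      fix x y assume "x \<in> carrier ?D" "y \<in> carrier ?D"
      note m = this[THEN memD]
      show "x \<oplus>\<^bsub>?D\<^esub> y \<in> carrier ?D" using m ag(1) by auto
      show "x \<oplus>\<^bsub>?D\<^esub> y = y \<oplus>\<^bsub>?D\<^esub> x" using m ag(4) by (auto simp: fun_eq_iff)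
    next
      fix x assume x: "x \<in> carrier ?D"
      \<comment> \<open>The operations return functions that are \<open>undefined\<close> off the
        index set. The unit law therefore gives \<open>restrict x I\<close> first, and this is x
        because carrier elements are extensional.\<close>
      have "\<zero>\<^bsub>?D\<^esub> \<oplus>\<^bsub>?D\<^esub> x = restrict x I"
        using memD[OF x] ag(5) by (auto simp: fun_eq_iff)
      also have "\<dots> = x" using x by (simp add: PiE_restrict)
      finally show "\<zero>\<^bsub>?D\<^esub> \<oplus>\<^bsub>?D\<^esub> x = x" .
    qed (use ag(2) in auto)
  next
    fix x assume x: "x \<in> carrier ?D"
    then have "(\<lambda>i\<in>I. 1 \<odot>\<^bsub>M i\<^esub> x i) = restrict x I"
      using memD[OF x] module.smult_one[OF VM, simplified] by (auto simp: fun_eq_iff)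
    then show "1 \<odot>\<^bsub>?D\<^esub> x = x"
      using x by (auto simp: PiE_restrict)
  qed (auto simp: fun_eq_iff PiE_iff module.smult_closed[OF VM, simplified]
      module.smult_l_distr[OF VM, simplified] module.smult_r_distr[OF VM, simplified]
      module.smult_assoc1[OF VM, simplified])
  show ?thesis
  proof (rule left_module.intro[OF R V])
    fix x assume x: "x \<in> carrier ?D"
    then have "(\<lambda>i\<in>I. act (M i) \<one>\<^bsub>R\<^esub> (x i)) = restrict x I"
      using memD[OF x] left_module.act_one[OF M] by (auto simp: fun_eq_iff)
    then show "act ?D \<one>\<^bsub>R\<^esub> x = x"
      using x by (auto simp: PiE_restrict)
  qed (auto simp: fun_eq_iff PiE_iff left_module.act_closed[OF M] left_module.act_add_left[OF M]
      left_module.act_add_right[OF M] left_module.act_smult_left[OF M] left_module.act_smult_right[OF M]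
      left_module.act_mult[OF M])
qed

section \<open>Quotients by subspaces and by two-sided ideals\<close>

context
  fixes V :: "(complex, 'v, 'm) module_scheme" and I
  assumes V: "module complex_field V" and I: "submodule I complex_field V"
begin

interpretation V: module complex_field V by (rule V)

lemma abelian_subgroup_submodule: "abelian_subgroup I V"
  by (intro abelian_subgroupI3 additive_subgroupI submodule.axioms(1)[OF I] V.M.abelian_group_axioms)

interpretation I: abelian_subgroup I V by (rule abelian_subgroup_submodule)

lemma coset_eq_iff:
  assumes "x \<in> carrier V" "y \<in> carrier V"
  shows "I +>\<^bsub>V\<^esub> x = I +>\<^bsub>V\<^esub> y \<longleftrightarrow> x \<ominus>\<^bsub>V\<^esub> y \<in> I"
proof -
  have "I +>\<^bsub>V\<^esub> x = I +>\<^bsub>V\<^esub> y \<longleftrightarrow> x \<in> I +>\<^bsub>V\<^esub> y"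
    using assms I.a_rcos_self V.M.a_repr_independence[OF _ _ submodule.axioms(1)[OF I]] by metis
  also have "\<dots> \<longleftrightarrow> x \<ominus>\<^bsub>V\<^esub> y \<in> I"
    using assms I.a_rcos_module by (simp add: a_minus_def)
  finally show ?thesis .
qed

lemma carrier_quotient: "carrier (quotient V I) = (\<lambda>x. I +>\<^bsub>V\<^esub> x) ` carrier V"
  by (auto simp: quotient_def A_RCOSETS_def')

lemma coset_lin_maps: "(\<lambda>x. I +>\<^bsub>V\<^esub> x) \<in> lin_maps V (quotient V I)"
proof (rule lin_mapsI)
  show "I +>\<^bsub>V\<^esub> (x \<oplus>\<^bsub>V\<^esub> y) = (I +>\<^bsub>V\<^esub> x) \<oplus>\<^bsub>quotient V I\<^esub> (I +>\<^bsub>V\<^esub> y)"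
    if "x \<in> carrier V" "y \<in> carrier V" for x y
    using that by (simp add: quotient_def I.a_rcos_sum)
  show "I +>\<^bsub>V\<^esub> (c \<odot>\<^bsub>V\<^esub> x) = c \<odot>\<^bsub>quotient V I\<^esub> (I +>\<^bsub>V\<^esub> x)" if x: "x \<in> carrier V" for c x
  proof -
    \<comment> \<open>Scalar multiplication in \<open>quotient\<close> is a union over all members
      of the coset. Every member contributes the same coset, so the union collapses to one.\<close>
    have eq: "I +>\<^bsub>V\<^esub> (c \<odot>\<^bsub>V\<^esub> y) = I +>\<^bsub>V\<^esub> (c \<odot>\<^bsub>V\<^esub> x)" if y: "y \<in> I +>\<^bsub>V\<^esub> x" for y
    proof -
      obtain h where h: "h \<in> I" "y = h \<oplus>\<^bsub>V\<^esub> x"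
        using y by (auto simp: a_r_coset_def')
      then have hV: "h \<in> carrier V" by simp
      have ch: "c \<odot>\<^bsub>V\<^esub> h \<in> I" using submodule.smult_closed[OF I] h by simp
      then have "c \<odot>\<^bsub>V\<^esub> y \<ominus>\<^bsub>V\<^esub> c \<odot>\<^bsub>V\<^esub> x = c \<odot>\<^bsub>V\<^esub> h"
        using h hV x V.smult_closed[simplified]
        by (simp add: V.smult_r_distr[simplified] a_minus_def V.M.a_assoc V.M.r_neg)
      with ch show ?thesis
        using h hV x V.smult_closed[simplified] by (subst coset_eq_iff) simp_all
    qed
    have "c \<odot>\<^bsub>quotient V I\<^esub> (I +>\<^bsub>V\<^esub> x) = (\<Union>y\<in>I +>\<^bsub>V\<^esub> x. I +>\<^bsub>V\<^esub> (c \<odot>\<^bsub>V\<^esub> y))"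
      by (simp add: quotient_def)
    also have "\<dots> = (\<Union>y\<in>I +>\<^bsub>V\<^esub> x. I +>\<^bsub>V\<^esub> (c \<odot>\<^bsub>V\<^esub> x))"
      by (rule SUP_cong[OF refl eq])
    also have "\<dots> = I +>\<^bsub>V\<^esub> (c \<odot>\<^bsub>V\<^esub> x)"
      using I.a_rcos_self[OF x] by blast
    finally show ?thesis ..
  qed
qed (use carrier_quotient in blast)

lemma coset_zero: "I +>\<^bsub>V\<^esub> \<zero>\<^bsub>V\<^esub> = \<zero>\<^bsub>quotient V I\<^esub>"
  by (simp add: quotient_def I.a_subset)

lemma module_quotient: "module complex_field (quotient V I)"
  by (rule module_image[OF V coset_lin_maps carrier_quotient[symmetric] coset_zero])

lemma coset_eq_zero_iff: "x \<in> carrier V \<Longrightarrow> I +>\<^bsub>V\<^esub> x = \<zero>\<^bsub>quotient V I\<^esub> \<longleftrightarrow> x \<in> I"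
  by (subst coset_zero[symmetric], subst coset_eq_iff) (simp_all add: a_minus_def a_inv_def)

lemma rep_quotient:
  assumes "X \<in> carrier (quotient V I)"
  shows "rep X \<in> carrier V" "I +>\<^bsub>V\<^esub> rep X = X"
proof -
  obtain x where x: "x \<in> carrier V" "X = I +>\<^bsub>V\<^esub> x"
    using assms by (auto simp: carrier_quotient)
  then have "x \<in> X" by (simp add: I.a_rcos_self)
  then have rep: "rep X \<in> X" unfolding rep_def by (rule someI)
  then show "rep X \<in> carrier V"
    using x V.M.a_r_coset_subset_G[of I x] I.a_subset by blast
  show "I +>\<^bsub>V\<^esub> rep X = X"
    using rep x V.M.a_repr_independence[OF _ _ submodule.axioms(1)[OF I]] by metis
qed

context
  fixes W :: "(complex, 'w, 'n) module_scheme" and f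
  assumes W: "module complex_field W" and f: "f \<in> lin_maps V W" and fI: "\<And>x. x \<in> I \<Longrightarrow> f x = \<zero>\<^bsub>W\<^esub>"
begin

interpretation W: module complex_field W by (rule W)

text \<open>The chosen representative differs from x by an element of I, where f vanishes. This is
  the single place where independence of \<open>rep\<close> is proved; the later definitions by
  representatives all reduce to it.\<close>

lemma quotient_lift_coset:
  assumes x: "x \<in> carrier V"
  shows "f (rep (I +>\<^bsub>V\<^esub> x)) = f x"
proof -
  let ?y = "rep (I +>\<^bsub>V\<^esub> x)"
  have y: "?y \<in> carrier V" "I +>\<^bsub>V\<^esub> ?y = I +>\<^bsub>V\<^esub> x"
    using rep_quotient[of "I +>\<^bsub>V\<^esub> x"] x by (simp_all add: carrier_quotient)
  then have "f (?y \<ominus>\<^bsub>V\<^esub> x) = \<zero>\<^bsub>W\<^esub>"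
    using x by (intro fI) (simp add: coset_eq_iff[symmetric])
  then show ?thesis
    using x y(1) lin_mapsD(1)[OF f] lin_maps_minus[OF V W f]
    by (metis W.M.a_inv_closed W.M.minus_eq W.M.minus_minus W.M.minus_equality)
qed

lemma quotient_lift_lin_maps: "(\<lambda>X. f (rep X)) \<in> lin_maps (quotient V I) W"
proof (rule lin_mapsI)
  note D = lin_mapsD[OF f]
  fix X assume "X \<in> carrier (quotient V I)"
  then obtain x where x: "x \<in> carrier V" "X = I +>\<^bsub>V\<^esub> x"
    by (auto simp: carrier_quotient)
  then show "f (rep X) \<in> carrier W" by (simp add: quotient_lift_coset D)
  show "f (rep (c \<odot>\<^bsub>quotient V I\<^esub> X)) = c \<odot>\<^bsub>W\<^esub> f (rep X)" for c
    using x D V.smult_closed[simplified]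
    by (simp add: lin_mapsD(3)[OF coset_lin_maps, symmetric] quotient_lift_coset)
  fix Y assume "Y \<in> carrier (quotient V I)"
  then obtain y where y: "y \<in> carrier V" "Y = I +>\<^bsub>V\<^esub> y"
    by (auto simp: carrier_quotient)
  then show "f (rep (X \<oplus>\<^bsub>quotient V I\<^esub> Y)) = f (rep X) \<oplus>\<^bsub>W\<^esub> f (rep Y)"
    using x D by (simp add: lin_mapsD(2)[OF coset_lin_maps, symmetric] quotient_lift_coset)
qed

end

end

context
  fixes R :: "(complex, 'v, 'm) module_scheme" and I
  assumes R: "complex_algebra R" and I: "ideal I R"
begin

interpretation R: complex_algebra R by (rule R)
interpretation R: ring R by (rule R.ring)
interpretation RV: module complex_field R by (rule R.vector_space)
interpretation I: ideal I R by (rule I)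

lemma submodule_ideal: "submodule I complex_field R"
proof (rule RV.submoduleI)
  \<comment> \<open>A scalar multiple is a ring multiple, c x = (c 1) x, so an ideal is closed under
    scalars.\<close>
  show "c \<odot>\<^bsub>R\<^esub> x \<in> I" if "x \<in> I" for c x
    using I.I_l_closed[of x "c \<odot>\<^bsub>R\<^esub> \<one>\<^bsub>R\<^esub>"] that I.a_Hcarr[OF that]
    by (simp add: R.smult_mult_left)
qed (use I.a_Hcarr in auto)

lemma coset_algebra_hom: "(\<lambda>x. I +>\<^bsub>R\<^esub> x) \<in> algebra_hom R (quotient R I)"
  by (rule algebra_homI[OF coset_lin_maps[OF R.vector_space submodule_ideal]])
    (simp_all add: quotient_def I.rcoset_mult_add)

lemma complex_algebra_quotient: "complex_algebra (quotient R I)"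
  by (rule complex_algebra_image[OF R coset_algebra_hom])
    (simp_all add: carrier_quotient[OF R.vector_space submodule_ideal]
      coset_zero[OF R.vector_space submodule_ideal])

lemma quotient_lift_algebra_hom:
  assumes S: "complex_algebra S" and f: "f \<in> algebra_hom R S" and fI: "\<And>x. x \<in> I \<Longrightarrow> f x = \<zero>\<^bsub>S\<^esub>"
  shows "(\<lambda>X. f (rep X)) \<in> algebra_hom (quotient R I) S"
proof (rule algebra_homI)
  let ?Q = "quotient R I"
  note mods = R.vector_space submodule_ideal complex_algebra.vector_space[OF S] algebra_hom_lin_maps[OF f]
  note lift = quotient_lift_coset[OF mods fI]
  show "(\<lambda>X. f (rep X)) \<in> lin_maps ?Q S"
    by (rule quotient_lift_lin_maps[OF mods fI])
  show "f (rep \<one>\<^bsub>?Q\<^esub>) = \<one>\<^bsub>S\<^esub>"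
    using lift[of "\<one>\<^bsub>R\<^esub>"] algebra_homD(5)[OF coset_algebra_hom] algebra_homD(5)[OF f] by simp
  fix X Y assume "X \<in> carrier ?Q" "Y \<in> carrier ?Q"
  then obtain x y where "x \<in> carrier R" "X = I +>\<^bsub>R\<^esub> x" "y \<in> carrier R" "Y = I +>\<^bsub>R\<^esub> y"
    by (auto simp: carrier_quotient[OF mods(1,2)])
  then show "f (rep (X \<otimes>\<^bsub>?Q\<^esub> Y)) = f (rep X) \<otimes>\<^bsub>S\<^esub> f (rep Y)"
    by (simp add: algebra_homD(4)[OF coset_algebra_hom, symmetric] lift algebra_homD(4)[OF f])
qed

lemma left_module_quotient:
  assumes M: "left_module R M"
    and ann: "\<And>a x. \<lbrakk>a \<in> I; x \<in> carrier M\<rbrakk> \<Longrightarrow> act M a x = \<zero>\<^bsub>M\<^esub>"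
  shows "left_module (quotient R I) (with_action M (\<lambda>X. act M (rep X)))"
    and "\<lbrakk>a \<in> carrier R; x \<in> carrier M\<rbrakk> \<Longrightarrow> act M (rep (I +>\<^bsub>R\<^esub> a)) x = act M a x"
proof -
  interpret M: left_module R M by fact
  have lin: "(\<lambda>a. act M a x) \<in> lin_maps R M" if "x \<in> carrier M" for x
    using that by (intro lin_mapsI) (simp_all add: M.act_closed M.act_add_left M.act_smult_left)
  show act: "act M (rep (I +>\<^bsub>R\<^esub> a)) x = act M a x" if "a \<in> carrier R" "x \<in> carrier M" for a x
    using that quotient_lift_coset[OF R.vector_space submodule_ideal M.vector_space lin ann] by blast
  show "left_module (quotient R I) (with_action M (\<lambda>X. act M (rep X)))"
    by (rule left_module_image[OF M complex_algebra_quotient coset_algebra_hom, where g = "\<lambda>x. x"])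
      (auto simp: act lin_maps_def carrier_quotient[OF R.vector_space submodule_ideal])
qed

end

text \<open>Since \<open>Idl\<close> is the least ideal containing the relators, a homomorphism of
  the free algebra that vanishes on them vanishes on all of it. The next lemma plays the same role
  for actions.\<close>

lemma ideal_kernel:
  assumes R: "complex_algebra R" and S: "complex_algebra S" and f: "f \<in> algebra_hom R S"
  shows "ideal {x \<in> carrier R. f x = \<zero>\<^bsub>S\<^esub>} R"
proof -
  interpret ring_hom_ring R S f
    using f by (intro ring_hom_ringI2 complex_algebra.ring R S) (simp add: algebra_hom_def)
  show ?thesis using kernel_is_ideal unfolding a_kernel_def' .
qed

lemma ideal_annihilator:
  assumes M: "left_module R M"
  shows "ideal {a \<in> carrier R. \<forall>x\<in>carrier M. act M a x = \<zero>\<^bsub>M\<^esub>} R"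
proof -
  interpret M: left_module R M by fact
  interpret R: complex_algebra R by (rule M.algebra)
  interpret R: ring R by (rule R.ring)
  interpret RV: module complex_field R by (rule R.vector_space)
  interpret V: module complex_field M by (rule M.vector_space)
  have lin: "x \<in> carrier M \<Longrightarrow> (\<lambda>a. act M a x) \<in> lin_maps R M" "a \<in> carrier R \<Longrightarrow> act M a \<in> lin_maps M M" for x a
    by (auto intro!: lin_mapsI
        simp: M.act_closed M.act_add_left M.act_smult_left M.act_add_right M.act_smult_right)
  note lin0 = lin_maps_zero[OF R.vector_space M.vector_space lin(1)] 
    lin_maps_zero[OF M.vector_space M.vector_space lin(2)]
    lin_maps_a_inv[OF R.vector_space M.vector_space lin(1)]
  show ?thesis
  proof (rule idealI)
    show "subgroup {a \<in> carrier R. \<forall>x\<in>carrier M. act M a x = \<zero>\<^bsub>M\<^esub>} (add_monoid R)"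
      by (rule submodule.axioms(1)[of _ complex_field], rule RV.submoduleI)
        (auto simp: lin0 M.act_add_left M.act_smult_left V.smult_r_null[simplified])
  qed (auto simp: R.ring M.act_mult lin0 M.act_closed)
qed


text \<open>One bilinear extension for several products: with the multiplication of a monoid it is
  the product of the monoid algebra, with a set action it is the linearized action, and with
  \<open>Pair\<close> it is the tensor product of coordinate vectors.\<close>

definition bil :: "('x \<Rightarrow> 'y \<Rightarrow> 'z) \<Rightarrow> ('x \<Rightarrow>\<^sub>0 complex) \<Rightarrow> ('y \<Rightarrow>\<^sub>0 complex) \<Rightarrow> ('z \<Rightarrow>\<^sub>0 complex)"
  where "bil \<mu> p q = lin_ext (\<lambda>x. lin_ext (\<lambda>y. sgl (\<mu> x y) 1) q) p"

text \<open>Exchanging the two finite sums lets facts about the second argument be read off from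
  those about the first.\<close>

lemma bil_flip: "bil \<mu> p q = bil (\<lambda>y x. \<mu> x y) q p"
  unfolding bil_def by (rule lin_ext_swap)

lemma bil_single [simp]: "bil \<mu> (sgl x c) (sgl y d) = sgl (\<mu> x y) (c * d)"
  by (simp add: bil_def)

lemma bil_add_left: "bil \<mu> (p + p') q = bil \<mu> p q + bil \<mu> p' q"
  by (simp add: bil_def lin_ext_add)

lemma bil_add_right: "bil \<mu> p (q + q') = bil \<mu> p q + bil \<mu> p q'"
  by (simp add: bil_def lin_ext_add lin_ext_fun_add)

lemma bil_scl_left: "bil \<mu> (scl c p) q = scl c (bil \<mu> p q)"
  by (simp add: bil_def lin_ext_scl)

lemma bil_scl_right: "bil \<mu> p (scl c q) = scl c (bil \<mu> p q)"
  by (simp add: bil_def lin_ext_scl lin_ext_fun_scl)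

lemma bil_zero [simp]: "bil \<mu> 0 q = 0" "bil \<mu> p 0 = 0"
  using bil_scl_left[of \<mu> 0 0 q] bil_scl_right[of \<mu> p 0 0] by simp_all

lemma bil_minus_left: "bil \<mu> (p - p') q = bil \<mu> p q - bil \<mu> p' q"
  by (simp add: bil_def lin_ext_minus)

lemma bil_minus_right: "bil \<mu> p (q - q') = bil \<mu> p q - bil \<mu> p q'"
  by (simp add: bil_flip[of \<mu>] bil_minus_left)

lemma keys_bil: "(\<And>x y. \<lbrakk>x \<in> supp p; y \<in> supp q\<rbrakk> \<Longrightarrow> \<mu> x y \<in> Z) \<Longrightarrow> supp (bil \<mu> p q) \<subseteq> Z"
  unfolding bil_def by (intro lin_ext_keys) simp

lemma bil_assoc:
  assumes "\<And>x y z. \<lbrakk>x \<in> supp p; y \<in> supp q; z \<in> supp r\<rbrakk> \<Longrightarrow> \<alpha> (\<mu> x y) z = \<beta> x (\<gamma> y z)"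
  shows "bil \<alpha> (bil \<mu> p q) r = bil \<beta> p (bil \<gamma> q r)"
  unfolding bil_def lin_ext_lin_ext lin_ext_single pm.scale_one using assms by (intro lin_ext_cong) simp

lemma bil_single_left_id: "(\<And>y. y \<in> supp q \<Longrightarrow> \<mu> e y = y) \<Longrightarrow> bil \<mu> (sgl e 1) q = q"
  using lin_ext_cong[of q "\<lambda>y. sgl (\<mu> e y) 1" "\<lambda>y. sgl y 1"] by (simp add: bil_def lin_ext_single_id)

lemma bil_lin_maps:
  assumes "\<And>x y. \<lbrakk>x \<in> X; y \<in> Y\<rbrakk> \<Longrightarrow> \<mu> x y \<in> Z"
  shows "supp p \<subseteq> X \<Longrightarrow> bil \<mu> p \<in> lin_maps (free_space Y) (free_space Z)"
    and "supp q \<subseteq> Y \<Longrightarrow> (\<lambda>p. bil \<mu> p q) \<in> lin_maps (free_space X) (free_space Z)"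
proof -
  have "supp (bil \<mu> p q) \<subseteq> Z" if "supp p \<subseteq> X" "supp q \<subseteq> Y" for p q
    using that assms by (intro keys_bil) auto
  then show "supp p \<subseteq> X \<Longrightarrow> bil \<mu> p \<in> lin_maps (free_space Y) (free_space Z)"
    and "supp q \<subseteq> Y \<Longrightarrow> (\<lambda>p. bil \<mu> p q) \<in> lin_maps (free_space X) (free_space Z)"
    by (simp_all add: lin_maps_def bil_add_left bil_add_right bil_scl_left bil_scl_right)
qed

section \<open>Monoid algebras, the free algebra and presented algebras\<close>

lemma monoid_algebra_simps [simp]:
  "carrier (monoid_algebra G) = {p. supp p \<subseteq> carrier G}" "zero (monoid_algebra G) = 0"
  "add (monoid_algebra G) = (+)" "smult (monoid_algebra G) = scl"
  "one (monoid_algebra G) = sgl \<one>\<^bsub>G\<^esub> 1" "mult (monoid_algebra G) = bil (mult G)"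
  by (simp_all add: monoid_algebra_def scl_def bil_def lin_ext_def fun_eq_iff pm.scale_sum_right[unfolded scl_def])

lemma module_monoid_algebra: "module complex_field (monoid_algebra G)"
  by (rule module_cong[OF module_free_space]) simp_all

lemma complex_algebra_monoid_algebra:
  assumes "Group.monoid G"
  shows "complex_algebra (monoid_algebra G)"
proof -
  interpret Group.monoid G by fact
  let ?A = "monoid_algebra G"
  show ?thesis
  proof (intro complex_algebra.intro module_monoid_algebra ringI)
    show "abelian_group ?A" using module_monoid_algebra[of G] by (simp add: module_def)
    show "Group.monoid ?A"
    proof (rule monoidI)
      fix p q r assume "p \<in> carrier ?A" "q \<in> carrier ?A" "r \<in> carrier ?A"
      then show "p \<otimes>\<^bsub>?A\<^esub> q \<otimes>\<^bsub>?A\<^esub> r = p \<otimes>\<^bsub>?A\<^esub> (q \<otimes>\<^bsub>?A\<^esub> r)"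
        by (auto intro!: bil_assoc m_assoc)
    next
      fix p q assume "p \<in> carrier ?A" "q \<in> carrier ?A"
      then show "p \<otimes>\<^bsub>?A\<^esub> q \<in> carrier ?A"
        using keys_bil[of p q "mult G" "carrier G"] by auto
    next
      fix p assume "p \<in> carrier ?A"
      then show "\<one>\<^bsub>?A\<^esub> \<otimes>\<^bsub>?A\<^esub> p = p" "p \<otimes>\<^bsub>?A\<^esub> \<one>\<^bsub>?A\<^esub> = p"
        by (auto intro!: bil_single_left_id simp: bil_flip[of _ p])
    qed simp
  qed (simp_all add: bil_add_left bil_add_right bil_scl_left bil_scl_right)
qed

text \<open>An action of a monoid on a set linearizes. For tensor products the set consists of pairs
  of vectors, on which pairs of algebra elements act before anything is divided out.\<close>

lemma left_module_monoid_algebra: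
  assumes G: "Group.monoid G"
    and closed: "\<And>g y. \<lbrakk>g \<in> carrier G; y \<in> Y\<rbrakk> \<Longrightarrow> \<alpha> g y \<in> Y"
    and mult: "\<And>g h y. \<lbrakk>g \<in> carrier G; h \<in> carrier G; y \<in> Y\<rbrakk> \<Longrightarrow> \<alpha> (g \<otimes>\<^bsub>G\<^esub> h) y = \<alpha> g (\<alpha> h y)"
    and one: "\<And>y. y \<in> Y \<Longrightarrow> \<alpha> \<one>\<^bsub>G\<^esub> y = y"
  shows "left_module (monoid_algebra G) (with_action (free_space Y) (bil \<alpha>))"
proof (rule left_module.intro[OF complex_algebra_monoid_algebra[OF G] module_with_action[OF module_free_space]])
  let ?M = "with_action (free_space Y) (bil \<alpha>)"
  fix a b x assume "a \<in> carrier (monoid_algebra G)" "b \<in> carrier (monoid_algebra G)" "x \<in> carrier ?M"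
  then show "act ?M (a \<otimes>\<^bsub>monoid_algebra G\<^esub> b) x = act ?M a (act ?M b x)"
    by (simp, intro bil_assoc mult) auto
next
  let ?M = "with_action (free_space Y) (bil \<alpha>)"
  fix a x assume "a \<in> carrier (monoid_algebra G)" "x \<in> carrier ?M"
  then show "act ?M a x \<in> carrier ?M"
    using keys_bil[of a x \<alpha> Y] closed by auto
qed (use one in \<open>auto simp: bil_add_left bil_add_right bil_scl_left bil_scl_right intro!: bil_single_left_id\<close>)

lemma word_monoid_simps [simp]:
  "carrier word_monoid = UNIV" "mult word_monoid = (@)" "one word_monoid = []"
  by (simp_all add: word_monoid_def)

lemma complex_algebra_free_algebra: "complex_algebra free_algebra"
  by (intro complex_algebra_monoid_algebra monoidI) simp_all

lemma lin_maps_free_algebra: "lin_maps free_algebra W = lin_maps (free_space UNIV) W"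
  by (simp add: lin_maps_def)

lemma ideal_relators: "ideal (Idl\<^bsub>free_algebra\<^esub> R) free_algebra"
  using ring.genideal_ideal[OF complex_algebra.ring[OF complex_algebra_free_algebra]] by simp

lemma ideal_relators_subset:
  assumes "ideal I free_algebra" "R \<subseteq> I"
  shows "Idl\<^bsub>free_algebra\<^esub> R \<subseteq> I"
  using ring.genideal_minimal[OF complex_algebra.ring[OF complex_algebra_free_algebra] assms] .

lemma relators_subset: "R \<subseteq> Idl\<^bsub>free_algebra\<^esub> R"
  using ring.genideal_self[OF complex_algebra.ring[OF complex_algebra_free_algebra]] by simp

lemma complex_algebra_presented: "complex_algebra (presented_algebra R)"
  unfolding presented_algebra_def
  by (rule complex_algebra_quotient[OF complex_algebra_free_algebra ideal_relators])

definition presented_proj :: "('g list \<Rightarrow>\<^sub>0 complex) set \<Rightarrow> ('g list \<Rightarrow>\<^sub>0 complex) \<Rightarrow> ('g list \<Rightarrow>\<^sub>0 complex) set"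
  where "presented_proj R p = Idl\<^bsub>free_algebra\<^esub> R +>\<^bsub>free_algebra\<^esub> p"

lemma presented_proj_algebra_hom: "presented_proj R \<in> algebra_hom free_algebra (presented_algebra R)"
  unfolding presented_proj_def[abs_def] presented_algebra_def
  by (rule coset_algebra_hom[OF complex_algebra_free_algebra ideal_relators])

lemma carrier_presented: "carrier (presented_algebra R) = range (presented_proj R)"
  unfolding presented_proj_def[abs_def] presented_algebra_def
  using carrier_quotient[OF module_monoid_algebra submodule_ideal[OF complex_algebra_free_algebra ideal_relators]]
  by simp

lemma presented_proj_relator: "r \<in> R \<Longrightarrow> presented_proj R r = \<zero>\<^bsub>presented_algebra R\<^esub>"
  unfolding presented_proj_def presented_algebra_def
  using relators_subset
  by (subst coset_eq_zero_iff[OF module_monoid_algebra submodule_ideal[OF complex_algebra_free_algebra ideal_relators]])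
    auto

lemma generator_eq: "generator R g = presented_proj R (sgl [g] 1)"
  by (simp add: generator_def presented_proj_def)

lemma generator_closed [simp]: "generator R g \<in> carrier (presented_algebra R)"
  by (simp add: generator_eq carrier_presented)

lemma (in complex_algebra) mult_lin_maps:
  assumes "c \<in> carrier A"
  shows "(\<lambda>x. c \<otimes> x) \<in> lin_maps A A" "(\<lambda>x. x \<otimes> c) \<in> lin_maps A A"
proof -
  interpret ring A by (rule ring)
  show "(\<lambda>x. c \<otimes> x) \<in> lin_maps A A" "(\<lambda>x. x \<otimes> c) \<in> lin_maps A A"
    using assms by (auto intro!: lin_mapsI simp: r_distr l_distr smult_mult_left smult_mult_right)
qed

lemma (in left_module) act_lin_maps:
  "x \<in> carrier M \<Longrightarrow> (\<lambda>a. act M a x) \<in> lin_maps A M"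
  "a \<in> carrier A \<Longrightarrow> act M a \<in> lin_maps M M"
  by (auto intro!: lin_mapsI simp: act_closed act_add_left act_smult_left act_add_right act_smult_right)

section \<open>Homomorphisms and actions prescribed on generators\<close>

definition word_eval :: "(complex, 'b, 'm) module_scheme \<Rightarrow> ('g \<Rightarrow> 'b) \<Rightarrow> ('g list \<Rightarrow>\<^sub>0 complex) \<Rightarrow> 'b"
  where "word_eval S \<phi> = linear_extension S (\<lambda>w. foldr (\<lambda>g b. \<phi> g \<otimes>\<^bsub>S\<^esub> b) w \<one>\<^bsub>S\<^esub>)"

context
  fixes S :: "(complex, 'b, 'm) module_scheme" and \<phi> :: "'g \<Rightarrow> 'b"
  assumes S: "complex_algebra S" and \<phi>: "\<And>g. \<phi> g \<in> carrier S"
begin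

interpretation S: complex_algebra S by (rule S)
interpretation S: ring S by (rule S.ring)

lemma foldr_mult_closed: "foldr (\<lambda>g b. \<phi> g \<otimes>\<^bsub>S\<^esub> b) w \<one>\<^bsub>S\<^esub> \<in> carrier S"
  by (induction w) (simp_all add: \<phi>)

lemma word_eval_lin_maps: "word_eval S \<phi> \<in> lin_maps (free_space UNIV) S"
  unfolding word_eval_def by (rule linear_extension_lin_maps[OF S.vector_space]) (simp add: foldr_mult_closed)

lemma word_eval_word: "word_eval S \<phi> (sgl w 1) = foldr (\<lambda>g b. \<phi> g \<otimes>\<^bsub>S\<^esub> b) w \<one>\<^bsub>S\<^esub>"
  unfolding word_eval_def
  by (rule linear_extension_single_one[OF S.vector_space, where X = UNIV]) (simp_all add: foldr_mult_closed)

lemma word_eval_append: "word_eval S \<phi> (sgl (v @ w) 1) = word_eval S \<phi> (sgl v 1) \<otimes>\<^bsub>S\<^esub> word_eval S \<phi> (sgl w 1)"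
  by (induction v) (simp_all add: word_eval_word S.m_assoc \<phi> foldr_mult_closed del: foldr_append)

text \<open>Both sides are linear in each argument, so the claim reduces to two words, where it is
  associativity: first q is extended linearly for a fixed word, then p.\<close>

lemma word_eval_bil: "word_eval S \<phi> (bil (@) p q) = word_eval S \<phi> p \<otimes>\<^bsub>S\<^esub> word_eval S \<phi> q"
proof -
  note D = lin_mapsD(1)[OF word_eval_lin_maps, simplified]
  have "word_eval S \<phi> (bil (@) (sgl v 1) q) = word_eval S \<phi> (sgl v 1) \<otimes>\<^bsub>S\<^esub> word_eval S \<phi> q" for v
    by (rule free_space_lin_maps_eq[where X = UNIV, OF S.vector_space
          lin_maps_comp[OF bil_lin_maps(1)[where X = UNIV and Z = UNIV] word_eval_lin_maps]
          lin_maps_comp[OF word_eval_lin_maps S.mult_lin_maps(1)]])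
      (simp_all add: D word_eval_append)
  then show ?thesis
    by (intro free_space_lin_maps_eq[where X = UNIV and p = p, OF S.vector_space
          lin_maps_comp[OF bil_lin_maps(2)[where Y = UNIV and Z = UNIV] word_eval_lin_maps]
          lin_maps_comp[OF word_eval_lin_maps S.mult_lin_maps(2)]])
      (simp_all add: D)
qed

lemma word_eval_algebra_hom: "word_eval S \<phi> \<in> algebra_hom free_algebra S"
  using word_eval_lin_maps word_eval_word[of "[]"]
  by (intro algebra_homI) (simp_all add: lin_maps_free_algebra word_eval_bil)

lemma word_eval_generator: "word_eval S \<phi> (sgl [g] 1) = \<phi> g"
  by (simp add: word_eval_word \<phi>)

context
  fixes R assumes R: "\<And>r. r \<in> R \<Longrightarrow> word_eval S \<phi> r = \<zero>\<^bsub>S\<^esub>"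
begin

text \<open>The kernel of the evaluation is an ideal containing R, hence contains the ideal
  generated by R. This is what makes \<open>presented_hom\<close> independent of the
  representative.\<close>

lemma word_eval_relators: "x \<in> Idl\<^bsub>free_algebra\<^esub> R \<Longrightarrow> word_eval S \<phi> x = \<zero>\<^bsub>S\<^esub>"
  using ideal_relators_subset[OF ideal_kernel[OF complex_algebra_free_algebra S word_eval_algebra_hom], of R] R
  by auto

lemma presented_hom_algebra_hom: "presented_hom S \<phi> \<in> algebra_hom (presented_algebra R) S"
  using quotient_lift_algebra_hom[OF complex_algebra_free_algebra ideal_relators S word_eval_algebra_hom word_eval_relators]
  by (simp add: presented_hom_def[abs_def] word_eval_def presented_algebra_def)

lemma presented_hom_generator: "presented_hom S \<phi> (generator R g) = \<phi> g"
proof -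
  have "word_eval S \<phi> (rep (generator R g)) = word_eval S \<phi> (sgl [g] 1)"
    unfolding generator_def
    by (rule quotient_lift_coset[OF module_monoid_algebra submodule_ideal[OF complex_algebra_free_algebra ideal_relators]
          S.vector_space algebra_hom_lin_maps[OF word_eval_algebra_hom] word_eval_relators]) simp_all
  also have "\<dots> = \<phi> g" by (rule word_eval_generator)
  finally show ?thesis by (simp add: presented_hom_def word_eval_def)
qed

end

end

definition word_action ::
    "(complex, 'v, 'm) module_scheme \<Rightarrow> ('g \<Rightarrow> 'v \<Rightarrow> 'v) \<Rightarrow> ('g list \<Rightarrow>\<^sub>0 complex) \<Rightarrow> 'v \<Rightarrow> 'v"
  where "word_action V \<rho> p v = linear_extension V (\<lambda>w. foldr \<rho> w v) p"

context
  fixes V :: "(complex, 'v, 'm) module_scheme" and \<rho> :: "'g \<Rightarrow> 'v \<Rightarrow> 'v"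
  assumes V: "module complex_field V" and \<rho>: "\<And>g. \<rho> g \<in> lin_maps V V"
begin

interpretation V: module complex_field V by (rule V)

lemma foldr_lin_maps: "foldr \<rho> w \<in> lin_maps V V"
proof (induction w)
  case (Cons g w)
  then show ?case using lin_maps_comp[OF Cons \<rho>[of g]] by (simp add: comp_def)
qed (simp add: lin_maps_def)

lemma word_action_lin_maps_left: "v \<in> carrier V \<Longrightarrow> (\<lambda>p. word_action V \<rho> p v) \<in> lin_maps (free_space UNIV) V"
  unfolding word_action_def using lin_mapsD(1)[OF foldr_lin_maps] by (intro linear_extension_lin_maps[OF V]) simp

lemma word_action_word: "v \<in> carrier V \<Longrightarrow> word_action V \<rho> (sgl w 1) v = foldr \<rho> w v"
  unfolding word_action_def using lin_mapsD(1)[OF foldr_lin_maps]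
  by (intro linear_extension_single_one[OF V, where X = UNIV]) simp_all

lemma word_action_lin_maps: "word_action V \<rho> p \<in> lin_maps V V"
proof -
  note D = lin_mapsD[OF word_action_lin_maps_left, simplified]
  have "supp p \<subseteq> UNIV" by simp
  then show ?thesis
  proof (induction rule: free_space_induct)
    case zero
    have "word_action V \<rho> 0 v = \<zero>\<^bsub>V\<^esub>" if "v \<in> carrier V" for v
      using lin_maps_zero[OF module_free_space V word_action_lin_maps_left[OF that]] by simp
    then show ?case by (intro lin_mapsI) (simp_all add: V.smult_r_null[simplified])
  next
    case (single w c)
    have "word_action V \<rho> (sgl w c) v = c \<odot>\<^bsub>V\<^esub> foldr \<rho> w v" if "v \<in> carrier V" for v
      using D(3)[OF that, of c "sgl w 1"] that by (simp add: word_action_word)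
    then show ?case
      using lin_mapsD[OF foldr_lin_maps] 
      by (intro lin_mapsI) (simp_all add: V.smult_r_distr[simplified] V.smult_assoc1[simplified, symmetric] mult.commute)
  next
    case (add p q)
    note P = lin_mapsD[OF add(3)] and Q = lin_mapsD[OF add(4)]
    show ?case
      by (rule lin_mapsI)
        (simp_all add: D P Q V.M.a_ac V.smult_r_distr[simplified] V.smult_closed[simplified])
  qed
qed

lemma word_action_bil:
  assumes v: "v \<in> carrier V"
  shows "word_action V \<rho> (bil (@) p q) v = word_action V \<rho> p (word_action V \<rho> q v)"
proof -
  note D = lin_mapsD(1)[OF word_action_lin_maps]
  have "word_action V \<rho> (bil (@) (sgl u 1) q) v = word_action V \<rho> (sgl u 1) (word_action V \<rho> q v)" for u
    by (rule free_space_lin_maps_eq[where X = UNIV, OF V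
          lin_maps_comp[OF bil_lin_maps(1)[where X = UNIV and Z = UNIV] word_action_lin_maps_left[OF v]]
          lin_maps_comp[OF word_action_lin_maps_left[OF v] word_action_lin_maps]])
      (simp_all add: word_action_word v lin_mapsD(1)[OF foldr_lin_maps])
  then show ?thesis
    by (intro free_space_lin_maps_eq[where X = UNIV and p = p, OF V
          lin_maps_comp[OF bil_lin_maps(2)[where Y = UNIV and Z = UNIV] word_action_lin_maps_left[OF v]]
          word_action_lin_maps_left])
      (simp_all add: D v)
qed

lemma left_module_word_action: "left_module free_algebra (with_action V (word_action V \<rho>))"
  by (rule left_module.intro[OF complex_algebra_free_algebra module_with_action[OF V]])
    (simp_all add: lin_mapsD[OF word_action_lin_maps] lin_mapsD[OF word_action_lin_maps_left, simplified]
    word_action_bil word_action_word)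

text \<open>The elements of the free algebra that act as zero form an ideal; it contains R by
  assumption, so the word action descends to the quotient.\<close>

lemma left_module_presented:
  assumes R: "\<And>r v. \<lbrakk>r \<in> R; v \<in> carrier V\<rbrakk> \<Longrightarrow> word_action V \<rho> r v = \<zero>\<^bsub>V\<^esub>"
  shows "left_module (presented_algebra R) (with_action V (presented_action V \<rho>))"
    and "v \<in> carrier V \<Longrightarrow> presented_action V \<rho> (generator R g) v = \<rho> g v"
proof -
  let ?M = "with_action V (word_action V \<rho>)"
  have ann: "act ?M a x = \<zero>\<^bsub>?M\<^esub>" if "a \<in> Idl\<^bsub>free_algebra\<^esub> R" "x \<in> carrier ?M" for a x
    using ideal_relators_subset[OF ideal_annihilator[OF left_module_word_action], of R] R that by auto
  note * = left_module_quotient[OF complex_algebra_free_algebra ideal_relators left_module_word_action ann]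
  have eq: "presented_action V \<rho> = (\<lambda>X. word_action V \<rho> (rep X))"
    by (simp add: fun_eq_iff presented_action_def word_action_def)
  show "left_module (presented_algebra R) (with_action V (presented_action V \<rho>))"
    using *(1) by (simp add: eq presented_algebra_def with_action_def)
  show "presented_action V \<rho> (generator R g) v = \<rho> g v" if "v \<in> carrier V"
  proof -
    have "act ?M (rep (generator R g)) v = act ?M (sgl [g] 1) v"
      unfolding generator_def using that by (intro *(2)) simp_all
    then show ?thesis using that by (simp add: eq word_action_word)
  qed
qed

end

text \<open>Commuting with two operators implies commuting with their product and with linear
  combinations, and the images of words span the presented algebra.\<close>

lemma presented_module_hom:
  assumes M: "left_module (presented_algebra R) M" and N: "left_module (presented_algebra R) N"
    and h: "h \<in> lin_maps M N"
    and gen: "\<And>g x. x \<in> carrier M \<Longrightarrow> h (act M (generator R g) x) = act N (generator R g) (h x)"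
  shows "h \<in> alg_module_hom (presented_algebra R) M N"
proof -
  let ?P = "presented_algebra R" and ?\<pi> = "presented_proj R"
  interpret M: left_module ?P M by fact
  interpret N: left_module ?P N by fact
  interpret N: module complex_field N by (rule N.vector_space)
  note \<pi> = algebra_homD[OF presented_proj_algebra_hom[of R], simplified]
  note h = lin_mapsD[OF h]
  have word: "\<forall>x\<in>carrier M. h (act M (?\<pi> (sgl w 1)) x) = act N (?\<pi> (sgl w 1)) (h x)" for w
  proof (induction w)
    case Nil
    show ?case using \<pi>(5) h by (simp add: M.act_one N.act_one)
  next
    case (Cons g w)
    have "?\<pi> (sgl (g # w) 1) = generator R g \<otimes>\<^bsub>?P\<^esub> ?\<pi> (sgl w 1)"
      unfolding generator_eq \<pi>(4)[symmetric] by simp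
    with Cons show ?case using gen h \<pi>(1) by (simp add: M.act_mult N.act_mult M.act_closed)
  qed
  have "\<forall>x\<in>carrier M. h (act M (?\<pi> p) x) = act N (?\<pi> p) (h x)" for p
  proof -
    have "supp p \<subseteq> UNIV" by simp
    then show ?thesis
    proof (induction rule: free_space_induct)
      case zero
      \<comment> \<open>Zero is written as 0 times itself, so that the scalar axiom shows that it
        acts as zero on both modules.\<close>
      have "?\<pi> 0 = 0 \<odot>\<^bsub>?P\<^esub> ?\<pi> 0" using \<pi>(3)[where c = 0 and x = 0] by simp
      then have "act M (?\<pi> 0) x = 0 \<odot>\<^bsub>M\<^esub> act M (?\<pi> 0) x" "act N (?\<pi> 0) y = 0 \<odot>\<^bsub>N\<^esub> act N (?\<pi> 0) y"
        if "x \<in> carrier M" "y \<in> carrier N" for x y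
        using that by (metis M.act_smult_left N.act_smult_left \<pi>(1))+
      then show ?case
        using h M.act_closed N.act_closed \<pi>(1) N.smult_l_null[simplified] by metis
    next
      case (single w c)
      then show ?case
        using word[of w] \<pi>(3)[where c = c and x = "sgl w 1"] \<pi>(1) h by (simp add: M.act_smult_left N.act_smult_left M.act_closed)
    next
      case (add p q)
      then show ?case using \<pi>(1) h by (simp add: \<pi>(2) M.act_add_left N.act_add_left M.act_closed)
    qed
  qed
  then show ?thesis
    using h by (auto simp: alg_module_hom_def carrier_presented)
qed


section \<open>Tensor products\<close>

definition tensor_proj ::
    "(complex, 'v, 'm) module_scheme \<Rightarrow> (complex, 'w, 'n) module_scheme \<Rightarrow>
     ('v \<times> 'w \<Rightarrow>\<^sub>0 complex) \<Rightarrow> ('v \<times> 'w \<Rightarrow>\<^sub>0 complex) set"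
  where "tensor_proj V W p = tensor_kernel V W +>\<^bsub>free_space (carrier V \<times> carrier W)\<^esub> p"

context
  fixes V :: "(complex, 'v, 'm) module_scheme" and W :: "(complex, 'w, 'n) module_scheme"
  assumes V: "module complex_field V" and W: "module complex_field W"
begin

interpretation V: module complex_field V by (rule V)
interpretation W: module complex_field W by (rule W)

abbreviation (input) "FS \<equiv> free_space (carrier V \<times> carrier W)"

lemma tensor_relators_subset: "tensor_relators V W \<subseteq> carrier FS"
  by (auto simp: tensor_relators_def in_keys_iff lookup_minus lookup_single when_def
      V.smult_closed[simplified] W.smult_closed[simplified] split: if_splits)

lemma submodule_tensor_kernel: "submodule (tensor_kernel V W) complex_field FS"
proof -
  interpret FS: module complex_field FS by (rule module_free_space)
  let ?S = "{N. submodule N complex_field FS \<and> tensor_relators V W \<subseteq> N}"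
  \<comment> \<open>The family must have a member, since an empty intersection would be
    \<open>UNIV\<close>; the whole free space is one.\<close>
  have top: "carrier FS \<in> ?S"
    using tensor_relators_subset FS.submoduleI[of "carrier FS"] FS.smult_closed by blast
  note E = FS.submoduleE
  have zero: "\<zero>\<^bsub>FS\<^esub> \<in> N" if "N \<in> ?S" for N
    using subgroup.one_closed[OF submodule.axioms(1), of N complex_field FS] that by simp
  show ?thesis
    unfolding tensor_kernel_def
  proof (rule FS.submoduleI)
    show "\<Inter> ?S \<subseteq> carrier FS" using top by blast
    show "\<zero>\<^bsub>FS\<^esub> \<in> \<Inter> ?S" using zero by blast
    show "\<ominus>\<^bsub>FS\<^esub> a \<in> \<Inter> ?S" if "a \<in> \<Inter> ?S" for a using that E(3) by blast
    show "a \<oplus>\<^bsub>FS\<^esub> b \<in> \<Inter> ?S" if "a \<in> \<Inter> ?S" "b \<in> \<Inter> ?S" for a b using that E(5) by blast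
    show "a \<odot>\<^bsub>FS\<^esub> x \<in> \<Inter> ?S" if "a \<in> carrier complex_field" "x \<in> \<Inter> ?S" for a x using that E(4) by blast
  qed
qed

lemma tensor_kernel_subset: "x \<in> tensor_kernel V W \<Longrightarrow> supp x \<subseteq> carrier V \<times> carrier W"
  using module.submoduleE(1)[OF module_free_space submodule_tensor_kernel] by auto

lemma tensor_relators_kernel: "tensor_relators V W \<subseteq> tensor_kernel V W"
  unfolding tensor_kernel_def by blast

lemma tensor_kernel_least:
  "\<lbrakk>submodule N complex_field FS; tensor_relators V W \<subseteq> N\<rbrakk> \<Longrightarrow> tensor_kernel V W \<subseteq> N"
  unfolding tensor_kernel_def by blast

lemma tensor_proj_lin_maps: "tensor_proj V W \<in> lin_maps FS (tensor_space V W)"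
  unfolding tensor_proj_def[abs_def] tensor_space_def
  by (rule coset_lin_maps[OF module_free_space submodule_tensor_kernel])

lemma carrier_tensor_space: "carrier (tensor_space V W) = tensor_proj V W ` carrier FS"
  unfolding tensor_proj_def[abs_def] tensor_space_def
  by (rule carrier_quotient[OF module_free_space submodule_tensor_kernel])

lemma module_tensor_space: "module complex_field (tensor_space V W)"
  unfolding tensor_space_def by (rule module_quotient[OF module_free_space submodule_tensor_kernel])

lemma tensor_proj_zero: "tensor_proj V W 0 = \<zero>\<^bsub>tensor_space V W\<^esub>"
  using coset_zero[OF module_free_space submodule_tensor_kernel] by (simp add: tensor_proj_def tensor_space_def)

lemma tensor_proj_eq_iff:
  "\<lbrakk>supp p \<subseteq> carrier V \<times> carrier W; supp q \<subseteq> carrier V \<times> carrier W\<rbrakk> \<Longrightarrow>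
    tensor_proj V W p = tensor_proj V W q \<longleftrightarrow> p - q \<in> tensor_kernel V W"
  using coset_eq_iff[OF module_free_space submodule_tensor_kernel, of p q] by (simp add: tensor_proj_def)

lemma tensor_proj_eq_zero_iff:
  "supp p \<subseteq> carrier V \<times> carrier W \<Longrightarrow> tensor_proj V W p = \<zero>\<^bsub>tensor_space V W\<^esub> \<longleftrightarrow> p \<in> tensor_kernel V W"
  using tensor_proj_eq_iff[of p 0] by (simp add: tensor_proj_zero)

lemma rep_tensor_space:
  assumes "X \<in> carrier (tensor_space V W)"
  shows "supp (rep X) \<subseteq> carrier V \<times> carrier W" "tensor_proj V W (rep X) = X"
  using rep_quotient[OF module_free_space submodule_tensor_kernel] assms
  by (simp_all add: tensor_space_def tensor_proj_def)

lemma pure_tensor_eq: "pure_tensor V W v w = tensor_proj V W (sgl (v, w) 1)"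
  by (simp add: pure_tensor_def tensor_proj_def)

lemma pure_tensor_closed:
  "\<lbrakk>v \<in> carrier V; w \<in> carrier W\<rbrakk> \<Longrightarrow> pure_tensor V W v w \<in> carrier (tensor_space V W)"
  by (simp add: pure_tensor_eq carrier_tensor_space)

lemma pure_tensor_lin_maps_left:
  assumes w: "w \<in> carrier W"
  shows "(\<lambda>v. pure_tensor V W v w) \<in> lin_maps V (tensor_space V W)"
proof (rule lin_mapsI)
  fix v assume v: "v \<in> carrier V"
  show "pure_tensor V W v w \<in> carrier (tensor_space V W)" using v w by (rule pure_tensor_closed)
  show "pure_tensor V W (c \<odot>\<^bsub>V\<^esub> v) w = c \<odot>\<^bsub>tensor_space V W\<^esub> pure_tensor V W v w" for c
  proof -
    have "sgl (c \<odot>\<^bsub>V\<^esub> v, w) 1 - sgl (v, w) c \<in> tensor_relators V W"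
      using v w unfolding tensor_relators_def by blast
    then have "tensor_proj V W (sgl (c \<odot>\<^bsub>V\<^esub> v, w) 1) = tensor_proj V W (sgl (v, w) c)"
      using v w tensor_relators_kernel by (subst tensor_proj_eq_iff) (auto simp: V.smult_closed[simplified])
    then show ?thesis
      using v w lin_mapsD(3)[OF tensor_proj_lin_maps, of "sgl (v, w) 1" c] by (simp add: pure_tensor_eq)
  qed
  fix v' assume v': "v' \<in> carrier V"
  have "sgl (v \<oplus>\<^bsub>V\<^esub> v', w) 1 - (sgl (v, w) 1 + sgl (v', w) 1) \<in> tensor_relators V W"
    using v v' w unfolding tensor_relators_def diff_diff_eq[symmetric] by blast
  then have "tensor_proj V W (sgl (v \<oplus>\<^bsub>V\<^esub> v', w) 1) = tensor_proj V W (sgl (v, w) 1 + sgl (v', w) 1)"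
    using v v' w tensor_relators_kernel keys_add[of "sgl (v, w) (1::complex)" "sgl (v', w) 1"]
    by (subst tensor_proj_eq_iff) auto
  then show "pure_tensor V W (v \<oplus>\<^bsub>V\<^esub> v') w = pure_tensor V W v w \<oplus>\<^bsub>tensor_space V W\<^esub> pure_tensor V W v' w"
    using v v' w lin_mapsD(2)[OF tensor_proj_lin_maps, of "sgl (v, w) 1" "sgl (v', w) 1"] by (simp add: pure_tensor_eq)
qed

lemma pure_tensor_lin_maps_right:
  assumes v: "v \<in> carrier V"
  shows "pure_tensor V W v \<in> lin_maps W (tensor_space V W)"
proof (rule lin_mapsI)
  fix w assume w: "w \<in> carrier W"
  show "pure_tensor V W v w \<in> carrier (tensor_space V W)" using v w by (rule pure_tensor_closed)
  show "pure_tensor V W v (c \<odot>\<^bsub>W\<^esub> w) = c \<odot>\<^bsub>tensor_space V W\<^esub> pure_tensor V W v w" for c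
  proof -
    have "sgl (v, c \<odot>\<^bsub>W\<^esub> w) 1 - sgl (v, w) c \<in> tensor_relators V W"
      using v w unfolding tensor_relators_def by blast
    then have "tensor_proj V W (sgl (v, c \<odot>\<^bsub>W\<^esub> w) 1) = tensor_proj V W (sgl (v, w) c)"
      using v w tensor_relators_kernel by (subst tensor_proj_eq_iff) (auto simp: W.smult_closed[simplified])
    then show ?thesis
      using v w lin_mapsD(3)[OF tensor_proj_lin_maps, of "sgl (v, w) 1" c] by (simp add: pure_tensor_eq)
  qed
  fix w' assume w': "w' \<in> carrier W"
  have "sgl (v, w \<oplus>\<^bsub>W\<^esub> w') 1 - (sgl (v, w) 1 + sgl (v, w') 1) \<in> tensor_relators V W"
    using v w w' unfolding tensor_relators_def diff_diff_eq[symmetric] by blast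
  then have "tensor_proj V W (sgl (v, w \<oplus>\<^bsub>W\<^esub> w') 1) = tensor_proj V W (sgl (v, w) 1 + sgl (v, w') 1)"
    using v w w' tensor_relators_kernel keys_add[of "sgl (v, w) (1::complex)" "sgl (v, w') 1"]
    by (subst tensor_proj_eq_iff) auto
  then show "pure_tensor V W v (w \<oplus>\<^bsub>W\<^esub> w') = pure_tensor V W v w \<oplus>\<^bsub>tensor_space V W\<^esub> pure_tensor V W v w'"
    using v w w' lin_mapsD(2)[OF tensor_proj_lin_maps, of "sgl (v, w) 1" "sgl (v, w') 1"] by (simp add: pure_tensor_eq)
qed

lemma tensor_lin_maps_eq:
  assumes U: "module complex_field U"
    and f: "f \<in> lin_maps (tensor_space V W) U" and g: "g \<in> lin_maps (tensor_space V W) U"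
    and eq: "\<And>v w. \<lbrakk>v \<in> carrier V; w \<in> carrier W\<rbrakk> \<Longrightarrow> f (pure_tensor V W v w) = g (pure_tensor V W v w)"
    and X: "X \<in> carrier (tensor_space V W)"
  shows "f X = g X"
proof -
  obtain p where "supp p \<subseteq> carrier V \<times> carrier W" "X = tensor_proj V W p"
    using X by (auto simp: carrier_tensor_space)
  then show ?thesis
    using free_space_lin_maps_eq[OF U lin_maps_comp[OF tensor_proj_lin_maps f]
        lin_maps_comp[OF tensor_proj_lin_maps g], of p] eq
    by (auto simp: pure_tensor_eq)
qed

section \<open>The universal property of the tensor product\<close>

context
  fixes U :: "(complex, 'u, 'o) module_scheme" and \<beta> :: "'v \<Rightarrow> 'w \<Rightarrow> 'u"
  assumes U: "module complex_field U"
    and left: "\<And>w. w \<in> carrier W \<Longrightarrow> (\<lambda>v. \<beta> v w) \<in> lin_maps V U"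
    and right: "\<And>v. v \<in> carrier V \<Longrightarrow> \<beta> v \<in> lin_maps W U"
begin

interpretation U: module complex_field U by (rule U)

abbreviation (input) "ext \<equiv> linear_extension U (\<lambda>(v, w). \<beta> v w)"

lemma bilinear_ext_lin_maps: "ext \<in> lin_maps FS U"
  using lin_mapsD(1)[OF left] by (intro linear_extension_lin_maps[OF U]) auto

lemma bilinear_ext_single:
  "\<lbrakk>v \<in> carrier V; w \<in> carrier W\<rbrakk> \<Longrightarrow> ext (sgl (v, w) c) = c \<odot>\<^bsub>U\<^esub> \<beta> v w"
  using lin_mapsD(1)[OF left] by (subst linear_extension_single[OF U, where X = "carrier V \<times> carrier W"]) auto

text \<open>Bilinearity says exactly that each relator is sent to zero. The kernel of the linear
  extension is a subspace, and \<open>tensor_kernel\<close> is the least subspace containing the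
  relators.\<close>

lemma bilinear_ext_kernel: "p \<in> tensor_kernel V W \<Longrightarrow> ext p = \<zero>\<^bsub>U\<^esub>"
proof -
  have minus: "ext (p - q) = ext p \<ominus>\<^bsub>U\<^esub> ext q \<and> supp (p - q) \<subseteq> carrier V \<times> carrier W"
    if "supp p \<subseteq> carrier V \<times> carrier W" "supp q \<subseteq> carrier V \<times> carrier W" for p q
    using lin_maps_minus[OF module_free_space U bilinear_ext_lin_maps, of p q] that keys_diff[of p q] by auto
  note D = lin_mapsD[OF left] lin_mapsD[OF right]
  have cancel: "x \<oplus>\<^bsub>U\<^esub> y \<ominus>\<^bsub>U\<^esub> x \<ominus>\<^bsub>U\<^esub> y = \<zero>\<^bsub>U\<^esub>" if "x \<in> carrier U" "y \<in> carrier U" for x y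
  proof -
    have "x \<oplus>\<^bsub>U\<^esub> y \<ominus>\<^bsub>U\<^esub> x \<ominus>\<^bsub>U\<^esub> y = (x \<oplus>\<^bsub>U\<^esub> y) \<oplus>\<^bsub>U\<^esub> \<ominus>\<^bsub>U\<^esub> (x \<oplus>\<^bsub>U\<^esub> y)"
      using that by (simp add: a_minus_def U.M.a_assoc U.M.minus_add)
    also have "\<dots> = \<zero>\<^bsub>U\<^esub>" using that by (intro U.M.r_neg) simp
    finally show ?thesis .
  qed
  have "ext r = \<zero>\<^bsub>U\<^esub>" if "r \<in> tensor_relators V W" for r
    using that unfolding tensor_relators_def
    by (auto simp: minus bilinear_ext_single D U.smult_one[simplified] V.smult_closed[simplified]
        W.smult_closed[simplified] U.smult_closed[simplified] cancel U.M.r_neg a_minus_def[of U "_ \<odot>\<^bsub>U\<^esub> _"])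
  then have "tensor_relators V W \<subseteq> {p \<in> carrier FS. ext p = \<zero>\<^bsub>U\<^esub>}"
    using tensor_relators_subset by blast
  then show "p \<in> tensor_kernel V W \<Longrightarrow> ext p = \<zero>\<^bsub>U\<^esub>"
    using tensor_kernel_least[OF submodule_kernel[OF module_free_space U bilinear_ext_lin_maps]] by blast
qed

lemma tensor_lift_lin_maps: "(\<lambda>X. ext (rep X)) \<in> lin_maps (tensor_space V W) U"
  unfolding tensor_space_def
  by (rule quotient_lift_lin_maps[OF module_free_space submodule_tensor_kernel U bilinear_ext_lin_maps bilinear_ext_kernel])

lemma tensor_lift_pure: "\<lbrakk>v \<in> carrier V; w \<in> carrier W\<rbrakk> \<Longrightarrow> ext (rep (pure_tensor V W v w)) = \<beta> v w"
  unfolding pure_tensor_def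
  using lin_mapsD(1)[OF left]
  by (subst quotient_lift_coset[OF module_free_space submodule_tensor_kernel U bilinear_ext_lin_maps bilinear_ext_kernel])
    (simp_all add: bilinear_ext_single U.smult_one[simplified])

end

end

text \<open>Functoriality of the tensor product on the level of free spaces: (v, w) \<mapsto> f v
  \<otimes> g w is bilinear, so its extension kills the kernel of the source. Taking multiplications
  or module actions for f and g gives the ideal property and the well-definedness of the
  action.\<close>

lemma tensor_kernel_map:
  assumes V: "module complex_field V" and W: "module complex_field W"
    and V': "module complex_field V'" and W': "module complex_field W'"
    and f: "f \<in> lin_maps V V'" and g: "g \<in> lin_maps W W'"
    and p: "p \<in> tensor_kernel V W"
  shows "lin_ext (\<lambda>y. sgl (case y of (v, w) \<Rightarrow> (f v, g w)) 1) p \<in> tensor_kernel V' W'"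
proof -
  let ?T = "tensor_space V' W'" and ?h = "\<lambda>y. sgl (case y of (v, w) \<Rightarrow> (f v, g w)) 1"
  have supp: "supp p \<subseteq> carrier V \<times> carrier W" by (rule tensor_kernel_subset[OF V W p])
  have h: "?h \<in> supp p \<rightarrow> carrier (free_space (carrier V' \<times> carrier W'))"
    using supp lin_mapsD(1)[OF f] lin_mapsD(1)[OF g] by auto
  then have "supp (?h y) \<subseteq> carrier V' \<times> carrier W'" if "y \<in> supp p" for y
    using that by auto
  then have keys: "supp (lin_ext ?h p) \<subseteq> carrier V' \<times> carrier W'"
    by (rule lin_ext_keys)
  have "tensor_proj V' W' (lin_ext ?h p) = tensor_proj V' W' (linear_extension (free_space (carrier V' \<times> carrier W')) ?h p)"
    by (simp add: linear_extension_free_space[OF h])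
  also have "\<dots> = linear_extension ?T (\<lambda>y. tensor_proj V' W' (?h y)) p"
    by (rule lin_maps_linear_extension[OF module_free_space module_tensor_space[OF V' W'] tensor_proj_lin_maps[OF V' W'] h])
  also have "(\<lambda>y. tensor_proj V' W' (?h y)) = (\<lambda>(v, w). pure_tensor V' W' (f v) (g w))"
    by (auto simp: pure_tensor_eq[OF V' W'])
  also have "linear_extension ?T (\<lambda>(v, w). pure_tensor V' W' (f v) (g w)) p = \<zero>\<^bsub>?T\<^esub>"
    by (rule bilinear_ext_kernel[OF V W module_tensor_space[OF V' W'] _ _ p])
      (rule lin_maps_comp[OF f pure_tensor_lin_maps_left[OF V' W']]
        lin_maps_comp[OF g pure_tensor_lin_maps_right[OF V' W']], simp add: lin_mapsD(1)[OF f] lin_mapsD(1)[OF g])+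
  finally show ?thesis
    using tensor_proj_eq_zero_iff[OF V' W' keys] by simp
qed

text \<open>A subspace need only be tested on basis elements in the first argument. This turns a
  two-variable claim into one about a single linear map, the shape of
  \<open>tensor_kernel_map\<close>.\<close>

lemma bil_submodule:
  assumes N: "submodule N complex_field (free_space Z)"
    and mem: "\<And>x. x \<in> X \<Longrightarrow> lin_ext (\<lambda>y. sgl (\<mu> x y) 1) q \<in> N"
    and p: "supp p \<subseteq> X"
  shows "bil \<mu> p q \<in> N"
  using p
proof (induction rule: free_space_induct)
  case zero
  show ?case using subgroup.one_closed[OF submodule.axioms(1)[OF N]] by simp
next
  case (single x c)
  then show ?case using submodule.smult_closed[OF N, of c] mem by (simp add: bil_def)
next
  case (add p p')
  then show ?case
    using module.submoduleE(5)[OF module_free_space N] by (simp add: bil_add_left)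
qed

lemma DirProd_simps [simp]:
  "carrier (G \<times>\<times> K) = carrier G \<times> carrier K" "\<one>\<^bsub>G \<times>\<times> K\<^esub> = (\<one>\<^bsub>G\<^esub>, \<one>\<^bsub>K\<^esub>)"
  "mult (G \<times>\<times> K) = (\<lambda>(g, h) (g', h'). (g \<otimes>\<^bsub>G\<^esub> g', h \<otimes>\<^bsub>K\<^esub> h'))"
  by (simp_all add: DirProd_def)

section \<open>Tensor products of algebras and of their modules\<close>

context
  fixes R :: "(complex, 'a, 'm) module_scheme" and S :: "(complex, 'b, 'n) module_scheme"
  assumes R: "complex_algebra R" and S: "complex_algebra S"
begin

interpretation R: complex_algebra R by (rule R)
interpretation R: ring R by (rule R.ring)
interpretation S: complex_algebra S by (rule S)
interpretation S: ring S by (rule S.ring)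

lemma complex_algebra_DirProd: "complex_algebra (monoid_algebra (R \<times>\<times> S))"
  by (intro complex_algebra_monoid_algebra DirProd_monoid R.monoid_axioms S.monoid_axioms)

text \<open>Multiplication by a pair (a, b) from either side acts on each tensor factor by a linear
  map, so \<open>tensor_kernel_map\<close> shows that it preserves the kernel;
  \<open>bil_submodule\<close> extends this to all multipliers.\<close>

lemma ideal_tensor_kernel: "ideal (tensor_kernel R S) (monoid_algebra (R \<times>\<times> S))"
proof (rule idealI)
  let ?K = "tensor_kernel R S"
  note sub = submodule_tensor_kernel[OF R.vector_space S.vector_space]
  note map = tensor_kernel_map[OF R.vector_space S.vector_space R.vector_space S.vector_space]
  show "ring (monoid_algebra (R \<times>\<times> S))" by (rule complex_algebra.ring[OF complex_algebra_DirProd])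
  show "subgroup ?K (add_monoid (monoid_algebra (R \<times>\<times> S)))"
    using submodule.axioms(1)[OF sub] by (simp add: subgroup_def m_inv_def)
  fix q p assume q: "q \<in> ?K" and p: "p \<in> carrier (monoid_algebra (R \<times>\<times> S))"
  then have supp: "supp p \<subseteq> carrier R \<times> carrier S" by simp
  have "lin_ext (\<lambda>y. sgl (x \<otimes>\<^bsub>R \<times>\<times> S\<^esub> y) 1) q \<in> ?K" if "x \<in> carrier R \<times> carrier S" for x
    using map[OF R.mult_lin_maps(1)[of "fst x"] S.mult_lin_maps(1)[of "snd x"] q] that
    by (auto simp: case_prod_unfold)
  from bil_submodule[OF sub this supp] show "p \<otimes>\<^bsub>monoid_algebra (R \<times>\<times> S)\<^esub> q \<in> ?K" by simp
  have "lin_ext (\<lambda>y. sgl (y \<otimes>\<^bsub>R \<times>\<times> S\<^esub> x) 1) q \<in> ?K" if "x \<in> carrier R \<times> carrier S" for x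
    using map[OF R.mult_lin_maps(2)[of "fst x"] S.mult_lin_maps(2)[of "snd x"] q] that
    by (auto simp: case_prod_unfold)
  from bil_submodule[OF sub this supp] show "q \<otimes>\<^bsub>monoid_algebra (R \<times>\<times> S)\<^esub> p \<in> ?K"
    by (simp add: bil_flip[of _ q])
qed

lemma complex_algebra_tensor_algebra: "complex_algebra (tensor_algebra R S)"
  unfolding tensor_algebra_def by (rule complex_algebra_quotient[OF complex_algebra_DirProd ideal_tensor_kernel])

lemma tensor_proj_algebra_hom: "tensor_proj R S \<in> algebra_hom (monoid_algebra (R \<times>\<times> S)) (tensor_algebra R S)"
  using coset_algebra_hom[OF complex_algebra_DirProd ideal_tensor_kernel]
  by (simp add: tensor_proj_def[abs_def] tensor_algebra_def a_r_coset_def')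

text \<open>The monoid algebra and the free vector space on pairs share carrier, addition and
  scalars, so their quotients agree except for the ring structure. Universal properties proved for
  \<open>tensor_space\<close> thus apply to the algebra.\<close>

lemma tensor_algebra_simps:
  "carrier (tensor_algebra R S) = carrier (tensor_space R S)"
  "add (tensor_algebra R S) = add (tensor_space R S)"
  "smult (tensor_algebra R S) = smult (tensor_space R S)"
  "zero (tensor_algebra R S) = zero (tensor_space R S)"
  by (simp_all add: tensor_algebra_def tensor_space_def quotient_def A_RCOSETS_def' a_r_coset_def'
      set_add_def' fun_eq_iff)

lemma pure_tensor_mult:
  "\<lbrakk>a \<in> carrier R; a' \<in> carrier R; b \<in> carrier S; b' \<in> carrier S\<rbrakk> \<Longrightarrow>
    pure_tensor R S a b \<otimes>\<^bsub>tensor_algebra R S\<^esub> pure_tensor R S a' b' = pure_tensor R S (a \<otimes>\<^bsub>R\<^esub> a') (b \<otimes>\<^bsub>S\<^esub> b')"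
  using algebra_homD(4)[OF tensor_proj_algebra_hom, of "sgl (a, b) 1" "sgl (a', b') 1"]
  by (simp add: pure_tensor_eq[OF R.vector_space S.vector_space])

context
  fixes M :: "('a, 'v, 'p) alg_module_scheme" and N :: "('b, 'w, 'q) alg_module_scheme"
  assumes M: "left_module R M" and N: "left_module S N"
begin

interpretation M: left_module R M by (rule M)
interpretation N: left_module S N by (rule N)

abbreviation (input) "\<alpha> \<equiv> \<lambda>(a, b) (x, y). (act M a x, act N b y)"

lemma left_module_free_tensor:
  "left_module (monoid_algebra (R \<times>\<times> S)) (with_action (free_space (carrier M \<times> carrier N)) (bil \<alpha>))"
  by (rule left_module_monoid_algebra[OF DirProd_monoid[OF R.monoid_axioms S.monoid_axioms]])
    (auto simp: M.act_closed N.act_closed M.act_mult N.act_mult M.act_one N.act_one)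

text \<open>The action is well defined in both variables. In the first part a pair of algebra
  elements is fixed and acts linearly on M and N; in the second a pair of vectors is fixed and a
  \<mapsto> a x, b \<mapsto> b y are linear on R and S.\<close>

lemma bil_tensor_kernel:
  shows "\<lbrakk>supp p \<subseteq> carrier R \<times> carrier S; q \<in> tensor_kernel M N\<rbrakk> \<Longrightarrow> bil \<alpha> p q \<in> tensor_kernel M N"
    and "\<lbrakk>p \<in> tensor_kernel R S; supp q \<subseteq> carrier M \<times> carrier N\<rbrakk> \<Longrightarrow> bil \<alpha> p q \<in> tensor_kernel M N"
proof -
  note sub = submodule_tensor_kernel[OF M.vector_space N.vector_space]
  have "lin_ext (\<lambda>y. sgl (\<alpha> x y) 1) q \<in> tensor_kernel M N"
    if "x \<in> carrier R \<times> carrier S" "q \<in> tensor_kernel M N" for x q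
    using tensor_kernel_map[OF M.vector_space N.vector_space M.vector_space N.vector_space
        M.act_lin_maps(2)[of "fst x"] N.act_lin_maps(2)[of "snd x"], of q] that
    by (auto simp: case_prod_unfold)
  then show "\<lbrakk>supp p \<subseteq> carrier R \<times> carrier S; q \<in> tensor_kernel M N\<rbrakk> \<Longrightarrow> bil \<alpha> p q \<in> tensor_kernel M N"
    by (rule bil_submodule[OF sub])
  have "lin_ext (\<lambda>y. sgl (\<alpha> y x) 1) p \<in> tensor_kernel M N"
    if "x \<in> carrier M \<times> carrier N" "p \<in> tensor_kernel R S" for x p
    using tensor_kernel_map[OF R.vector_space S.vector_space M.vector_space N.vector_space
        M.act_lin_maps(1)[of "fst x"] N.act_lin_maps(1)[of "snd x"], of p] that
    by (auto simp: case_prod_unfold)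
  then show "\<lbrakk>p \<in> tensor_kernel R S; supp q \<subseteq> carrier M \<times> carrier N\<rbrakk> \<Longrightarrow> bil \<alpha> p q \<in> tensor_kernel M N"
    unfolding bil_flip[of _ p] by (rule bil_submodule[OF sub])
qed

lemma bil_tensor_cong:
  assumes "supp p \<subseteq> carrier R \<times> carrier S" "supp p' \<subseteq> carrier R \<times> carrier S" "tensor_proj R S p = tensor_proj R S p'"
    and "supp q \<subseteq> carrier M \<times> carrier N" "supp q' \<subseteq> carrier M \<times> carrier N" "tensor_proj M N q = tensor_proj M N q'"
  shows "tensor_proj M N (bil \<alpha> p q) = tensor_proj M N (bil \<alpha> p' q')"
proof -
  have keys: "supp (bil \<alpha> p q) \<subseteq> carrier M \<times> carrier N"
    if "supp p \<subseteq> carrier R \<times> carrier S" "supp q \<subseteq> carrier M \<times> carrier N" for p q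
    using that by (intro keys_bil) (auto simp: M.act_closed N.act_closed subset_iff)
  have "p - p' \<in> tensor_kernel R S" "q - q' \<in> tensor_kernel M N"
    using assms by (simp_all add: tensor_proj_eq_iff[OF R.vector_space S.vector_space]
        tensor_proj_eq_iff[OF M.vector_space N.vector_space])
  then have "bil \<alpha> (p - p') q \<in> tensor_kernel M N" "bil \<alpha> p' (q - q') \<in> tensor_kernel M N"
    using assms by (simp_all only: bil_tensor_kernel)
  \<comment> \<open>One variable is changed at a time: p q - p' q' = (p - p') q + p' (q -
    q').\<close>
  then have "bil \<alpha> (p - p') q + bil \<alpha> p' (q - q') \<in> tensor_kernel M N"
    using module.submoduleE(5)[OF module_free_space submodule_tensor_kernel[OF M.vector_space N.vector_space]] by simp
  then have "bil \<alpha> p q - bil \<alpha> p' q' \<in> tensor_kernel M N"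
    by (simp add: bil_minus_left bil_minus_right)
  then show ?thesis
    using assms keys by (subst tensor_proj_eq_iff[OF M.vector_space N.vector_space]) auto
qed

text \<open>The definition of \<open>tensor_module\<close> nests two linear extensions over chosen
  representatives. Pulling the projection out of both sums gives the free action of these
  representatives, which may then be replaced by any others.\<close>

lemma act_tensor_module_proj:
  assumes p: "supp p \<subseteq> carrier R \<times> carrier S" and q: "supp q \<subseteq> carrier M \<times> carrier N"
  shows "act (tensor_module M N) (tensor_proj R S p) (tensor_proj M N q) = tensor_proj M N (bil \<alpha> p q)"
proof -
  let ?T = "tensor_space M N" and ?F = "free_space (carrier M \<times> carrier N)"
  define p' where "p' = rep (tensor_proj R S p)"
  define q' where "q' = rep (tensor_proj M N q)"
  note mods = R.vector_space S.vector_space M.vector_space N.vector_space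
  have p': "supp p' \<subseteq> carrier R \<times> carrier S" "tensor_proj R S p' = tensor_proj R S p"
    using rep_tensor_space[OF mods(1,2), of "tensor_proj R S p"] p
    by (auto simp: carrier_tensor_space[OF mods(1,2)] p'_def)
  have q': "supp q' \<subseteq> carrier M \<times> carrier N" "tensor_proj M N q' = tensor_proj M N q"
    using rep_tensor_space[OF mods(3,4), of "tensor_proj M N q"] q
    by (auto simp: carrier_tensor_space[OF mods(3,4)] q'_def)
  note lin = lin_maps_linear_extension[OF module_free_space module_tensor_space[OF mods(3,4)]
      tensor_proj_lin_maps[OF mods(3,4)]]
  have inner: "linear_extension ?T (\<lambda>(x, y). pure_tensor M N (act M a x) (act N b y)) q' =
      tensor_proj M N (lin_ext (\<lambda>z. sgl (\<alpha> (a, b) z) 1) q')" 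
    and keys: "(\<lambda>z. lin_ext (\<lambda>z'. sgl (\<alpha> z z') 1) q') (a, b) \<in> carrier ?F"
    if ab: "(a, b) \<in> carrier R \<times> carrier S" for a b
  proof -
    have h: "(\<lambda>z. sgl (\<alpha> (a, b) z) 1) \<in> supp q' \<rightarrow> carrier ?F"
      using ab q' by (auto simp: M.act_closed N.act_closed subset_iff)
    then have "supp (sgl (\<alpha> (a, b) z) 1) \<subseteq> carrier M \<times> carrier N" if "z \<in> supp q'" for z
      using that by auto
    then have "supp (lin_ext (\<lambda>z. sgl (\<alpha> (a, b) z) 1) q') \<subseteq> carrier M \<times> carrier N"
      by (rule lin_ext_keys)
    then show "(\<lambda>z. lin_ext (\<lambda>z'. sgl (\<alpha> z z') 1) q') (a, b) \<in> carrier ?F"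
      by simp
    have "tensor_proj M N (lin_ext (\<lambda>z. sgl (\<alpha> (a, b) z) 1) q') =
        linear_extension ?T (\<lambda>z. tensor_proj M N (sgl (\<alpha> (a, b) z) 1)) q'"
      by (subst linear_extension_free_space[OF h, symmetric], rule lin[OF h])
    also have "(\<lambda>z. tensor_proj M N (sgl (\<alpha> (a, b) z) 1)) =
        (\<lambda>(x, y). pure_tensor M N (act M a x) (act N b y))"
      by (auto simp: pure_tensor_eq[OF mods(3,4)])
    finally show "linear_extension ?T (\<lambda>(x, y). pure_tensor M N (act M a x) (act N b y)) q' =
      tensor_proj M N (lin_ext (\<lambda>z. sgl (\<alpha> (a, b) z) 1) q')" ..
  qed
  have h: "(\<lambda>z. lin_ext (\<lambda>z'. sgl (\<alpha> z z') 1) q') \<in> supp p' \<rightarrow> carrier ?F"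
  proof (rule Pi_I)
    fix z assume "z \<in> supp p'"
    then show "lin_ext (\<lambda>z'. sgl (\<alpha> z z') 1) q' \<in> carrier ?F"
      using p'(1) keys[of "fst z" "snd z"] by auto
  qed
  have "act (tensor_module M N) (tensor_proj R S p) (tensor_proj M N q) =
      linear_extension ?T (\<lambda>(a, b). linear_extension ?T
        (\<lambda>(x, y). pure_tensor M N (act M a x) (act N b y)) q') p'"
    by (simp add: tensor_module_def p'_def q'_def)
  also have "\<dots> = linear_extension ?T (\<lambda>z. tensor_proj M N (lin_ext (\<lambda>z'. sgl (\<alpha> z z') 1) q')) p'"
    using p' h lin_mapsD(1)[OF tensor_proj_lin_maps[OF mods(3,4)]]
    by (intro linear_extension_cong module_tensor_space mods) (auto simp: inner subset_iff Pi_iff)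
  also have "\<dots> = tensor_proj M N (bil \<alpha> p' q')"
    by (simp add: bil_def linear_extension_free_space[OF h, symmetric] lin[OF h])
  also have "\<dots> = tensor_proj M N (bil \<alpha> p q)"
    by (rule bil_tensor_cong[OF p'(1) p p'(2) q'(1) q q'(2)])
  finally show ?thesis .
qed

text \<open>All axioms hold for the free action of the monoid algebra on pairs and are pushed
  through the two projections, with \<open>act_tensor_module_proj\<close> as the
  compatibility.\<close>

lemma left_module_tensor_module: "left_module (tensor_algebra R S) (tensor_module M N)"
proof (rule left_module_image[OF left_module_free_tensor complex_algebra_tensor_algebra tensor_proj_algebra_hom,
      where g = "tensor_proj M N"])
  note mods = R.vector_space S.vector_space M.vector_space N.vector_space
  let ?F = "with_action (free_space (carrier M \<times> carrier N)) (bil \<alpha>)"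
  show "tensor_proj R S ` carrier (monoid_algebra (R \<times>\<times> S)) = carrier (tensor_algebra R S)"
    by (simp add: tensor_algebra_simps carrier_tensor_space[OF mods(1,2)])
  show "tensor_proj M N \<in> lin_maps ?F (tensor_module M N)"
    using tensor_proj_lin_maps[OF mods(3,4)] by (simp add: lin_maps_def tensor_module_def)
  show "tensor_proj M N ` carrier ?F = carrier (tensor_module M N)"
    by (simp add: tensor_module_def carrier_tensor_space[OF mods(3,4)])
  show "tensor_proj M N \<zero>\<^bsub>?F\<^esub> = \<zero>\<^bsub>tensor_module M N\<^esub>"
    by (simp add: tensor_module_def tensor_proj_zero[OF mods(3,4)])
qed (simp add: act_tensor_module_proj)

lemma act_pure_tensor:
  "\<lbrakk>a \<in> carrier R; b \<in> carrier S; x \<in> carrier M; y \<in> carrier N\<rbrakk> \<Longrightarrow>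
    act (tensor_module M N) (pure_tensor R S a b) (pure_tensor M N x y) =
      pure_tensor M N (act M a x) (act N b y)"
  using act_tensor_module_proj[of "sgl (a, b) 1" "sgl (x, y) 1"]
  by (simp add: pure_tensor_eq R.vector_space S.vector_space M.vector_space N.vector_space)

end

end


section \<open>Brackets and the maps \<open>\<zeta>\<close> and \<open>\<Delta>\<close>\<close>

lemma (in abelian_group) minus_eq_zero_iff:
  "\<lbrakk>x \<in> carrier G; y \<in> carrier G\<rbrakk> \<Longrightarrow> x \<ominus> y = \<zero> \<longleftrightarrow> x = y"
  by (metis a_inv_closed minus_eq minus_equality minus_minus r_neg)

definition bracket :: "(complex, 'a, 'm) module_scheme \<Rightarrow> 'a \<Rightarrow> 'a \<Rightarrow> 'a"
  where "bracket S x y = x \<otimes>\<^bsub>S\<^esub> y \<ominus>\<^bsub>S\<^esub> y \<otimes>\<^bsub>S\<^esub> x"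

lemma bracket_free_algebra [simp]: "bracket free_algebra p q = bil (@) p q - bil (@) q p"
proof -
  interpret module complex_field free_algebra by (rule module_monoid_algebra)
  have "\<ominus>\<^bsub>free_algebra\<^esub> x = - x" for x :: "'a list \<Rightarrow>\<^sub>0 complex"
    by (rule minus_equality) auto
  then show ?thesis by (simp add: bracket_def a_minus_def)
qed

lemma algebra_hom_bracket:
  assumes "complex_algebra R" "complex_algebra S" "f \<in> algebra_hom R S" "x \<in> carrier R" "y \<in> carrier R"
  shows "f (bracket R x y) = bracket S (f x) (f y)"
proof -
  interpret ring R by (rule complex_algebra.ring[OF assms(1)])
  show ?thesis
    using assms(4,5) algebra_homD(4)[OF assms(3)]
    by (simp add: bracket_def lin_maps_minus[OF complex_algebra.vector_space[OF assms(1)]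
          complex_algebra.vector_space[OF assms(2)] algebra_hom_lin_maps[OF assms(3)]])
qed

context
  fixes S :: "(complex, 'b, 'm) module_scheme"
  assumes S: "complex_algebra S"
begin

interpretation S: complex_algebra S by (rule S)
interpretation S: ring S by (rule S.ring)
interpretation SV: module complex_field S by (rule S.vector_space)

lemma bracket_closed: "\<lbrakk>x \<in> carrier S; y \<in> carrier S\<rbrakk> \<Longrightarrow> bracket S x y \<in> carrier S"
  by (simp add: bracket_def)

lemma bracket_anti: "\<lbrakk>x \<in> carrier S; y \<in> carrier S\<rbrakk> \<Longrightarrow> bracket S x y = (-1) \<odot>\<^bsub>S\<^esub> bracket S y x"
  using SV.smult_l_minus[of 1 "bracket S y x"]
  by (simp add: bracket_def a_minus_def S.minus_add S.a_comm SV.smult_one[simplified])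

lemma bracket_self: "x \<in> carrier S \<Longrightarrow> bracket S x x = \<zero>\<^bsub>S\<^esub>"
  by (simp add: bracket_def S.minus_eq_zero_iff)

lemma bracket_lin_maps_right:
  assumes x: "x \<in> carrier S"
  shows "bracket S x \<in> lin_maps S S"
proof (rule lin_mapsI)
  show "bracket S x (y \<oplus>\<^bsub>S\<^esub> z) = bracket S x y \<oplus>\<^bsub>S\<^esub> bracket S x z" if "y \<in> carrier S" "z \<in> carrier S" for y z
    using x that by (simp add: bracket_def a_minus_def S.l_distr S.r_distr S.minus_add S.a_ac)
  show "bracket S x (c \<odot>\<^bsub>S\<^esub> y) = c \<odot>\<^bsub>S\<^esub> bracket S x y" if "y \<in> carrier S" for c y
    using x that SV.smult_r_minus[of c "y \<otimes>\<^bsub>S\<^esub> x"]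
    by (simp add: bracket_def a_minus_def S.smult_mult_left S.smult_mult_right SV.smult_r_distr[simplified])
qed (use x in \<open>simp add: bracket_closed\<close>)

lemma bracket_lin_maps_left:
  assumes x: "x \<in> carrier S"
  shows "(\<lambda>y. bracket S y x) \<in> lin_maps S S"
proof (rule lin_mapsI)
  show "bracket S (y \<oplus>\<^bsub>S\<^esub> z) x = bracket S y x \<oplus>\<^bsub>S\<^esub> bracket S z x" if "y \<in> carrier S" "z \<in> carrier S" for y z
    using x that by (simp add: bracket_def a_minus_def S.l_distr S.r_distr S.minus_add S.a_ac)
  show "bracket S (c \<odot>\<^bsub>S\<^esub> y) x = c \<odot>\<^bsub>S\<^esub> bracket S y x" if "y \<in> carrier S" for c y
    using x that SV.smult_r_minus[of c "x \<otimes>\<^bsub>S\<^esub> y"]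
    by (simp add: bracket_def a_minus_def S.smult_mult_left S.smult_mult_right SV.smult_r_distr[simplified])
qed (use x in \<open>simp add: bracket_closed\<close>)

end

text \<open>Expanding [X,[X,Y]] gives XXY - 2 XYX + YXX. In bracket form the relations are preserved
  by any linear map that respects brackets, which covers both \<zeta> and the
  comultiplication.\<close>

lemma K_relators_eq:
  "K_relators \<omega> =
    {bracket free_algebra (sgl [A] 1) (bracket free_algebra (sgl [A] 1) (sgl [B] 1)) - (sgl [B] 1 + scl \<omega> (sgl [A] 1)),
     bracket free_algebra (sgl [B] 1) (bracket free_algebra (sgl [B] 1) (sgl [A] 1)) - (sgl [A] 1 + scl \<omega> (sgl [B] 1))}"
proof -
  \<comment> \<open>The coefficient 2 is split so that both sides become sums of the same unit
    monomials.\<close>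
  have two: "sgl w (2::complex) = sgl w 1 + sgl w 1" for w :: "K_gen list"
    by (simp add: single_add[symmetric])
  show ?thesis by (simp add: K_relators_def bil_minus_left bil_minus_right two algebra_simps)
qed

text \<open>Word evaluation is an algebra homomorphism and so commutes with brackets; the two
  assumed identities therefore say that the relators are sent to zero.\<close>

lemma K_hom:
  assumes S: "complex_algebra S" and \<phi>: "\<And>g. \<phi> g \<in> carrier S"
    and "bracket S (\<phi> A) (bracket S (\<phi> A) (\<phi> B)) = \<phi> B \<oplus>\<^bsub>S\<^esub> \<omega> \<odot>\<^bsub>S\<^esub> \<phi> A"
    and "bracket S (\<phi> B) (bracket S (\<phi> B) (\<phi> A)) = \<phi> A \<oplus>\<^bsub>S\<^esub> \<omega> \<odot>\<^bsub>S\<^esub> \<phi> B"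
  shows "presented_hom S \<phi> \<in> algebra_hom (K_alg \<omega>) S"
    and "presented_hom S \<phi> (generator (K_relators \<omega>) g) = \<phi> g"
proof -
  interpret S: complex_algebra S by (rule S)
  interpret S: ring S by (rule S.ring)
  interpret SV: module complex_field S by (rule S.vector_space)
  let ?f = "word_eval S \<phi>"
  note hom = word_eval_algebra_hom[where \<phi> = \<phi>, OF S \<phi>]
  note lin = word_eval_lin_maps[where \<phi> = \<phi>, OF S \<phi>]
  have br: "?f (bracket free_algebra p q) = bracket S (?f p) (?f q)" for p q
    by (rule algebra_hom_bracket[OF complex_algebra_free_algebra S hom]) simp_all
  have minus: "?f (p - q) = ?f p \<ominus>\<^bsub>S\<^esub> ?f q" for p q
    using lin_maps_minus[OF module_free_space S.vector_space lin, of p q] by simp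
  have rel: "?f r = \<zero>\<^bsub>S\<^esub>" if "r \<in> K_relators \<omega>" for r
    using that \<phi> unfolding K_relators_eq
    by (auto simp: br minus word_eval_generator[where \<phi> = \<phi>, OF S \<phi>] assms lin_mapsD(2,3)[OF lin, simplified] S.minus_eq_zero_iff
        simp del: bracket_free_algebra scl_single)
  show "presented_hom S \<phi> \<in> algebra_hom (K_alg \<omega>) S"
    unfolding K_alg_def by (rule presented_hom_algebra_hom[OF S \<phi> rel])
  show "presented_hom S \<phi> (generator (K_relators \<omega>) g) = \<phi> g"
    by (rule presented_hom_generator[OF S \<phi> rel])
qed

lemma complex_algebra_K: "complex_algebra (K_alg \<omega>)"
  unfolding K_alg_def by (rule complex_algebra_presented)

lemma complex_algebra_U: "complex_algebra U_sl2"
  unfolding U_sl2_def by (rule complex_algebra_presented)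

lemma K_generator_bracket:
  fixes \<omega> :: complex
  defines "a \<equiv> generator (K_relators \<omega>) A" and "b \<equiv> generator (K_relators \<omega>) B" and "K \<equiv> K_alg \<omega>"
  shows "bracket K a (bracket K a b) = b \<oplus>\<^bsub>K\<^esub> \<omega> \<odot>\<^bsub>K\<^esub> a"
    and "bracket K b (bracket K b a) = a \<oplus>\<^bsub>K\<^esub> \<omega> \<odot>\<^bsub>K\<^esub> b"
proof -
  interpret K: complex_algebra K unfolding K_def by (rule complex_algebra_K)
  interpret K: ring K by (rule K.ring)
  interpret KV: module complex_field K by (rule K.vector_space)
  let ?\<pi> = "presented_proj (K_relators \<omega>)"
  have hom: "?\<pi> \<in> algebra_hom free_algebra K"
    unfolding K_def K_alg_def by (rule presented_proj_algebra_hom)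
  note lin = algebra_hom_lin_maps[OF hom, unfolded lin_maps_free_algebra]
  have br: "?\<pi> (bracket free_algebra p q) = bracket K (?\<pi> p) (?\<pi> q)" for p q
    by (rule algebra_hom_bracket[OF complex_algebra_free_algebra K.complex_algebra_axioms hom]) simp_all
  have minus: "?\<pi> (p - q) = ?\<pi> p \<ominus>\<^bsub>K\<^esub> ?\<pi> q" for p q
    using lin_maps_minus[OF module_free_space K.vector_space lin, of p q] by simp
  have ab: "a \<in> carrier K" "b \<in> carrier K" by (simp_all add: a_def b_def K_def K_alg_def)
  have zero: "?\<pi> r = \<zero>\<^bsub>K\<^esub>" if "r \<in> K_relators \<omega>" for r
    unfolding K_def K_alg_def using that by (rule presented_proj_relator)
  have rels: "bracket free_algebra (sgl [A] 1) (bracket free_algebra (sgl [A] 1) (sgl [B] 1)) -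
      (sgl [B] 1 + scl \<omega> (sgl [A] 1)) \<in> K_relators \<omega>"
    "bracket free_algebra (sgl [B] 1) (bracket free_algebra (sgl [B] 1) (sgl [A] 1)) -
      (sgl [A] 1 + scl \<omega> (sgl [B] 1)) \<in> K_relators \<omega>"
    by (simp_all only: K_relators_eq insert_iff simp_thms)
  have "bracket K a (bracket K a b) \<ominus>\<^bsub>K\<^esub> (b \<oplus>\<^bsub>K\<^esub> \<omega> \<odot>\<^bsub>K\<^esub> a) = \<zero>\<^bsub>K\<^esub>"
    "bracket K b (bracket K b a) \<ominus>\<^bsub>K\<^esub> (a \<oplus>\<^bsub>K\<^esub> \<omega> \<odot>\<^bsub>K\<^esub> b) = \<zero>\<^bsub>K\<^esub>"
    using rels[THEN zero]
    by (simp_all add: br minus a_def b_def generator_eq lin_mapsD(2,3)[OF lin, simplified]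
        del: bracket_free_algebra scl_single)
  then show "bracket K a (bracket K a b) = b \<oplus>\<^bsub>K\<^esub> \<omega> \<odot>\<^bsub>K\<^esub> a"
    and "bracket K b (bracket K b a) = a \<oplus>\<^bsub>K\<^esub> \<omega> \<odot>\<^bsub>K\<^esub> b"
    using ab bracket_closed[OF K.complex_algebra_axioms] KV.smult_closed[simplified] by (simp_all add: K.minus_eq_zero_iff)
qed

section \<open>The Lie algebra sl2 inside its enveloping algebra, and the map \<zeta>\<close>

fun sl2_structure :: "sl2_gen \<Rightarrow> sl2_gen \<Rightarrow> (sl2_gen \<Rightarrow>\<^sub>0 complex)"
  where
    "sl2_structure E F = sgl H 1" | "sl2_structure F E = sgl H (-1)"
  | "sl2_structure H E = sgl E 2" | "sl2_structure E H = sgl E (-2)"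
  | "sl2_structure H F = sgl F (-2)" | "sl2_structure F H = sgl F 2"
  | "sl2_structure E E = 0" | "sl2_structure F F = 0" | "sl2_structure H H = 0"

definition sl2_bracket :: "(sl2_gen \<Rightarrow>\<^sub>0 complex) \<Rightarrow> (sl2_gen \<Rightarrow>\<^sub>0 complex) \<Rightarrow> (sl2_gen \<Rightarrow>\<^sub>0 complex)"
  where "sl2_bracket p q = lin_ext (\<lambda>g. lin_ext (sl2_structure g) q) p"

text \<open>The canonical Lie map from sl2, encoded as coefficient functions on E, F, H, into
  U(sl2). Bracket identities can then be verified by comparing three coefficients instead of
  computing in the quotient.\<close>

definition sl2_embed :: "(sl2_gen \<Rightarrow>\<^sub>0 complex) \<Rightarrow> (sl2_gen list \<Rightarrow>\<^sub>0 complex) set"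
  where "sl2_embed = linear_extension U_sl2 (generator sl2_relators)"

lemma U_generator_closed: "generator sl2_relators g \<in> carrier U_sl2"
  by (simp add: U_sl2_def)

lemma sl2_embed_lin_maps: "sl2_embed \<in> lin_maps (free_space UNIV) U_sl2"
  unfolding sl2_embed_def
  by (rule linear_extension_lin_maps[OF complex_algebra.vector_space[OF complex_algebra_U]])
    (simp add: U_generator_closed)

lemma sl2_embed_single: "sl2_embed (sgl g c) = c \<odot>\<^bsub>U_sl2\<^esub> generator sl2_relators g"
  unfolding sl2_embed_def
  by (rule linear_extension_single[OF complex_algebra.vector_space[OF complex_algebra_U], where X = UNIV])
    (simp_all add: U_generator_closed)

text \<open>Three of the nine brackets are the defining relations; the others follow from
  antisymmetry and [x,x] = 0.\<close>

lemma U_generator_bracket: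
  "bracket U_sl2 (generator sl2_relators g) (generator sl2_relators h) = sl2_embed (sl2_structure g h)"
proof -
  interpret U: complex_algebra U_sl2 by (rule complex_algebra_U)
  interpret U: ring U_sl2 by (rule U.ring)
  interpret UV: module complex_field U_sl2 by (rule U.vector_space)
  let ?U = U_sl2 and ?\<pi> = "presented_proj sl2_relators" and ?g = "generator sl2_relators"
  have hom: "?\<pi> \<in> algebra_hom free_algebra ?U"
    unfolding U_sl2_def by (rule presented_proj_algebra_hom)
  note lin = algebra_hom_lin_maps[OF hom, unfolded lin_maps_free_algebra]
  have br: "?\<pi> (bracket free_algebra p q) = bracket ?U (?\<pi> p) (?\<pi> q)" for p q
    by (rule algebra_hom_bracket[OF complex_algebra_free_algebra complex_algebra_U hom]) simp_all
  have minus: "?\<pi> (p - q) = ?\<pi> p \<ominus>\<^bsub>?U\<^esub> ?\<pi> q" for p q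
    using lin_maps_minus[OF module_free_space U.vector_space lin, of p q] by simp
  have zero: "?\<pi> r = \<zero>\<^bsub>?U\<^esub>" if "r \<in> sl2_relators" for r
    unfolding U_sl2_def using that by (rule presented_proj_relator)
  have rel: "bracket ?U (?g g) (?g h) = c \<odot>\<^bsub>?U\<^esub> ?g k"
    if "sgl [g, h] 1 - sgl [h, g] 1 - sgl [k] c \<in> sl2_relators" for g h k c
  proof -
    have "bracket free_algebra (sgl [g] 1) (sgl [h] 1) - scl c (sgl [k] 1) \<in> sl2_relators"
      using that by simp
    from zero[OF this] have "bracket ?U (?g g) (?g h) \<ominus>\<^bsub>?U\<^esub> c \<odot>\<^bsub>?U\<^esub> ?g k = \<zero>\<^bsub>?U\<^esub>"
      by (simp add: br minus generator_eq lin_mapsD(3)[OF lin, simplified] del: bracket_free_algebra scl_single)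
    then show ?thesis
      using bracket_closed[OF complex_algebra_U U_generator_closed U_generator_closed]
        UV.smult_closed[simplified, OF U_generator_closed] by (simp add: U.minus_eq_zero_iff)
  qed
  \<comment> \<open>The relator for H and F carries a plus sign; \<open>single_uminus\<close> brings
    it to the shape of \<open>rel\<close> with c = -2.\<close>
  have HE: "bracket ?U (?g H) (?g E) = 2 \<odot>\<^bsub>?U\<^esub> ?g E" and HF: "bracket ?U (?g H) (?g F) = (-2) \<odot>\<^bsub>?U\<^esub> ?g F"
    and EF: "bracket ?U (?g E) (?g F) = 1 \<odot>\<^bsub>?U\<^esub> ?g H"
    by (rule rel; simp add: sl2_relators_def single_uminus)+
  have anti: "bracket ?U (?g g) (?g h) = (- c) \<odot>\<^bsub>?U\<^esub> ?g k" if "bracket ?U (?g h) (?g g) = c \<odot>\<^bsub>?U\<^esub> ?g k" for g h k c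
    using bracket_anti[OF complex_algebra_U U_generator_closed U_generator_closed, of g h] that
      UV.smult_assoc1[simplified, of "?g k" "-1" c] by (simp add: U_generator_closed)
  have zero: "sl2_embed 0 = \<zero>\<^bsub>?U\<^esub>"
    using lin_maps_zero[OF module_free_space U.vector_space sl2_embed_lin_maps] by simp
  show ?thesis
    using bracket_self[OF complex_algebra_U U_generator_closed] anti[OF HE] anti[OF HF] anti[OF EF]
    by (cases g; cases h) (simp_all add: HE HF EF sl2_embed_single zero)
qed

lemma sl2_embed_bracket: "sl2_embed (sl2_bracket p q) = bracket U_sl2 (sl2_embed p) (sl2_embed q)"
proof -
  note U = complex_algebra_U and UV = complex_algebra.vector_space[OF complex_algebra_U]
  note E = sl2_embed_lin_maps and D = lin_mapsD(1)[OF sl2_embed_lin_maps, simplified]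
  have single: "sl2_embed (sgl g 1) = generator sl2_relators g" for g
    by (simp add: sl2_embed_single module.smult_one[OF UV, simplified] U_generator_closed)
  have "sl2_embed (sl2_bracket (sgl g 1) q) = bracket U_sl2 (sl2_embed (sgl g 1)) (sl2_embed q)" for g
    by (rule free_space_lin_maps_eq[where X = UNIV, OF UV _ lin_maps_comp[OF E bracket_lin_maps_right[OF U]]])
      (auto simp: sl2_bracket_def single U_generator_bracket U_generator_closed intro!: lin_maps_comp[OF lin_ext_UNIV E])
  then show ?thesis
    by (intro free_space_lin_maps_eq[where X = UNIV and p = p, OF UV _ lin_maps_comp[OF E bracket_lin_maps_left[OF U]]])
      (auto simp: D sl2_bracket_def intro!: lin_maps_comp[OF lin_ext_UNIV E])
qed

fun zeta_gen :: "complex \<Rightarrow> K_gen \<Rightarrow> (sl2_gen \<Rightarrow>\<^sub>0 complex)"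
  where
    "zeta_gen \<omega> A = sgl E ((1 + \<omega>) / 2) + sgl F ((1 - \<omega>) / 2) - sgl H (\<omega> / 2)"
  | "zeta_gen \<omega> B = sgl H (1 / 2)"

text \<open>Write a, b for the images of A, B. The operator [b, -] has eigenvalues 1, -1, 0 on E, F,
  H, so applying it twice to a removes just the H-part, which is -\<omega> b; this is the second
  relation. In the first, [a,[a,b]] has H-coefficient (1 - \<omega>^2)/2, twice the product of the
  coefficients of E and F in a, as required by b + \<omega> a.\<close>

lemma zeta_gen_bracket:
  "sl2_bracket (zeta_gen \<omega> A) (sl2_bracket (zeta_gen \<omega> A) (zeta_gen \<omega> B)) = zeta_gen \<omega> B + scl \<omega> (zeta_gen \<omega> A)"
  "sl2_bracket (zeta_gen \<omega> B) (sl2_bracket (zeta_gen \<omega> B) (zeta_gen \<omega> A)) = zeta_gen \<omega> A + scl \<omega> (zeta_gen \<omega> B)"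
proof -
  have eq: "p = q" if "coef p E = coef q E" "coef p F = coef q F" "coef p H = coef q H"
    for p q :: "sl2_gen \<Rightarrow>\<^sub>0 complex"
    using that by (intro poly_mapping_eqI) (metis sl2_gen.exhaust)
  show "sl2_bracket (zeta_gen \<omega> A) (sl2_bracket (zeta_gen \<omega> A) (zeta_gen \<omega> B)) = zeta_gen \<omega> B + scl \<omega> (zeta_gen \<omega> A)"
    "sl2_bracket (zeta_gen \<omega> B) (sl2_bracket (zeta_gen \<omega> B) (zeta_gen \<omega> A)) = zeta_gen \<omega> A + scl \<omega> (zeta_gen \<omega> B)"
    by (rule eq; simp add: sl2_bracket_def lin_ext_add lin_ext_minus lookup_add lookup_minus lookup_single field_simps)+
qed

lemma zeta_eq: "zeta \<omega> = presented_hom U_sl2 (\<lambda>g. sl2_embed (zeta_gen \<omega> g))"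
proof -
  note UV = complex_algebra.vector_space[OF complex_algebra_U]
  note D = lin_mapsD[OF sl2_embed_lin_maps, simplified]
  have minus: "sl2_embed (p - q) = sl2_embed p \<ominus>\<^bsub>U_sl2\<^esub> sl2_embed q" for p q
    using lin_maps_minus[OF module_free_space UV sl2_embed_lin_maps, of p q] by simp
  show ?thesis
    unfolding zeta_def Let_def
    by (rule arg_cong[of _ _ "presented_hom U_sl2"])
      (auto simp: fun_eq_iff D minus sl2_embed_single split: K_gen.split)
qed

lemma zeta_algebra_hom: "zeta \<omega> \<in> algebra_hom (K_alg \<omega>) U_sl2"
  and zeta_generator: "zeta \<omega> (generator (K_relators \<omega>) g) = sl2_embed (zeta_gen \<omega> g)"
proof -
  note D = lin_mapsD[OF sl2_embed_lin_maps, simplified]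
  note * = K_hom[OF complex_algebra_U, where \<phi> = "\<lambda>g. sl2_embed (zeta_gen \<omega> g)" and \<omega> = \<omega>]
  show "zeta \<omega> \<in> algebra_hom (K_alg \<omega>) U_sl2"
    "zeta \<omega> (generator (K_relators \<omega>) g) = sl2_embed (zeta_gen \<omega> g)"
    unfolding zeta_eq
    by (rule *; simp only: D sl2_embed_bracket[symmetric] zeta_gen_bracket)+
qed

section \<open>Primitive elements and the comultiplication\<close>

definition primitive :: "complex \<Rightarrow> (K_gen list \<Rightarrow>\<^sub>0 complex) set \<Rightarrow>
    ((K_gen list \<Rightarrow>\<^sub>0 complex) set \<times> (K_gen list \<Rightarrow>\<^sub>0 complex) set \<Rightarrow>\<^sub>0 complex) set"
  where "primitive \<omega> x = pure_tensor (K_alg \<omega>) (K_alg \<omega>) x \<one>\<^bsub>K_alg \<omega>\<^esub>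
    \<oplus>\<^bsub>tensor_algebra (K_alg \<omega>) (K_alg \<omega>)\<^esub> pure_tensor (K_alg \<omega>) (K_alg \<omega>) \<one>\<^bsub>K_alg \<omega>\<^esub> x"

context
  fixes \<omega> :: complex
begin

interpretation K: complex_algebra "K_alg \<omega>" by (rule complex_algebra_K)
interpretation K: ring "K_alg \<omega>" by (rule K.ring)
abbreviation (input) "KK \<equiv> tensor_algebra (K_alg \<omega>) (K_alg \<omega>)"
interpretation KK: complex_algebra KK by (rule complex_algebra_tensor_algebra[OF complex_algebra_K complex_algebra_K])
interpretation KK: ring KK by (rule KK.ring)
interpretation KKV: module complex_field KK by (rule KK.vector_space)

abbreviation (input) "pt \<equiv> pure_tensor (K_alg \<omega>) (K_alg \<omega>)"

lemma K_pure_lin_maps: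
  "w \<in> carrier (K_alg \<omega>) \<Longrightarrow> (\<lambda>v. pt v w) \<in> lin_maps (K_alg \<omega>) KK"
  "v \<in> carrier (K_alg \<omega>) \<Longrightarrow> pt v \<in> lin_maps (K_alg \<omega>) KK"
  using pure_tensor_lin_maps_left[OF K.vector_space K.vector_space]
    pure_tensor_lin_maps_right[OF K.vector_space K.vector_space]
  by (simp_all add: lin_maps_def tensor_algebra_simps[OF complex_algebra_K complex_algebra_K])

lemma primitive_lin_maps: "primitive \<omega> \<in> lin_maps (K_alg \<omega>) KK"
proof (rule lin_mapsI)
  note D = lin_mapsD[OF K_pure_lin_maps(1)[OF K.one_closed]] lin_mapsD[OF K_pure_lin_maps(2)[OF K.one_closed]]
  fix x assume x: "x \<in> carrier (K_alg \<omega>)"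
  show "primitive \<omega> x \<in> carrier KK" using x D by (simp add: primitive_def)
  show "primitive \<omega> (c \<odot>\<^bsub>K_alg \<omega>\<^esub> x) = c \<odot>\<^bsub>KK\<^esub> primitive \<omega> x" for c
    using x D by (simp add: primitive_def KKV.smult_r_distr[simplified])
  show "primitive \<omega> (x \<oplus>\<^bsub>K_alg \<omega>\<^esub> y) = primitive \<omega> x \<oplus>\<^bsub>KK\<^esub> primitive \<omega> y" if "y \<in> carrier (K_alg \<omega>)" for y
    using x that D by (simp add: primitive_def KK.a_ac)
qed

text \<open>The mixed terms vanish because x \<otimes> 1 and 1 \<otimes> y commute, both products
  being x \<otimes> y. With x = A and y = B this accounts for the prescribed value of the
  comultiplication on C.\<close>

lemma primitive_bracket:
  assumes x: "x \<in> carrier (K_alg \<omega>)" and y: "y \<in> carrier (K_alg \<omega>)"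
  shows "primitive \<omega> (bracket (K_alg \<omega>) x y) = bracket KK (primitive \<omega> x) (primitive \<omega> y)"
proof -
  note closed = lin_mapsD(1)[OF K_pure_lin_maps(1)]
  note mult = pure_tensor_mult[OF complex_algebra_K complex_algebra_K, of _ \<omega>]
  note KL = bracket_lin_maps_left[OF KK.complex_algebra_axioms] 
  note KR = bracket_lin_maps_right[OF KK.complex_algebra_axioms] 
  have mixed: "bracket KK (pt x \<one>\<^bsub>K_alg \<omega>\<^esub>) (pt \<one>\<^bsub>K_alg \<omega>\<^esub> y) = \<zero>\<^bsub>KK\<^esub>"
    "bracket KK (pt \<one>\<^bsub>K_alg \<omega>\<^esub> x) (pt y \<one>\<^bsub>K_alg \<omega>\<^esub>) = \<zero>\<^bsub>KK\<^esub>"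
    using x y closed by (simp_all add: bracket_def mult KK.minus_eq_zero_iff)
  have "bracket KK (pt x \<one>\<^bsub>K_alg \<omega>\<^esub>) (pt y \<one>\<^bsub>K_alg \<omega>\<^esub>) = pt (bracket (K_alg \<omega>) x y) \<one>\<^bsub>K_alg \<omega>\<^esub>"
    using x y by (simp add: bracket_def mult lin_maps_minus[OF K.vector_space KK.vector_space K_pure_lin_maps(1)])
  moreover have "bracket KK (pt \<one>\<^bsub>K_alg \<omega>\<^esub> x) (pt \<one>\<^bsub>K_alg \<omega>\<^esub> y) = pt \<one>\<^bsub>K_alg \<omega>\<^esub> (bracket (K_alg \<omega>) x y)"
    using x y by (simp add: bracket_def mult lin_maps_minus[OF K.vector_space KK.vector_space K_pure_lin_maps(2)])
  ultimately show ?thesis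
    using x y closed bracket_closed[OF complex_algebra_K, of x \<omega> y]
    by (simp add: primitive_def lin_mapsD(2)[OF KL] lin_mapsD(2)[OF KR] mixed)
qed

text \<open>The map \<open>primitive\<close> is linear and respects brackets, so it carries the
  bracket relations of \<open>K_generator_bracket\<close> to the ones that \<open>K_hom\<close> asks
  for.\<close>

lemma comult_algebra_hom: "comult \<omega> \<in> algebra_hom (K_alg \<omega>) KK"
  and comult_generator: "comult \<omega> (generator (K_relators \<omega>) g) = primitive \<omega> (generator (K_relators \<omega>) g)"
proof -
  have eq: "comult \<omega> = presented_hom KK (\<lambda>g. primitive \<omega> (generator (K_relators \<omega>) g))"
    by (simp add: comult_def primitive_def Let_def)
  have gen: "generator (K_relators \<omega>) g \<in> carrier (K_alg \<omega>)" for g by (simp add: K_alg_def)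
  note * = K_hom[OF KK.complex_algebra_axioms, where \<phi> = "\<lambda>g. primitive \<omega> (generator (K_relators \<omega>) g)" and \<omega> = \<omega>]
  note D = lin_mapsD[OF primitive_lin_maps]
  show "comult \<omega> \<in> algebra_hom (K_alg \<omega>) KK"
    "comult \<omega> (generator (K_relators \<omega>) g) = primitive \<omega> (generator (K_relators \<omega>) g)"
    unfolding eq
    by (rule *; simp add: D gen primitive_bracket[symmetric] bracket_closed[OF complex_algebra_K] K_generator_bracket
        module.smult_closed[OF K.vector_space, simplified])+
qed

end

section \<open>The modules \<open>L\<^sub>n\<close>\<close>

definition L_op :: "nat \<Rightarrow> sl2_gen \<Rightarrow> (nat \<Rightarrow>\<^sub>0 complex) \<Rightarrow> (nat \<Rightarrow>\<^sub>0 complex)"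
  where "L_op n g = lin_ext (L_basis_action n g)"

lemma L_op_linear: "L_op n g (x + y) = L_op n g x + L_op n g y" "L_op n g (scl c x) = scl c (L_op n g x)"
  "L_op n g 0 = 0"
  by (simp_all add: L_op_def lin_ext_add lin_ext_scl)

lemma keys_L_basis_action: "i \<le> n \<Longrightarrow> supp (L_basis_action n g i) \<subseteq> {..n}"
  by (cases g) (auto split: if_splits)

lemma keys_L_op: "supp x \<subseteq> {..n} \<Longrightarrow> supp (L_op n g x) \<subseteq> {..n}"
  unfolding L_op_def by (rule lin_ext_keys) (use keys_L_basis_action in blast)

text \<open>The operators are total, so the formulas also cover indices above n; there only F is cut
  off.\<close>

lemma lookup_L_op:
  "coef (L_op n E x) i = (of_nat n - of_nat i) * coef x (Suc i)"
  "coef (L_op n F x) i = (if i = 0 \<or> n < i then 0 else of_nat i * coef x (i - 1))"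
  "coef (L_op n H x) i = (of_nat n - 2 * of_nat i) * coef x i"
proof -
  have "supp x \<subseteq> UNIV" by simp
  then show "coef (L_op n E x) i = (of_nat n - of_nat i) * coef x (Suc i)"
    "coef (L_op n F x) i = (if i = 0 \<or> n < i then 0 else of_nat i * coef x (i - 1))"
    "coef (L_op n H x) i = (of_nat n - 2 * of_nat i) * coef x i"
  proof (induction rule: free_space_induct)
    case (single j c)
    { case 1 show ?case by (auto simp: L_op_def lookup_single when_def of_nat_diff) }
    { case 2 show ?case by (cases i) (auto simp: L_op_def lookup_single when_def) }
    { case 3 show ?case by (auto simp: L_op_def lookup_single when_def) }
  qed (auto simp: L_op_linear lookup_add algebra_simps)
qed

lemma L_op_relations:
  assumes "supp x \<subseteq> {..n}"
  shows "L_op n H (L_op n E x) = L_op n E (L_op n H x) + scl 2 (L_op n E x)"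
    and "L_op n H (L_op n F x) = L_op n F (L_op n H x) - scl 2 (L_op n F x)"
    and "L_op n E (L_op n F x) = L_op n F (L_op n E x) + L_op n H x"
proof -
  show "L_op n H (L_op n E x) = L_op n E (L_op n H x) + scl 2 (L_op n E x)"
    by (rule poly_mapping_eqI) (simp add: lookup_L_op lookup_add algebra_simps)
  show "L_op n H (L_op n F x) = L_op n F (L_op n H x) - scl 2 (L_op n F x)"
    by (rule poly_mapping_eqI) (simp add: lookup_L_op lookup_minus of_nat_diff algebra_simps)
  show "L_op n E (L_op n F x) = L_op n F (L_op n E x) + L_op n H x"
  proof (rule poly_mapping_eqI)
    fix i
    \<comment> \<open>Beyond n both EF and FE give zero by the cut-off of F, whereas H would
      contribute (n - 2i) times the coefficient; the support condition removes it.\<close>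
    have "coef x i = 0" if "i > n" using that assms by (auto simp: in_keys_iff)
    then show "coef (L_op n E (L_op n F x)) i = coef (L_op n F (L_op n E x) + L_op n H x) i"
      by (cases i; cases "i = n") (auto simp: lookup_L_op lookup_add of_nat_diff algebra_simps)
  qed
qed

lemma L_action_eq:
  assumes "supp x \<subseteq> {..n}"
  shows "linear_extension (free_space {..n}) (L_basis_action n g) x = L_op n g x"
  unfolding L_op_def using assms keys_L_basis_action by (intro linear_extension_free_space) (auto simp: subset_iff)

lemma L_action_lin_maps:
  "linear_extension (free_space {..n}) (L_basis_action n g) \<in> lin_maps (free_space {..n}) (free_space {..n})"
  using keys_L_basis_action by (intro linear_extension_lin_maps module_free_space) auto

lemma L_word_action:
  assumes r: "r \<in> sl2_relators" and x: "x \<in> carrier (free_space {..n})"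
  shows "word_action (free_space {..n}) (\<lambda>g. linear_extension (free_space {..n}) (L_basis_action n g)) r x =
    \<zero>\<^bsub>free_space {..n}\<^esub>"
proof -
  let ?V = "free_space {..n}" and ?\<rho> = "\<lambda>g. linear_extension (free_space {..n}) (L_basis_action n g)"
  have "word_action ?V ?\<rho> r x = lin_ext (\<lambda>w. foldr ?\<rho> w x) r"
    unfolding word_action_def
    using lin_mapsD(1)[OF foldr_lin_maps[where \<rho> = ?\<rho>, OF module_free_space L_action_lin_maps] x]
    by (intro linear_extension_free_space) auto
  also have "\<dots> = 0"
    using r x L_op_relations[of x n] keys_L_op[of x n]
    by (auto simp: sl2_relators_def lin_ext_add lin_ext_minus L_action_eq)
  finally show ?thesis by simp
qed

lemma left_module_L_sl2: "left_module U_sl2 (L_sl2 n)"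
  unfolding L_sl2_def U_sl2_def
  by (rule left_module_presented[OF module_free_space L_action_lin_maps L_word_action])

lemma L_sl2_simps [simp]:
  "carrier (L_sl2 n) = {p. supp p \<subseteq> {..n}}" "zero (L_sl2 n) = 0" "add (L_sl2 n) = (+)" "smult (L_sl2 n) = scl"
  by (simp_all add: L_sl2_def)

lemma act_L_sl2_generator:
  assumes "supp x \<subseteq> {..n}"
  shows "act (L_sl2 n) (generator sl2_relators g) x = L_op n g x"
  using left_module_presented(2)[where V = "free_space {..n}" and v = x, OF module_free_space L_action_lin_maps L_word_action] assms
  by (simp add: L_sl2_def L_action_eq)

definition sl2_op :: "nat \<Rightarrow> (sl2_gen \<Rightarrow>\<^sub>0 complex) \<Rightarrow> (nat \<Rightarrow>\<^sub>0 complex) \<Rightarrow> (nat \<Rightarrow>\<^sub>0 complex)"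
  where "sl2_op n p x = lin_ext (\<lambda>g. L_op n g x) p"

lemma act_L_sl2_embed:
  assumes x: "supp x \<subseteq> {..n}"
  shows "act (L_sl2 n) (sl2_embed p) x = sl2_op n p x"
proof -
  interpret L: left_module U_sl2 "L_sl2 n" by (rule left_module_L_sl2)
  have "supp p \<subseteq> UNIV" by simp
  then show ?thesis
  proof (induction rule: free_space_induct)
    case zero
    have "(\<lambda>p. act (L_sl2 n) (sl2_embed p) x) \<in> lin_maps (free_space UNIV) (L_sl2 n)"
      using x by (intro lin_maps_comp[OF sl2_embed_lin_maps L.act_lin_maps(1)]) simp
    from lin_maps_zero[OF module_free_space L.vector_space this] show ?case by (simp add: sl2_op_def)
  next
    case (single g c)
    then show ?case
      using x by (simp add: sl2_embed_single L.act_smult_left[simplified] U_generator_closed act_L_sl2_generator sl2_op_def)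
  next
    case (add p q)
    then show ?case
      using x lin_mapsD(1,2)[OF sl2_embed_lin_maps] L.act_add_left[of "sl2_embed p" "sl2_embed q" x]
      by (simp add: sl2_op_def lin_ext_add)
  qed
qed

lemma L_mod_simps [simp]:
  "carrier (L_mod \<omega> n) = {p. supp p \<subseteq> {..n}}" "zero (L_mod \<omega> n) = 0" "add (L_mod \<omega> n) = (+)" "smult (L_mod \<omega> n) = scl"
  by (simp_all add: L_mod_def pullback_def)

lemma left_module_L_mod: "left_module (K_alg \<omega>) (L_mod \<omega> n)"
  unfolding L_mod_def by (rule left_module_pullback[OF left_module_L_sl2 complex_algebra_K zeta_algebra_hom])

lemma act_L_mod_generator:
  "supp x \<subseteq> {..n} \<Longrightarrow> act (L_mod \<omega> n) (generator (K_relators \<omega>) g) x = sl2_op n (zeta_gen \<omega> g) x"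
  by (simp add: L_mod_def pullback_def zeta_generator act_L_sl2_embed)

lemma left_module_K_tensor:
  "\<lbrakk>left_module (K_alg \<omega>) M; left_module (K_alg \<omega>) N\<rbrakk> \<Longrightarrow> left_module (K_alg \<omega>) (K_tensor \<omega> M N)"
  unfolding K_tensor_def
  by (rule left_module_pullback[OF left_module_tensor_module complex_algebra_K comult_algebra_hom])
    (simp_all add: complex_algebra_K)

lemma K_tensor_simps [simp]:
  "carrier (K_tensor \<omega> M N) = carrier (tensor_space M N)" "zero (K_tensor \<omega> M N) = zero (tensor_space M N)"
  "add (K_tensor \<omega> M N) = add (tensor_space M N)" "smult (K_tensor \<omega> M N) = smult (tensor_space M N)"
  by (simp_all add: K_tensor_def pullback_def tensor_module_def)

text \<open>The Leibniz rule. It is the form in which the comultiplication enters the rest of the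
  proof.\<close>

lemma act_K_tensor_generator:
  fixes \<omega> :: complex and g :: K_gen
  assumes M: "left_module (K_alg \<omega>) M" and N: "left_module (K_alg \<omega>) N"
    and x: "x \<in> carrier M" and y: "y \<in> carrier N"
  defines "a \<equiv> generator (K_relators \<omega>) g"
  shows "act (K_tensor \<omega> M N) a (pure_tensor M N x y) =
    pure_tensor M N (act M a x) y \<oplus>\<^bsub>tensor_space M N\<^esub> pure_tensor M N x (act N a y)"
proof -
  interpret M: left_module "K_alg \<omega>" M by (rule M)
  interpret N: left_module "K_alg \<omega>" N by (rule N)
  let ?K = "K_alg \<omega>"
  interpret K: ring ?K by (rule complex_algebra.ring[OF complex_algebra_K])
  interpret T: left_module "tensor_algebra ?K ?K" "tensor_module M N"
    by (rule left_module_tensor_module[OF complex_algebra_K complex_algebra_K M N])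
  have a: "a \<in> carrier ?K" by (simp add: a_def K_alg_def)
  note closed = lin_mapsD(1)[OF K_pure_lin_maps(1)]
  have T: "pure_tensor M N x y \<in> carrier (tensor_module M N)"
    using pure_tensor_closed[OF M.vector_space N.vector_space x y] by (simp add: tensor_module_def)
  note act = act_pure_tensor[OF complex_algebra_K complex_algebra_K M N]
  have "act (K_tensor \<omega> M N) a (pure_tensor M N x y) = act (tensor_module M N) (primitive \<omega> a) (pure_tensor M N x y)"
    by (simp add: K_tensor_def pullback_def comult_generator a_def)
  also have "\<dots> = pure_tensor M N (act M a x) y \<oplus>\<^bsub>tensor_module M N\<^esub> pure_tensor M N x (act N a y)"
    using a x y T closed by (simp add: primitive_def T.act_add_left act M.act_one N.act_one)
  finally show ?thesis by (simp add: tensor_module_def)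
qed


section \<open>The Clebsch--Gordan decomposition in coordinates\<close>

lemma lin_ext_fun_sum: "lin_ext (\<lambda>x. \<Sum>s\<in>S. f s x) p = (\<Sum>s\<in>S. lin_ext (f s) p)"
  by (simp add: lin_ext_def pm.scale_sum_right sum.swap[of _ S])

lemma bil_lin_ext_left: "bil \<mu> (lin_ext f s) q = lin_ext (\<lambda>g. bil \<mu> (f g) q) s"
  by (simp add: bil_def lin_ext_lin_ext)

lemma bil_lin_ext_right: "bil \<mu> q (lin_ext f s) = lin_ext (\<lambda>g. bil \<mu> q (f g)) s"
  by (simp add: bil_flip[of \<mu> q] bil_lin_ext_left)

text \<open>Injectivity makes the images of the basis X an independent family of size card Y. A
  vector outside their span would enlarge it to an independent set with more elements than the
  spanning set of the target.\<close>

lemma free_space_inj_imp_surj: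
  fixes f :: "'x \<Rightarrow> ('y \<Rightarrow>\<^sub>0 complex)"
  assumes X: "finite X" and Y: "finite Y" and card: "card X = card Y"
    and f: "\<And>x. x \<in> X \<Longrightarrow> supp (f x) \<subseteq> Y"
    and inj: "\<And>p. \<lbrakk>supp p \<subseteq> X; lin_ext f p = 0\<rbrakk> \<Longrightarrow> p = 0"
    and q: "supp q \<subseteq> Y"
  obtains p where "supp p \<subseteq> X" "lin_ext f p = q"
proof -
  define comb :: "(('y \<Rightarrow>\<^sub>0 complex) \<Rightarrow> complex) \<Rightarrow> ('x \<Rightarrow>\<^sub>0 complex)" where "comb u = (\<Sum>x\<in>X. sgl x (u (f x)))" for u
  \<comment> \<open>If f x = f y, then the difference of the two basis vectors lies in the kernel.
    Distinctness of the images is needed both for reindexing and for counting.\<close>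
  have inj_f: "inj_on f X"
  proof (rule inj_onI)
    fix x y assume xy: "x \<in> X" "y \<in> X" "f x = f y"
    then have "sgl x (1::complex) - sgl y 1 = 0"
      using keys_diff[of "sgl x (1::complex)" "sgl y 1"] by (intro inj) (auto simp: lin_ext_minus)
    then show "x = y" by (metis eq_iff_diff_eq_0 keys_single singleton_inject zero_neq_one)
  qed
  have comb_supp: "supp (comb u) \<subseteq> X" for u
    unfolding comb_def by (intro order.trans[OF keys_sum] UN_least) auto
  have comb_ext: "lin_ext f (comb u) = (\<Sum>v\<in>f ` X. scl (u v) v)" for u
    by (simp add: comb_def lin_ext_sum sum.reindex[OF inj_f])
  have coef_comb: "coef (comb u) x = u (f x)" if "x \<in> X" for u x
    using X that by (simp add: comb_def lookup_sum lookup_single when_def sum.delta)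
  have indep: "pm.independent (f ` X)"
  proof (rule pm.independent_if_scalars_zero)
    fix u x assume u: "(\<Sum>v\<in>f ` X. scl (u v) v) = 0" and "x \<in> f ` X"
    then obtain y where y: "y \<in> X" "x = f y" by blast
    have "comb u = 0" using inj[OF comb_supp] u by (simp add: comb_ext)
    then show "u x = 0" using coef_comb[OF y(1), of u] y(2) by simp
  qed (use X in simp)
  let ?T = "(\<lambda>y. sgl y (1::complex)) ` Y"
  have span: "r \<in> pm.span ?T" if "supp r \<subseteq> Y" for r
  proof -
    have "(\<Sum>y\<in>supp r. scl (coef r y) (sgl y 1)) \<in> pm.span ?T"
      using that by (intro pm.span_sum pm.span_scale pm.span_base) auto
    then show ?thesis by (simp add: poly_mapping_sum_singles)
  qed
  have "q \<in> pm.span (f ` X)"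
  proof (rule ccontr)
    assume nq: "q \<notin> pm.span (f ` X)"
    then have "pm.independent (insert q (f ` X))"
      using indep by (rule pm.independent_insertI)
    moreover have "insert q (f ` X) \<subseteq> pm.span ?T" using f q span by auto
    ultimately have "card (insert q (f ` X)) \<le> card ?T"
      using pm.independent_span_bound[of ?T] Y by blast
    also have "\<dots> \<le> card X" using card card_image_le[OF Y] by metis
    finally show False
      using nq pm.span_base[of q "f ` X"] X card_image[OF inj_f] by (auto simp: card_insert_if split: if_splits)
  qed
  then obtain u where "q = (\<Sum>v\<in>f ` X. scl (u v) v)"
    using X by (auto simp: pm.span_finite)
  with that[OF comb_supp] show ?thesis by (simp add: comb_ext)
qed

text \<open>Otherwise the basis vector with index \<open>0 :: nat\<close> is rewritten to \<open>1\<close>.\<close>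

declare Poly_Mapping.single_one [simp del]

text \<open>The Leibniz action of a generator of sl2 on L_m \<otimes> L_n, with the basis index (i,
  j) standing for v_i \<otimes> v_j.\<close>

definition T_op :: "nat \<Rightarrow> nat \<Rightarrow> sl2_gen \<Rightarrow> (nat \<times> nat \<Rightarrow>\<^sub>0 complex) \<Rightarrow> (nat \<times> nat \<Rightarrow>\<^sub>0 complex)"
  where "T_op m n g = lin_ext (\<lambda>(i, j). bil Pair (L_basis_action m g i) (sgl j 1) + bil Pair (sgl i 1) (L_basis_action n g j))"

lemma T_op_linear:
  "T_op m n g (x + y) = T_op m n g x + T_op m n g y" "T_op m n g (scl c x) = scl c (T_op m n g x)"
  "T_op m n g (x - y) = T_op m n g x - T_op m n g y" "T_op m n g 0 = 0"
  by (simp_all add: T_op_def lin_ext_add lin_ext_scl lin_ext_minus)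

lemma T_op_bil: "T_op m n g (bil Pair x y) = bil Pair (L_op m g x) y + bil Pair x (L_op n g y)"
proof -
  have "supp x \<subseteq> UNIV" "supp y \<subseteq> UNIV" by simp_all
  then show ?thesis
  proof (induction x rule: free_space_induct)
    case (single i c)
    from single(2) show ?case
    proof (induction y rule: free_space_induct)
      case (single j d)
      have "bil Pair (L_basis_action m g i) (sgl j d) = scl d (bil Pair (L_basis_action m g i) (sgl j 1))"
        "bil Pair (sgl i c) (L_basis_action n g j) = scl c (bil Pair (sgl i 1) (L_basis_action n g j))"
        using bil_scl_right[of Pair _ d "sgl j 1"] bil_scl_left[of Pair c "sgl i 1"] by simp_all
      then show ?case
        by (simp add: T_op_def L_op_def bil_scl_left bil_scl_right pm.scale_right_distrib mult.commute)
    qed (simp_all add: T_op_linear L_op_linear bil_add_right)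
  qed (simp_all add: T_op_linear L_op_linear bil_add_left)
qed

lemma lookup_T_op:
  "coef (T_op m n E z) (i, j) = (of_nat m - of_nat i) * coef z (Suc i, j) + (of_nat n - of_nat j) * coef z (i, Suc j)"
  "coef (T_op m n H z) (i, j) = (of_nat (m + n) - 2 * of_nat (i + j)) * coef z (i, j)"
proof -
  have "supp z \<subseteq> UNIV" by simp
  then show "coef (T_op m n E z) (i, j) = (of_nat m - of_nat i) * coef z (Suc i, j) + (of_nat n - of_nat j) * coef z (i, Suc j)"
    "coef (T_op m n H z) (i, j) = (of_nat (m + n) - 2 * of_nat (i + j)) * coef z (i, j)"
  proof (induction rule: free_space_induct)
    case (single x c)
    obtain a b where x: "x = (a, b)" by (cases x)
    { case 1 show ?case by (auto simp: x T_op_def lookup_add lookup_single when_def of_nat_diff) }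
    { case 2 show ?case by (auto simp: x T_op_def lookup_add lookup_single when_def algebra_simps) }
  qed (simp_all only: T_op_linear lookup_zero lookup_add distrib_left mult_zero_right add_0_right add_ac)
qed

lemma keys_T_op:
  assumes "supp z \<subseteq> {..m} \<times> {..n}"
  shows "supp (T_op m n g z) \<subseteq> {..m} \<times> {..n}"
  unfolding T_op_def
proof (rule lin_ext_keys)
  fix x assume "x \<in> supp z"
  then obtain i j where x: "x = (i, j)" "i \<le> m" "j \<le> n" using assms by auto
  have "supp (bil Pair (L_basis_action m g i) (sgl j 1)) \<subseteq> {..m} \<times> {..n}"
    "supp (bil Pair (sgl i 1) (L_basis_action n g j)) \<subseteq> {..m} \<times> {..n}"
    using x keys_L_basis_action[of i m g] keys_L_basis_action[of j n g] by (intro keys_bil; auto)+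
  then have "supp (bil Pair (L_basis_action m g i) (sgl j 1) + bil Pair (sgl i 1) (L_basis_action n g j))
      \<subseteq> {..m} \<times> {..n}"
    by (intro order.trans[OF keys_add] Un_least)
  then show "supp (case x of (i, j) \<Rightarrow> bil Pair (L_basis_action m g i) (sgl j 1) + bil Pair (sgl i 1) (L_basis_action n g j))
      \<subseteq> {..m} \<times> {..n}"
    by (simp add: x(1))
qed

text \<open>On v_i \<otimes> v_j the mixed terms of the two compositions coincide, and the remaining
  terms are the relations on each factor.\<close>

lemma T_op_relations:
  assumes "supp z \<subseteq> {..m} \<times> {..n}"
  shows "T_op m n H (T_op m n F z) = T_op m n F (T_op m n H z) - scl 2 (T_op m n F z)"
    and "T_op m n E (T_op m n F z) = T_op m n F (T_op m n E z) + T_op m n H z"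
  using assms
proof (induction rule: free_space_induct)
  case (single x c)
  obtain i j where x: "x = (i, j)" "i \<le> m" "j \<le> n" using single by auto
  have eq: "sgl x c = bil Pair (sgl i c) (sgl j 1)" by (simp add: x)
  have i: "supp (sgl i c) \<subseteq> {..m}" and j: "supp (sgl j (1::complex)) \<subseteq> {..n}" using x by auto
  { case 1 show ?case
      unfolding eq by (simp add: T_op_bil T_op_linear L_op_relations(2)[OF i] L_op_relations(2)[OF j]
          bil_minus_left bil_minus_right bil_scl_left bil_scl_right pm.scale_right_distrib del: bil_single) }
  { case 2 show ?case
      unfolding eq by (simp add: T_op_bil T_op_linear L_op_relations(3)[OF i] L_op_relations(3)[OF j]
          bil_add_left bil_add_right del: bil_single) }
qed (simp_all add: T_op_linear pm.scale_right_distrib)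

text \<open>The coefficient of E z at (i, j) expresses (n - j) z(i, j+1) through z(i+1, j), so
  vanishing propagates from column j to column j+1. At j = n the factor is zero, but column n+1 lies
  outside the support.\<close>

lemma T_op_E_injective:
  assumes z: "supp z \<subseteq> {..m} \<times> {..n}" and Ez: "T_op m n E z = 0" and z0: "\<And>i. coef z (i, 0) = 0"
  shows "z = 0"
proof -
  have "coef z (i, j) = 0" for i j
  proof (induction j arbitrary: i)
    case (Suc j)
    have "(of_nat n - of_nat j) * coef z (i, Suc j) = (0::complex)"
      using lookup_T_op(1)[of m n z i j] Suc Ez by simp
    then have "j = n \<or> coef z (i, Suc j) = 0" by auto
    moreover have "coef z (i, Suc n) = 0" using z by (auto simp: in_keys_iff)
    ultimately show ?case by auto
  qed (rule z0)
  then show ?thesis by (intro poly_mapping_eqI) auto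
qed

text \<open>The coefficients solve the recursion that \<open>E w\<^sub>p = 0\<close> imposes on a vector of weight \<open>m + n - 2p\<close>.\<close>

definition hw_vector :: "nat \<Rightarrow> nat \<Rightarrow> nat \<Rightarrow> (nat \<times> nat \<Rightarrow>\<^sub>0 complex)"
  where "hw_vector m n p = (\<Sum>i\<le>p. sgl (i, p - i) ((-1) ^ i * fact (m - i) * fact (n - (p - i))))"

lemma lookup_hw_vector:
  "coef (hw_vector m n p) (i, j) = (if i + j = p then (-1) ^ i * fact (m - i) * fact (n - j) else 0)"
proof -
  have "coef (hw_vector m n p) (i, j) =
      (\<Sum>k\<le>p. if k = i then (if i + j = p then (-1) ^ i * fact (m - i) * fact (n - j) else 0) else 0)"
    unfolding hw_vector_def lookup_sum by (rule sum.cong) (auto simp: lookup_single when_def)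
  also have "\<dots> = (if i + j = p then (-1) ^ i * fact (m - i) * fact (n - j) else 0)"
    by (auto simp: sum.delta)
  finally show ?thesis .
qed

section \<open>Strings generated by the highest weight vectors\<close>

context
  fixes m n :: nat
begin

text \<open>Divided powers are forced by the normalization F v_i = (i+1) v_{i+1} of the basis of
  L_n.\<close>

fun hw_string :: "nat \<Rightarrow> nat \<Rightarrow> (nat \<times> nat \<Rightarrow>\<^sub>0 complex)"
  where
    "hw_string p 0 = hw_vector m n p"
  | "hw_string p (Suc i) = scl (1 / of_nat (Suc i)) (T_op m n F (hw_string p i))"

context
  fixes p assumes p: "p \<le> min m n"
begin

lemma keys_hw_string: "supp (hw_string p i) \<subseteq> {..m} \<times> {..n}"
proof (induction i)
  case 0
  show ?case using p by (auto simp: in_keys_iff lookup_hw_vector split: if_splits)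
next
  case (Suc i)
  from order.trans[OF keys_scl keys_T_op[OF this]] show ?case by simp
qed

lemma T_op_F_hw_string: "T_op m n F (hw_string p i) = scl (of_nat (Suc i)) (hw_string p (Suc i))"
  by (simp del: of_nat_Suc)

lemma T_op_H_hw_string: "T_op m n H (hw_string p i) = scl (of_nat (m + n - 2 * p) - 2 * of_nat i) (hw_string p i)"
proof (induction i)
  case 0
  show ?case
    using p by (intro poly_mapping_eqI) (auto simp: lookup_T_op lookup_hw_vector of_nat_diff split: if_splits)
next
  case (Suc i)
  let ?u = "hw_string p i" and ?N = "of_nat (m + n - 2 * p) :: complex"
  have "T_op m n H (T_op m n F ?u) = scl (?N - 2 * of_nat i) (T_op m n F ?u) - scl 2 (T_op m n F ?u)"
    unfolding T_op_relations(1)[OF keys_hw_string] Suc T_op_linear ..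
  also have "\<dots> = scl (?N - 2 * of_nat (Suc i)) (T_op m n F ?u)"
    unfolding pm.scale_left_diff_distrib[symmetric] by (simp add: algebra_simps)
  finally show ?case by (simp add: T_op_linear mult.commute del: of_nat_Suc)
qed

text \<open>At (i, j) with i + j + 1 = p the two terms are (m-i)! (n-j)! with opposite signs. The
  bound on p keeps m - i and n - j positive, so that the factor produced by E completes each
  factorial.\<close>

lemma T_op_E_hw_string_0: "T_op m n E (hw_string p 0) = 0"
proof (rule poly_mapping_eqI)
  fix x :: "nat \<times> nat"
  obtain i j where x: "x = (i, j)" by (cases x)
  have "coef (T_op m n E (hw_string p 0)) (i, j) = 0"
  proof (cases "Suc (i + j) = p")
    case True
    then have "m - i = Suc (m - Suc i)" "n - j = Suc (n - Suc j)" using p by auto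
    then have f: "fact (m - i) = (of_nat (m - i) * fact (m - Suc i) :: complex)"
      "fact (n - j) = (of_nat (n - j) * fact (n - Suc j) :: complex)"
      by (metis fact_Suc)+
    show ?thesis using True p by (auto simp: lookup_T_op lookup_hw_vector f of_nat_diff)
  qed (auto simp: lookup_T_op lookup_hw_vector)
  then show "coef (T_op m n E (hw_string p 0)) x = coef 0 x" by (simp add: x)
qed

text \<open>With N = m + n - 2p this is the coefficient in E v_{i+1} = (N - i) v_i. The induction
  uses EF = FE + H and the identity (N-i)(i+1) + N - 2(i+1) = (i+2)(N-(i+1)).\<close>

lemma T_op_E_hw_string: "T_op m n E (hw_string p (Suc i)) = scl (of_nat (m + n - 2 * p) - of_nat i) (hw_string p i)"
proof (induction i)
  case 0
  show ?case
    using T_op_E_hw_string_0 T_op_relations(2)[OF keys_hw_string[of 0]] T_op_H_hw_string[of 0] 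
    by (simp add: T_op_linear)
next
  case (Suc i)
  have "T_op m n E (hw_string p (Suc (Suc i))) = scl (1 / of_nat (Suc (Suc i)))
      (T_op m n F (T_op m n E (hw_string p (Suc i))) + T_op m n H (hw_string p (Suc i)))"
    using T_op_relations(2)[OF keys_hw_string[of "Suc i"]] by (subst hw_string.simps(2)) (simp only: T_op_linear)
  also have "T_op m n F (T_op m n E (hw_string p (Suc i))) =
      scl ((of_nat (m + n - 2 * p) - of_nat i) * of_nat (Suc i)) (hw_string p (Suc i))"
    unfolding Suc T_op_linear T_op_F_hw_string by simp
  also have "T_op m n H (hw_string p (Suc i)) = scl (of_nat (m + n - 2 * p) - 2 * of_nat (Suc i)) (hw_string p (Suc i))"
    by (rule T_op_H_hw_string)
  also have "scl ((of_nat (m + n - 2 * p) - of_nat i) * of_nat (Suc i)) (hw_string p (Suc i)) +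
      scl (of_nat (m + n - 2 * p) - 2 * of_nat (Suc i)) (hw_string p (Suc i)) =
      scl (of_nat (Suc (Suc i)) * (of_nat (m + n - 2 * p) - of_nat (Suc i))) (hw_string p (Suc i))"
    unfolding pm.scale_left_distrib[symmetric] by (rule arg_cong[of _ _ "\<lambda>c. scl c _"]) (simp add: algebra_simps)
  finally show ?case by (simp del: of_nat_Suc hw_string.simps)
qed

text \<open>H acts on v_i \<otimes> v_j by m + n - 2(i+j) and on the k-th string vector by m + n -
  2p - 2k; where the coefficient is nonzero the eigenvalues must agree.\<close>

lemma hw_string_weight:
  assumes "coef (hw_string p k) (i, j) \<noteq> 0"
  shows "i + j = p + k"
proof -
  have "(of_nat (m + n) - 2 * of_nat (i + j)) * coef (hw_string p k) (i, j) =
      (of_nat (m + n - 2 * p) - 2 * of_nat k) * coef (hw_string p k) (i, j)"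
    using lookup_T_op(2)[of m n "hw_string p k" i j] unfolding T_op_H_hw_string lookup_scl by (rule sym)
  with assms have "(of_nat (m + n) - 2 * of_nat (i + j) :: complex) = of_nat (m + n - 2 * p) - 2 * of_nat k"
    by simp
  \<comment> \<open>Subtractions are moved across the equation so that both sides become images of
    natural numbers and the cast can be cancelled.\<close>
  moreover have move: "a + d = c + b" if "a - b = c - d" for a b c d :: complex
    using that by (simp add: algebra_simps)
  ultimately have "of_nat (m + n) + 2 * of_nat k = (of_nat (m + n - 2 * p) + 2 * of_nat (i + j) :: complex)"
    using move by blast
  then have "of_nat (m + n + 2 * k) = (of_nat (m + n - 2 * p + 2 * (i + j)) :: complex)"
    by (simp only: of_nat_add of_nat_mult of_nat_numeral)
  then have "m + n + 2 * k = m + n - 2 * p + 2 * (i + j)"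
    by (simp only: of_nat_eq_iff)
  then show ?thesis using p by auto
qed

text \<open>The vector is killed by E since the factor N - i is zero at i = N = m + n - 2p. A
  nonzero coefficient at (i, 0) would force i = m + n - p + 1, which exceeds m because p is at most
  n; so \<open>T_op_E_injective\<close> applies.\<close>

lemma hw_string_vanishes: "hw_string p (Suc (m + n - 2 * p)) = 0"
proof (rule T_op_E_injective[OF keys_hw_string])
  show "T_op m n E (hw_string p (Suc (m + n - 2 * p))) = 0"
    by (subst T_op_E_hw_string) simp
  fix i
  show "coef (hw_string p (Suc (m + n - 2 * p))) (i, 0) = 0"
  proof (rule ccontr)
    assume nz: "coef (hw_string p (Suc (m + n - 2 * p))) (i, 0) \<noteq> 0"
    have "i \<le> m" using nz keys_hw_string[of "Suc (m + n - 2 * p)"] by (auto simp: in_keys_iff)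
    with hw_string_weight[OF nz] p show False by auto
  qed
qed

lemma lin_ext_hw_string:
  assumes y: "supp y \<subseteq> {..m + n - 2 * p}"
  shows "lin_ext (hw_string p) (L_op (m + n - 2 * p) g y) = T_op m n g (lin_ext (hw_string p) y)"
  unfolding L_op_def T_op_def lin_ext_lin_ext
proof (rule lin_ext_cong, fold T_op_def)
  let ?N = "m + n - 2 * p"
  fix i assume "i \<in> supp y"
  then have i: "i \<le> ?N" using y by auto
  show "lin_ext (hw_string p) (L_basis_action ?N g i) = T_op m n g (hw_string p i)"
  proof (cases g)
    case E
    then show ?thesis
      using T_op_E_hw_string_0 T_op_E_hw_string by (cases i) (simp_all del: hw_string.simps)
  next
    \<comment> \<open>At the top index the left side is zero because F v_N = 0 in L_N;
      \<open>hw_string_vanishes\<close> provides the same on the right.\<close>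
    case F
    show ?thesis
      unfolding F T_op_F_hw_string using i hw_string_vanishes
      by (cases "i = ?N") (simp_all del: hw_string.simps add: add.commute)
  next
    case H
    then show ?thesis by (simp add: T_op_H_hw_string)
  qed
qed

end

section \<open>The Clebsch-Gordan map and its bijectivity\<close>

definition CG_map :: "(nat \<Rightarrow> (nat \<Rightarrow>\<^sub>0 complex)) \<Rightarrow> (nat \<times> nat \<Rightarrow>\<^sub>0 complex)"
  where "CG_map x = (\<Sum>p\<in>{0..min m n}. lin_ext (hw_string p) (x p))"

lemma CG_map_L_op:
  assumes "\<And>p. p \<le> min m n \<Longrightarrow> supp (x p) \<subseteq> {..m + n - 2 * p}"
  shows "CG_map (\<lambda>p. L_op (m + n - 2 * p) g (x p)) = T_op m n g (CG_map x)"
proof -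
  have "CG_map (\<lambda>p. L_op (m + n - 2 * p) g (x p)) = (\<Sum>p\<in>{0..min m n}. T_op m n g (lin_ext (hw_string p) (x p)))"
    unfolding CG_map_def by (intro sum.cong refl lin_ext_hw_string assms) simp_all
  also have "\<dots> = T_op m n g (CG_map x)" by (simp add: CG_map_def T_op_def lin_ext_sum)
  finally show ?thesis .
qed

text \<open>Induction on a common bound k for the indices in all components. E commutes with the map
  and lowers the bound, so by induction it kills every component; only multiples of v_0 survive,
  which leaves a relation among the highest weight vectors.\<close>

lemma CG_map_eq_zero:
  assumes "\<And>p. p \<le> min m n \<Longrightarrow> supp (x p) \<subseteq> {..m + n - 2 * p}"
    and "CG_map x = 0" and "p \<le> min m n"
  shows "x p = 0"
proof -
  have main: "\<forall>p\<le>min m n. x p = 0"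
    if "\<And>p. p \<le> min m n \<Longrightarrow> supp (x p) \<subseteq> {..m + n - 2 * p}"
      "\<And>p. p \<le> min m n \<Longrightarrow> supp (x p) \<subseteq> {..<k}" "CG_map x = 0" for k x
    using that
  proof (induction k arbitrary: x)
    case 0
    then show ?case by (metis keys_eq_empty lessThan_0 subset_empty)
  next
    case (Suc k)
    define y where "y p = L_op (m + n - 2 * p) E (x p)" for p
    have "\<forall>p\<le>min m n. y p = 0"
    proof (rule Suc.IH)
      show "CG_map y = 0"
        using CG_map_L_op[of x E] Suc.prems(1,3) by (simp add: y_def[abs_def] T_op_linear)
      fix p assume p: "p \<le> min m n"
      show "supp (y p) \<subseteq> {..m + n - 2 * p}"
        unfolding y_def by (rule keys_L_op[OF Suc.prems(1)[OF p]])
      show "supp (y p) \<subseteq> {..<k}"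
        using Suc.prems(2)[OF p] by (auto simp: y_def in_keys_iff lookup_L_op)
    qed
    \<comment> \<open>E v_{i+1} = (N - i) v_i with a nonzero factor for i < N = m + n - 2p; indices
      above N are excluded by the support.\<close>
    then have tail: "coef (x p) (Suc i) = 0" if "p \<le> min m n" for p i
    proof (cases "i < m + n - 2 * p")
      case True
      have "(of_nat (m + n - 2 * p) - of_nat i) * coef (x p) (Suc i) = 0"
        using \<open>\<forall>p\<le>min m n. y p = 0\<close> that lookup_L_op(1)[of "m + n - 2 * p" "x p" i] by (simp add: y_def)
      moreover have "(of_nat (m + n - 2 * p) :: complex) \<noteq> of_nat i"
        unfolding of_nat_eq_iff using True by simp
      ultimately show ?thesis by (metis mult_eq_0_iff right_minus_eq)
    next
      case False
      then show ?thesis using Suc.prems(1)[OF that] by (auto simp: in_keys_iff)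
    qed
    have x: "x p = sgl 0 (coef (x p) 0)" if "p \<le> min m n" for p
    proof (rule poly_mapping_eqI)
      show "coef (x p) i = coef (sgl 0 (coef (x p) 0)) i" for i
        using tail[OF that] by (cases i) (auto simp: lookup_single)
    qed
    have eq: "lin_ext (hw_string p) (x p) = scl (coef (x p) 0) (hw_vector m n p)" if "p \<le> min m n" for p
      by (subst x[OF that]) simp
    have "CG_map x = (\<Sum>p\<in>{0..min m n}. scl (coef (x p) 0) (hw_vector m n p))"
      unfolding CG_map_def by (intro sum.cong refl eq) simp
    then have zero: "(\<Sum>p\<in>{0..min m n}. scl (coef (x p) 0) (hw_vector m n p)) = 0"
      using Suc.prems(3) by simp
    show ?case
    proof (intro allI impI)
      fix q assume q: "q \<le> min m n"
      \<comment> \<open>The coordinate (0, q) isolates one term: of all the highest weight vectors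
        only the one with p = q is nonzero there, with value m! (n-q)!.\<close>
      have "0 = coef (\<Sum>p\<in>{0..min m n}. scl (coef (x p) 0) (hw_vector m n p)) (0, q)"
        by (simp only: zero lookup_zero)
      also have "\<dots> = (\<Sum>p\<in>{0..min m n}. if p = q then coef (x q) 0 * fact m * fact (n - q) else 0)"
        unfolding lookup_sum by (rule sum.cong) (auto simp: lookup_hw_vector)
      also have "\<dots> = coef (x q) 0 * fact m * fact (n - q)"
        using q by (simp add: sum.delta)
      finally show "x q = 0" using x[OF q] by simp
    qed
  qed
  \<comment> \<open>A starting bound valid for all p at once, since m + n - 2p is at most m +
    n.\<close>
  have "supp (x p) \<subseteq> {..<Suc (m + n)}" if "p \<le> min m n" for p
    using assms(1)[OF that] by auto
  from main[OF assms(1) this assms(2)] assms(3) show ?thesis by simp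
qed

lemma card_CG_index: "card (Sigma {0..min m n} (\<lambda>p. {..m + n - 2 * p})) = card ({..m} \<times> {..n})"
proof -
  \<comment> \<open>Generalized to partial sums to allow induction on k; at k = min m n the closed
    form is (m+1)(n+1).\<close>
  have "(\<Sum>p\<le>k. Suc (m + n - 2 * p)) = Suc k * (m + n + 1 - k)" if "k \<le> min m n" for k
    using that
  proof (induction k)
    case (Suc k)
    then obtain a where "m = Suc k + a" by (metis le_iff_add min.bounded_iff)
    moreover obtain b where "n = Suc k + b" using Suc by (metis le_iff_add min.bounded_iff)
    ultimately show ?case using Suc by (simp add: algebra_simps)
  qed simp
  from this[of "min m n"] have "(\<Sum>p\<le>min m n. Suc (m + n - 2 * p)) = Suc m * Suc n"
    by (cases "m \<le> n") (auto simp: min_def)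
  then show ?thesis by (simp add: atLeast0AtMost)
qed

text \<open>The counting argument needs one free space as domain, so a family of vectors is encoded
  as a single function on pairs (p, i), and \<open>slice\<close> recovers the components.
  Injectivity comes from \<open>CG_map_eq_zero\<close>, equality of dimensions from
  \<open>card_CG_index\<close>.\<close>

lemma CG_map_surj:
  assumes z: "supp z \<subseteq> {..m} \<times> {..n}"
  obtains x where "\<And>p. supp (x p) \<subseteq> {..m + n - 2 * p}" "CG_map x = z"
proof -
  let ?I = "Sigma {0..min m n} (\<lambda>p. {..m + n - 2 * p})" and ?f = "\<lambda>(p, i). hw_string p i"
  define slice :: "nat \<Rightarrow> (nat \<times> nat \<Rightarrow>\<^sub>0 complex) \<Rightarrow> (nat \<Rightarrow>\<^sub>0 complex)"
    where "slice p = lin_ext (\<lambda>(p', i). if p' = p then sgl i 1 else 0)" for p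
  have slice_supp: "supp (slice p q) \<subseteq> {..m + n - 2 * p}" if "supp q \<subseteq> ?I" for p q
    unfolding slice_def using that by (intro lin_ext_keys) (auto split: if_splits)
  have lookup_slice: "coef (slice p q) i = coef q (p, i)" for p q i
  proof -
    have "supp q \<subseteq> UNIV" by simp
    then show ?thesis
    proof (induction q rule: free_space_induct)
      case (single x c)
      then show ?case by (cases x) (auto simp: slice_def lookup_single when_def)
    qed (simp_all add: slice_def lin_ext_add lookup_add)
  qed
  have CG: "CG_map (\<lambda>p. slice p q) = lin_ext ?f q" if q: "supp q \<subseteq> ?I" for q
  proof -
    have "CG_map (\<lambda>p. slice p q) =
        lin_ext (\<lambda>x. \<Sum>p\<in>{0..min m n}. lin_ext (hw_string p) (case x of (p', i) \<Rightarrow> if p' = p then sgl i 1 else 0)) q"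
      by (simp add: CG_map_def slice_def lin_ext_lin_ext lin_ext_fun_sum)
    also have "\<dots> = lin_ext ?f q"
    proof (rule lin_ext_cong)
      fix x assume "x \<in> supp q"
      then obtain p' i where x: "x = (p', i)" "p' \<in> {0..min m n}" using q by auto
      have "(\<Sum>p\<in>{0..min m n}. lin_ext (hw_string p) (case x of (p', i) \<Rightarrow> if p' = p then sgl i 1 else 0)) =
          (\<Sum>p\<in>{0..min m n}. if p = p' then hw_string p' i else 0)"
        by (rule sum.cong) (auto simp: x(1))
      then show "(\<Sum>p\<in>{0..min m n}. lin_ext (hw_string p) (case x of (p', i) \<Rightarrow> if p' = p then sgl i 1 else 0)) = ?f x"
        using x by (simp add: sum.delta)
    qed
    finally show ?thesis .
  qed
  have inj: "q = 0" if q: "supp q \<subseteq> ?I" "lin_ext ?f q = 0" for q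
  proof (rule poly_mapping_eqI)
    fix x :: "nat \<times> nat"
    obtain p i where x: "x = (p, i)" by (cases x)
    show "coef q x = coef 0 x"
    proof (cases "p \<le> min m n")
      case True
      have "slice p q = 0"
        using slice_supp[OF q(1)] CG[OF q(1)] q(2) True by (intro CG_map_eq_zero) simp_all
      then show ?thesis using lookup_slice[of p q i] by (simp add: x)
    next
      case False
      then show ?thesis using q(1) x by (auto simp: in_keys_iff)
    qed
  qed
  obtain q where q: "supp q \<subseteq> ?I" "lin_ext ?f q = z"
  proof (rule free_space_inj_imp_surj[OF _ _ card_CG_index _ inj z])
    show "supp (?f x) \<subseteq> {..m} \<times> {..n}" if "x \<in> ?I" for x
      using that keys_hw_string[of "fst x" "snd x"] by (auto simp: case_prod_unfold)
  qed auto
  then show ?thesis using that[of "\<lambda>p. slice p q"] slice_supp CG by simp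
qed

end


section \<open>The decomposition of \<open>L\<^sub>m \<otimes> L\<^sub>n\<close>\<close>

lemma inv_into_lin_maps:
  assumes V: "module complex_field V" and f: "f \<in> lin_maps V W" and bij: "bij_betw f (carrier V) (carrier W)"
  shows "inv_into (carrier V) f \<in> lin_maps W V"
proof -
  interpret V: module complex_field V by (rule V)
  let ?g = "inv_into (carrier V) f"
  have g: "?g y \<in> carrier V" "f (?g y) = y" if "y \<in> carrier W" for y
    using that bij by (auto simp: bij_betw_def inv_into_into f_inv_into_f)
  have gf: "?g (f x) = x" if "x \<in> carrier V" for x
    using that bij by (simp add: bij_betw_def inv_into_f_f)
  show ?thesis
  proof (rule lin_mapsI)
    fix y assume y: "y \<in> carrier W"
    show "?g y \<in> carrier V" by (rule g(1)[OF y])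
    show "?g (c \<odot>\<^bsub>W\<^esub> y) = c \<odot>\<^bsub>V\<^esub> ?g y" for c
      using gf[of "c \<odot>\<^bsub>V\<^esub> ?g y"] g[OF y] by (simp add: lin_mapsD(3)[OF f])
    fix z assume z: "z \<in> carrier W"
    show "?g (y \<oplus>\<^bsub>W\<^esub> z) = ?g y \<oplus>\<^bsub>V\<^esub> ?g z"
      using gf[of "?g y \<oplus>\<^bsub>V\<^esub> ?g z"] g[OF y] g[OF z] by (simp add: lin_mapsD(2)[OF f])
  qed
qed

definition T_sl2_op :: "nat \<Rightarrow> nat \<Rightarrow> (sl2_gen \<Rightarrow>\<^sub>0 complex) \<Rightarrow> (nat \<times> nat \<Rightarrow>\<^sub>0 complex) \<Rightarrow> (nat \<times> nat \<Rightarrow>\<^sub>0 complex)"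
  where "T_sl2_op m n s z = lin_ext (\<lambda>g. T_op m n g z) s"

lemma T_sl2_op_bil: "T_sl2_op m n s (bil Pair x y) = bil Pair (sl2_op m s x) y + bil Pair x (sl2_op n s y)"
  by (simp add: T_sl2_op_def sl2_op_def T_op_bil lin_ext_fun_add bil_lin_ext_left bil_lin_ext_right)

lemma keys_sl2_op: "supp x \<subseteq> {..n} \<Longrightarrow> supp (sl2_op n s x) \<subseteq> {..n}"
  unfolding sl2_op_def by (intro lin_ext_keys keys_L_op)

lemma T_sl2_op_lin_maps:
  "T_sl2_op m n s \<in> lin_maps (free_space ({..m} \<times> {..n})) (free_space ({..m} \<times> {..n}))"
proof (rule lin_mapsI)
  show "T_sl2_op m n s x \<in> carrier (free_space ({..m} \<times> {..n}))" if "x \<in> carrier (free_space ({..m} \<times> {..n}))" for x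
    using that unfolding T_sl2_op_def free_space_simps mem_Collect_eq by (intro lin_ext_keys keys_T_op)
qed (simp_all add: T_sl2_op_def T_op_linear lin_ext_fun_add lin_ext_fun_scl)

context
  fixes \<omega> :: complex and m n :: nat
begin

abbreviation (input) "box \<equiv> {..m} \<times> {..n}"
abbreviation (input) "LT \<equiv> K_tensor \<omega> (L_mod \<omega> m) (L_mod \<omega> n)"
abbreviation (input) "LD \<equiv> direct_sum {0..min m n} (\<lambda>p. L_mod \<omega> (m + n - 2 * p))"

lemma left_module_LT: "left_module (K_alg \<omega>) LT"
  by (intro left_module_K_tensor left_module_L_mod)

lemma left_module_LD: "left_module (K_alg \<omega>) LD"
  by (intro left_module_direct_sum complex_algebra_K left_module_L_mod) simp

text \<open>The coordinate isomorphism, obtained by applying the universal property to the bilinear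
  map \<open>bil Pair\<close>.\<close>

definition T_coords :: "(((nat \<Rightarrow>\<^sub>0 complex) \<times> (nat \<Rightarrow>\<^sub>0 complex)) \<Rightarrow>\<^sub>0 complex) set \<Rightarrow> (nat \<times> nat \<Rightarrow>\<^sub>0 complex)"
  where "T_coords X = linear_extension (free_space box) (\<lambda>(x, y). bil Pair x y) (rep X)"

lemma bil_Pair_lin_maps:
  "y \<in> carrier (L_mod \<omega> n) \<Longrightarrow> (\<lambda>x. bil Pair x y) \<in> lin_maps (L_mod \<omega> m) (free_space box)"
  "x \<in> carrier (L_mod \<omega> m) \<Longrightarrow> bil Pair x \<in> lin_maps (L_mod \<omega> n) (free_space box)"
  using bil_lin_maps[of "{..m}" "{..n}" Pair box] by (simp_all add: lin_maps_def)

lemmas module_L_mod = left_module.vector_space[OF left_module_L_mod]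

lemma T_coords_lin_maps: "T_coords \<in> lin_maps (tensor_space (L_mod \<omega> m) (L_mod \<omega> n)) (free_space box)"
  unfolding T_coords_def[abs_def]
  by (rule tensor_lift_lin_maps[OF module_L_mod module_L_mod module_free_space bil_Pair_lin_maps])

lemma T_coords_pure:
  "\<lbrakk>supp x \<subseteq> {..m}; supp y \<subseteq> {..n}\<rbrakk> \<Longrightarrow> T_coords (pure_tensor (L_mod \<omega> m) (L_mod \<omega> n) x y) = bil Pair x y"
  unfolding T_coords_def
  by (rule tensor_lift_pure[OF module_L_mod module_L_mod module_free_space bil_Pair_lin_maps]) simp_all

lemma T_coords_act:
  assumes X: "X \<in> carrier LT"
  shows "T_coords (act LT (generator (K_relators \<omega>) g) X) = T_sl2_op m n (zeta_gen \<omega> g) (T_coords X)"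
proof -
  let ?T = "tensor_space (L_mod \<omega> m) (L_mod \<omega> n)" and ?a = "generator (K_relators \<omega>) g"
  have "?a \<in> carrier (K_alg \<omega>)" by (simp add: K_alg_def)
  then have act: "act LT ?a \<in> lin_maps ?T ?T"
    using left_module.act_lin_maps(2)[OF left_module_LT] by (simp add: lin_maps_def)
  note closed = pure_tensor_closed[OF module_L_mod[of \<omega> m] module_L_mod[of \<omega> n]]
  show ?thesis
  proof (rule tensor_lin_maps_eq[OF module_L_mod module_L_mod module_free_space
        lin_maps_comp[OF act T_coords_lin_maps] lin_maps_comp[OF T_coords_lin_maps T_sl2_op_lin_maps]])
    fix x y assume "x \<in> carrier (L_mod \<omega> m)" "y \<in> carrier (L_mod \<omega> n)"
    then show "T_coords (act LT ?a (pure_tensor (L_mod \<omega> m) (L_mod \<omega> n) x y)) =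
        T_sl2_op m n (zeta_gen \<omega> g) (T_coords (pure_tensor (L_mod \<omega> m) (L_mod \<omega> n) x y))"
      by (simp add: act_K_tensor_generator left_module_L_mod act_L_mod_generator lin_mapsD(2)[OF T_coords_lin_maps]
          closed keys_sl2_op T_coords_pure T_sl2_op_bil)
  qed (use X in simp)
qed

text \<open>The inverse sends the basis element (i, j) to the pure tensor v_i \<otimes> v_j. One
  composite is checked on basis elements, the other on pure tensors.\<close>

lemma bij_betw_T_coords: "bij_betw T_coords (carrier LT) (carrier (free_space box))"
proof -
  let ?L = "L_mod \<omega> m" and ?L' = "L_mod \<omega> n"
  let ?T = "tensor_space ?L ?L'"
  let ?e = "\<lambda>(i, j). pure_tensor ?L ?L' (sgl i 1) (sgl j 1)"
  define k where "k = linear_extension ?T ?e"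
  note T = module_tensor_space[OF module_L_mod[of \<omega> m] module_L_mod[of \<omega> n]]
  have e: "?e \<in> box \<rightarrow> carrier ?T"
    using pure_tensor_closed[OF module_L_mod[of \<omega> m] module_L_mod[of \<omega> n]] by auto
  have k: "k \<in> lin_maps (free_space box) ?T"
    unfolding k_def by (rule linear_extension_lin_maps[OF T e])
  have k_single: "k (sgl (i, j) 1) = pure_tensor ?L ?L' (sgl i 1) (sgl j 1)" if "i \<le> m" "j \<le> n" for i j
    unfolding k_def using that by (subst linear_extension_single_one[OF T e]) auto
  have id: "(\<lambda>x. x) \<in> lin_maps V V" for V :: "(complex, 'v, 'o) module_scheme"
    by (simp add: lin_maps_def)
  have fk: "T_coords (k z) = z" if "z \<in> carrier (free_space box)" for z
    by (rule free_space_lin_maps_eq[OF module_free_space lin_maps_comp[OF k T_coords_lin_maps] id])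
      (use that in \<open>auto simp: k_single T_coords_pure\<close>)
  note pl = pure_tensor_lin_maps_left[OF module_L_mod[of \<omega> m] module_L_mod[of \<omega> n]]
    and pr = pure_tensor_lin_maps_right[OF module_L_mod[of \<omega> m] module_L_mod[of \<omega> n]]
  have L: "lin_maps (L_mod \<omega> n) W = lin_maps (free_space {..n}) W" for n and W :: "(complex, 'w, 'o) module_scheme"
    by (simp add: lin_maps_def)
  have bl: "(\<lambda>x. bil Pair x y) \<in> lin_maps (free_space {..m}) (free_space box)" if "supp y \<subseteq> {..n}" for y
    using bil_Pair_lin_maps(1) that by (simp add: lin_maps_def)
  have br: "bil Pair x \<in> lin_maps (free_space {..n}) (free_space box)" if "supp x \<subseteq> {..m}" for x
    using bil_Pair_lin_maps(2) that by (simp add: lin_maps_def)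
  \<comment> \<open>A general pure tensor is reached one factor at a time: first y varies with x a
    basis vector, then x varies.\<close>
  have kb: "k (bil Pair (sgl i 1) y) = pure_tensor ?L ?L' (sgl i 1) y" if "i \<le> m" "supp y \<subseteq> {..n}" for i y
    by (rule free_space_lin_maps_eq[OF T lin_maps_comp[OF br k] pr[unfolded L]]) (use that in \<open>simp_all add: k_single\<close>)
  have kp: "k (bil Pair x y) = pure_tensor ?L ?L' x y" if "supp x \<subseteq> {..m}" "supp y \<subseteq> {..n}" for x y
    by (rule free_space_lin_maps_eq[where p = x, OF T lin_maps_comp[OF bl k] pl[unfolded L]]) (use that in \<open>simp_all add: kb\<close>)
  have kf: "k (T_coords X) = X" if "X \<in> carrier ?T" for X
    by (rule tensor_lin_maps_eq[OF module_L_mod module_L_mod T lin_maps_comp[OF T_coords_lin_maps k] id])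
      (use that in \<open>simp_all add: T_coords_pure kp\<close>)
  show ?thesis
    using lin_mapsD(1)[OF k] lin_mapsD(1)[OF T_coords_lin_maps] fk kf
    by (intro bij_betw_byWitness[where f' = k]) auto
qed

lemma carrier_LD: "carrier LD = (\<Pi>\<^sub>E p\<in>{0..min m n}. {x. supp x \<subseteq> {..m + n - 2 * p}})"
  by (simp add: direct_sum_def)

text \<open>Elements of the direct sum are \<open>undefined\<close> off the index set, so pointwise
  formulas for its operations agree with them only on the indices that the map reads.\<close>

lemma CG_map_cong: "(\<And>p. p \<le> min m n \<Longrightarrow> x p = y p) \<Longrightarrow> CG_map m n x = CG_map m n y"
  unfolding CG_map_def by (intro sum.cong) auto

lemma LD_supp: "\<lbrakk>x \<in> carrier LD; p \<le> min m n\<rbrakk> \<Longrightarrow> supp (x p) \<subseteq> {..m + n - 2 * p}"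
  unfolding carrier_LD by (auto simp: PiE_iff)

lemma CG_map_lin_maps: "CG_map m n \<in> lin_maps LD (free_space box)"
proof (rule lin_mapsI)
  fix x assume x: "x \<in> carrier LD"
  have "supp (CG_map m n x) \<subseteq> box"
    unfolding CG_map_def using keys_hw_string by (intro order.trans[OF keys_sum] UN_least lin_ext_keys) simp
  then show "CG_map m n x \<in> carrier (free_space box)" by simp
  have "CG_map m n (c \<odot>\<^bsub>LD\<^esub> x) = CG_map m n (\<lambda>p. scl c (x p))" for c
    by (rule CG_map_cong) (simp add: direct_sum_def)
  then show "CG_map m n (c \<odot>\<^bsub>LD\<^esub> x) = c \<odot>\<^bsub>free_space box\<^esub> CG_map m n x" for c
    by (simp add: CG_map_def lin_ext_scl pm.scale_sum_right)
  fix y assume y: "y \<in> carrier LD"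
  have "CG_map m n (x \<oplus>\<^bsub>LD\<^esub> y) = CG_map m n (\<lambda>p. x p + y p)"
    by (rule CG_map_cong) (simp add: direct_sum_def)
  then show "CG_map m n (x \<oplus>\<^bsub>LD\<^esub> y) = CG_map m n x \<oplus>\<^bsub>free_space box\<^esub> CG_map m n y"
    by (simp add: CG_map_def lin_ext_add sum.distrib)
qed

lemma bij_betw_CG_map: "bij_betw (CG_map m n) (carrier LD) (carrier (free_space box))"
  unfolding bij_betw_def
proof
  show "inj_on (CG_map m n) (carrier LD)"
  proof (rule inj_onI)
    fix x y assume x: "x \<in> carrier LD" and y: "y \<in> carrier LD" and eq: "CG_map m n x = CG_map m n y"
    have "CG_map m n (\<lambda>p. x p - y p) = 0"
      using eq by (simp add: CG_map_def lin_ext_minus sum_subtractf)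
    moreover have "supp (x p - y p) \<subseteq> {..m + n - 2 * p}" if "p \<le> min m n" for p
      using LD_supp[OF x that] LD_supp[OF y that] by (intro order.trans[OF keys_diff] Un_least)
    ultimately have "x p - y p = 0" if "p \<le> min m n" for p
      using that by (intro CG_map_eq_zero[where x = "\<lambda>p. x p - y p"])
    then show "x = y"
      using x y unfolding carrier_LD by (intro PiE_ext) auto
  qed
  show "CG_map m n ` carrier LD = carrier (free_space box)"
  proof
    show "CG_map m n ` carrier LD \<subseteq> carrier (free_space box)"
      using lin_mapsD(1)[OF CG_map_lin_maps] by blast
    show "carrier (free_space box) \<subseteq> CG_map m n ` carrier LD"
    proof
      fix z assume "z \<in> carrier (free_space box)"
      then have "supp z \<subseteq> box" by simp
      then obtain x where x: "\<And>p. supp (x p) \<subseteq> {..m + n - 2 * p}" "CG_map m n x = z"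
        by (rule CG_map_surj) blast
      \<comment> \<open>The preimage found in coordinates is an arbitrary function; restricting it
        makes it extensional without changing its image.\<close>
      have "restrict x {0..min m n} \<in> carrier LD" unfolding carrier_LD using x(1) by auto
      moreover have "CG_map m n (restrict x {0..min m n}) = z"
        unfolding x(2)[symmetric] by (rule CG_map_cong) simp
      ultimately show "z \<in> CG_map m n ` carrier LD" by blast
    qed
  qed
qed

text \<open>A generator of the algebra acts through an element of sl2, and both sides are linear in
  that element, so the claim reduces to E, F and H.\<close>

lemma CG_map_act:
  assumes x: "x \<in> carrier LD"
  shows "CG_map m n (act LD (generator (K_relators \<omega>) g) x) = T_sl2_op m n (zeta_gen \<omega> g) (CG_map m n x)"
proof -
  let ?N = "\<lambda>p. m + n - 2 * p" and ?s = "zeta_gen \<omega> g"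
  have "CG_map m n (act LD (generator (K_relators \<omega>) g) x) = CG_map m n (\<lambda>p. sl2_op (?N p) ?s (x p))"
    using LD_supp[OF x] by (intro CG_map_cong) (simp add: direct_sum_def act_L_mod_generator)
  also have "\<dots> = lin_ext (\<lambda>h. CG_map m n (\<lambda>p. L_op (?N p) h (x p))) ?s"
    by (simp add: CG_map_def sl2_op_def lin_ext_lin_ext lin_ext_fun_sum)
  also have "\<dots> = T_sl2_op m n ?s (CG_map m n x)"
    unfolding T_sl2_op_def by (intro lin_ext_cong CG_map_L_op LD_supp[OF x])
  finally show ?thesis .
qed

end

theorem theorem2p6:
  fixes \<omega> :: complex and m n :: nat
  shows "alg_module_isomorphic (K_alg \<omega>)
    (K_tensor \<omega> (L_mod \<omega> m) (L_mod \<omega> n))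
    (direct_sum {0..min m n} (\<lambda>p. L_mod \<omega> (m + n - 2 * p)))"
proof -
  let ?T = "K_tensor \<omega> (L_mod \<omega> m) (L_mod \<omega> n)" and ?D = "direct_sum {0..min m n} (\<lambda>p. L_mod \<omega> (m + n - 2 * p))"
  let ?inv = "inv_into (carrier ?D) (CG_map m n)"
  let ?h = "\<lambda>X. ?inv (T_coords m n X)"
  note T = left_module_LT[of \<omega> m n] and D = left_module_LD[of \<omega> m n]
  note bij = bij_betw_CG_map[of m n \<omega>] and bijT = bij_betw_T_coords[of m n \<omega>]
  have inv: "?inv \<in> lin_maps (free_space ({..m} \<times> {..n})) ?D"
    by (rule inv_into_lin_maps[OF left_module.vector_space[OF D] CG_map_lin_maps bij])
  have coords: "T_coords m n \<in> lin_maps ?T (free_space ({..m} \<times> {..n}))"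
    using T_coords_lin_maps[of m n \<omega>] by (simp add: lin_maps_def)
  have h: "?h \<in> lin_maps ?T ?D" by (rule lin_maps_comp[OF coords inv])
  have Ch: "CG_map m n (?h X) = T_coords m n X" if "X \<in> carrier ?T" for X
    using lin_mapsD(1)[OF coords that] bij by (auto simp: bij_betw_def f_inv_into_f)
  have "?h \<in> alg_module_hom (presented_algebra (K_relators \<omega>)) ?T ?D"
  proof (rule presented_module_hom[OF T[unfolded K_alg_def] D[unfolded K_alg_def] h])
    fix g X assume X: "X \<in> carrier ?T"
    let ?a = "generator (K_relators \<omega>) g"
    have a: "?a \<in> carrier (K_alg \<omega>)" by (simp add: K_alg_def)
    have aX: "act ?T ?a X \<in> carrier ?T" by (rule left_module.act_closed[OF T a X])
    \<comment> \<open>The intertwining property is proved after applying the injective map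
      \<open>CG_map\<close>: both sides then become the same operator on coordinates, and no formula
      for the inverse is required.\<close>
    have "CG_map m n (?h (act ?T ?a X)) = T_sl2_op m n (zeta_gen \<omega> g) (CG_map m n (?h X))"
      unfolding Ch[OF aX] Ch[OF X] by (rule T_coords_act[OF X])
    also have "\<dots> = CG_map m n (act ?D ?a (?h X))"
      by (rule CG_map_act[OF lin_mapsD(1)[OF h X], symmetric])
    finally show "?h (act ?T ?a X) = act ?D ?a (?h X)"
      using bij lin_mapsD(1)[OF h] left_module.act_closed[OF D a] aX X
      by (auto simp: bij_betw_def dest: inj_onD)
  qed
  moreover have "bij_betw ?h (carrier ?T) (carrier ?D)"
    using bij_betw_trans[OF bijT bij_betw_inv_into[OF bij]] by (simp add: comp_def)
  ultimately show ?thesis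
    using T D unfolding alg_module_isomorphic_def K_alg_def by blast
qed

end
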